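(* Let $k$ be a commutative ring and let $\mathcal{H}=(\mathcal{H}_L,\mathcal{H}_R,S)$ be a Hopf algebroid over base $k$-algebras $L$ and $R$ with bijective antipode $S$. If two $\mathcal{H}$-categories $\mathcal{C}$ and $\mathcal{C}'$ are $\mathcal{H}$-equivariantly equivalent, then for any fixed stable left-left $\mathcal{H}$-module/comodule $M$ the cyclic right $\mathcal{H}$-modules $\mathcal{Q}_\bullet(\mathcal{C},M)$ and $\mathcal{Q}_\bullet(\mathcal{C}',M)$ are $\mathcal{H}$-equivariantly homotopy equivalent.
   Context: **Bialgebroids.** A left bialgebroid $\mathcal{H}_L=(H,L,s_L,t_L,\Delta_L,\varepsilon_L)$ consists of $k$-algebras $H$ (total) and $L$ (base), algebra maps $s_L:L\to H$, $t_L:L^{op}\to H$ with commuting images, making $H$ an $L$-$L$-bimodule by $l\cdot h\cdot l'=s_L(l)t_L(l')h$, and an $L$-coring structure $(H,\Delta_L,\varepsilon_L)$, $\Delta_L(h)=h_{(1)}\otimes_L h_{(2)}$, with $h_{(1)}t_L(l)\otimes_L h_{(2)}=h_{(1)}\otimes_L h_{(2)}s_L(l)$, $\Delta_L(1)=1\otimes_L 1$, $\Delta_L(hg)=\Delta_L(h)\Delta_L(g)$, $\varepsilon_L(1)=1$, $\varepsilon_L(hs_L\varepsilon_L(g))=\varepsilon_L(hg)=\varepsilon_L(ht_L\varepsilon_L(g))$. A right bialgebroid $\mathcal{H}_R=(H,R,s_R,t_R,\Delta_R,\varepsilon_R)$ is the mirror notion: $s_R:R\to H$, $t_R:R^{op}\to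 H$ algebra maps with commuting images, $r\cdot h\cdot r'=h\,t_R(r)s_R(r')$, an $R$-coring $(H,\Delta_R,\varepsilon_R)$, $\Delta_R(h)=h^{(1)}\otimes_R h^{(2)}$, with $s_R(r)h^{(1)}\otimes_R h^{(2)}=h^{(1)}\otimes_R t_R(r)h^{(2)}$, $\Delta_R$ unital and multiplicative, $\varepsilon_R(1)=1$, $\varepsilon_R(s_R\varepsilon_R(h)g)=\varepsilon_R(hg)=\varepsilon_R(t_R\varepsilon_R(h)g)$. **Hopf algebroid.** $\mathcal{H}=(\mathcal{H}_L,\mathcal{H}_R,S)$: a left and a right bialgebroid on the same total algebra $H$ and a $k$-linear map $S:H\to H$ with $s_L\varepsilon_Lt_R=t_R$, $t_L\varepsilon_Ls_R=s_R$, $s_R\varepsilon_Rt_L=t_L$, $t_R\varepsilon_Rs_L=s_L$; $(\Delta_L\otimes_R id)\Delta_R=(id\otimes_L\Delta_R)\Delta_L$, $(\Delta_R\otimes_L id)\Delta_L=(id\otimes_R\Delta_L)\Delta_R$; $S(t_L(l)ht_R(r))=s_R(r)S(h)s_L(l)$; $S(h_{(1)})h_{(2)}=s_R\varepsilon_R(h)$, $h^{(1)}S(h^{(2)})=s_L\varepsilon_L(h)$. The algebras $L$ and $R$ are anti-isomorphic. A left (right) $\mathcal{H}$-module is a left (right) $H$-module; a left one is an $L$-$L$-bimodule by $l\cdot m\cdot l'=s_L(l)t_L(l')m$, a right one is an $R$-$R$-bimodule by $r\cdot m\cdot r'=m\,t_R(r)s_R(r')$. **$\mathcal{H}$-categories.**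 A small $k$-linear category $\mathcal{C}$ is an $\mathcal{H}$-category if each $\mathrm{Hom}_{\mathcal{C}}(X,Y)$ is a left $\mathcal{H}$-module (hence an $L$-$L$-bimodule, $l\cdot f\cdot l'=s_L(l)t_L(l')f$) with $l\cdot id_X=id_X\cdot l$, $h(id_X)=s_L\varepsilon_L(h)id_X=t_L\varepsilon_L(h)id_X$, and $h(fg)=(h_{(1)}f)(h_{(2)}g)$ for composable $f,g$. A morphism $f$ is $\mathcal{H}$-invariant if $h(f)=s_L\varepsilon_L(h)f=t_L\varepsilon_L(h)f$ for all $h$. An $\mathcal{H}$-equivariant functor is a $k$-linear functor that is $\mathcal{H}$-linear on Hom-modules. $\mathcal{C},\mathcal{C}'$ are $\mathcal{H}$-equivariantly equivalent if there are $\mathcal{H}$-equivariant functors $\mathcal{F}:\mathcal{C}\to\mathcal{C}'$, $\mathcal{G}:\mathcal{C}'\to\mathcal{C}$ and natural isomorphisms $\mathcal{G}\mathcal{F}\cong id_{\mathcal{C}}$, $\mathcal{F}\mathcal{G}\cong id_{\mathcal{C}'}$ whose components are $\mathcal{H}$-invariant. **Coefficients.** A left $\mathcal{H}$-comodule is a $k$-module $M$ that is a left comodule over the $L$-coring $(H,\Delta_L,\varepsilon_L)$, $m\mapsto m_{[-1]}\otimes_L m_{[0]}$, and over the $R$-coring $(H,\Delta_R,\varepsilon_R)$, $m\mapsto m^{[-1]}\otimes_R m^{[0]}$, with $L$-$L$ and $R$-$R$ bimodule structures related by $l\cdot m\cdot l'=\varepsilon_Rs_L(l')\cdot m\cdot\varepsilon_Rs_L(l)$,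 and $(id\otimes_L\lambda_R)\lambda_L=(\Delta_L\otimes_R id)\lambda_R$, $(id\otimes_R\lambda_L)\lambda_R=(\Delta_R\otimes_L id)\lambda_L$, where $\lambda_L,\lambda_R$ are the two coactions. A left-left $\mathcal{H}$-module/comodule is a left $\mathcal{H}$-module that is also a left $\mathcal{H}$-comodule (no compatibility assumed); it is stable if $m_{[-1]}m_{[0]}=m=m^{[-1]}m^{[0]}$ for all $m$. **Cyclic modules.** A cyclic right $\mathcal{H}$-module is a cyclic object in right $\mathcal{H}$-modules; a para-cyclic one drops only $\tau_n^{n+1}=id$; a pseudo para-cyclic one moreover does not require $\tau_n$ and the last face $d_n:X_n\to X_{n-1}$ to be $\mathcal{H}$-linear. For an $\mathcal{H}$-category $\mathcal{C}$ and a stable left-left $M$, the pseudo para-cyclic right $\mathcal{H}$-module $\mathcal{T}_\bullet(\mathcal{C},M)$ is $$\mathcal{T}_n(\mathcal{C},M)=\bigoplus_{(X_0,\dots,X_n)}\mathrm{Hom}(X_1,X_0)\otimes_L\cdots\otimes_L\mathrm{Hom}(X_n,X_{n-1})\otimes_L\mathrm{Hom}(X_0,X_n)\otimes_L M,$$ with $d_i(f_0\otimes\cdots\otimes f_n\otimes m)=f_0\otimes\cdots\otimes f_if_{i+1}\otimes\cdots\otimes f_n\otimes m$ for $0\le i\le n-1$, $d_n(f_0\otimes\cdots\otimes f_n\otimes m)=(m_{[-1]}f_n)f_0\otimes f_1\otimes\cdots\otimes f_{n-1}\otimes m_{[0]}$; $s_i$ inserts $id_{X_{i+1}}$ after $f_i$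 for $0\le i\le n-1$, and $s_n$ inserts $id_{X_0}$ after $f_n$; $\tau_n(f_0\otimes\cdots\otimes f_n\otimes m)=m_{[-1]}f_n\otimes f_0\otimes\cdots\otimes f_{n-1}\otimes m_{[0]}$; and right action $(f_0\otimes\cdots\otimes f_n\otimes m)h=S^{-1}(h)_{(1)}f_0\otimes\cdots\otimes S^{-1}(h)_{(n+1)}f_n\otimes S^{-1}(h)_{(n+2)}m$ (tensors over $L$, iterated $\Delta_L$). Let $\rho_n:\mathcal{T}_n\otimes\mathcal{H}\to\mathcal{T}_n$ be the action. $\mathcal{Q}^{\mathcal{H}}_n(\mathcal{C},M)$ is the colimit over $j\in\mathbb{N}$, in $R$-$R$-bimodules, of the coequalizers $\mathcal{T}_n\to\mathcal{T}_n^{j}$ of the pairs $\rho_n(\tau_n^j\otimes id)$, $\tau_n^j\rho_n$ (i.e. the universal quotient of $\mathcal{T}_n$ coequalizing all these pairs); it is a para-cyclic right $\mathcal{H}$-module with induced structure. $\mathcal{Q}_n(\mathcal{C},M)$ is the equalizer of $\tau_n^{n+1}$ and $id$ on $\mathcal{Q}^{\mathcal{H}}_n(\mathcal{C},M)$; $\mathcal{Q}_\bullet(\mathcal{C},M)$ is a cyclic right $\mathcal{H}$-module. **Homotopy equivalence.** A semi-cyclic map of cyclic $\mathcal{H}$-modules is a map of graded $\mathcal{H}$-modules commuting with faces and cyclic operators (not necessarily degeneracies). Cyclic $\mathcal{H}$-modules $X_\bullet,Y_\bullet$ are $\mathcal{H}$-equivariantly homotopy equivalent if there are semi-cyclic $\mathcal{H}$-module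 maps $X_\bullet\to Y_\bullet$ and $Y_\bullet\to X_\bullet$ whose two composites are homotopic, through $\mathcal{H}$-module maps (presimplicial homotopy), to the identities.
   Formalization: It is additionally assumed, for both C and C', that the cyclic operators τ_n are well defined on T_n and that Q^H with the induced structure is a para-cyclic right H-module; the stated setting does not guarantee this, since τ_n need not be balanced over L. *)

theory Defs
  imports
    "HOL.Modules"
    "HOL-Algebra.Free_Abelian_Groups"
    "HOL-Computational_Algebra.Group_Closure"
begin

section \<open>Tensors over a noncommutative base\<close>

text \<open>
  An element of a tensor product is given by a representative in the free abelian group on the
  simple tensors, and \<open>tensor_rel\<close>, \<open>tensor3_rel\<close> are the subgroups divided out. A map into a
  tensor product (a coproduct, a coaction) is accordingly given by a choice of Sweedler
  representatives, and all identities between tensors are stated modulo these subgroups.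
\<close>

definition tensor_rel ::
  "('a::ab_group_add \<Rightarrow> 's \<Rightarrow> 'a) \<Rightarrow> ('s \<Rightarrow> 'b::ab_group_add \<Rightarrow> 'b) \<Rightarrow> ('a \<times> 'b \<Rightarrow>\<^sub>0 int) set" where
  "tensor_rel r l = group_closure
     ({frag_of (a + a', b) - frag_of (a, b) - frag_of (a', b) | a a' b. True} \<union>
      {frag_of (a, b + b') - frag_of (a, b) - frag_of (a, b') | a b b'. True} \<union>
      {frag_of (r a s, b) - frag_of (a, l s b) | a s b. True})"

definition tensor3_rel ::
  "('a::ab_group_add \<Rightarrow> 's \<Rightarrow> 'a) \<Rightarrow> ('s \<Rightarrow> 'b::ab_group_add \<Rightarrow> 'b) \<Rightarrow>
   ('b \<Rightarrow> 'u \<Rightarrow> 'b) \<Rightarrow> ('u \<Rightarrow> 'c::ab_group_add \<Rightarrow> 'c) \<Rightarrow> ('a \<times> 'b \<times> 'c \<Rightarrow>\<^sub>0 int) set" where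
  "tensor3_rel r l r' l' = group_closure
     ({frag_of (a + a', b, c) - frag_of (a, b, c) - frag_of (a', b, c) | a a' b c. True} \<union>
      {frag_of (a, b + b', c) - frag_of (a, b, c) - frag_of (a, b', c) | a b b' c. True} \<union>
      {frag_of (a, b, c + c') - frag_of (a, b, c) - frag_of (a, b, c') | a b c c'. True} \<union>
      {frag_of (r a s, b, c) - frag_of (a, l s b, c) | a s b c. True} \<union>
      {frag_of (a, r' b u, c) - frag_of (a, b, l' u c) | a b u c. True})"

definition int_scale :: "int \<Rightarrow> 'a::ab_group_add \<Rightarrow> 'a" where
  "int_scale n x = (\<Sum>i<nat n. x) - (\<Sum>i<nat (- n). x)"

definition frag_eval :: "('x \<Rightarrow> 'a::ab_group_add) \<Rightarrow> ('x \<Rightarrow>\<^sub>0 int) \<Rightarrow> 'a" where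
  "frag_eval f c = (\<Sum>x\<in>Poly_Mapping.keys c. int_scale (Poly_Mapping.lookup c x) (f x))"

text \<open>\<open>frag_map2 f g\<close> is \<open>f \<otimes> g\<close> on representatives; \<open>cop_left\<close> and \<open>cop_right\<close> are
  \<open>D \<otimes> id\<close> and \<open>id \<otimes> D\<close>.\<close>

definition frag_map2 :: "('a \<Rightarrow> 'c) \<Rightarrow> ('b \<Rightarrow> 'd) \<Rightarrow> ('a \<times> 'b \<Rightarrow>\<^sub>0 int) \<Rightarrow> ('c \<times> 'd \<Rightarrow>\<^sub>0 int)" where
  "frag_map2 f g = frag_extend (\<lambda>(a, b). frag_of (f a, g b))"

definition cop_left :: "('a \<Rightarrow> ('b \<times> 'c \<Rightarrow>\<^sub>0 int)) \<Rightarrow> ('a \<times> 'd \<Rightarrow>\<^sub>0 int) \<Rightarrow> ('b \<times> 'c \<times> 'd \<Rightarrow>\<^sub>0 int)" where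
  "cop_left D = frag_extend (\<lambda>(a, d). frag_extend (\<lambda>(b, c). frag_of (b, c, d)) (D a))"

definition cop_right :: "('d \<Rightarrow> ('b \<times> 'c \<Rightarrow>\<^sub>0 int)) \<Rightarrow> ('a \<times> 'd \<Rightarrow>\<^sub>0 int) \<Rightarrow> ('a \<times> 'b \<times> 'c \<Rightarrow>\<^sub>0 int)" where
  "cop_right D = frag_extend (\<lambda>(a, d). frag_extend (\<lambda>(b, c). frag_of (a, b, c)) (D d))"

definition frag_mult :: "('h::times \<times> 'h \<Rightarrow>\<^sub>0 int) \<Rightarrow> ('h \<times> 'h \<Rightarrow>\<^sub>0 int) \<Rightarrow> ('h \<times> 'h \<Rightarrow>\<^sub>0 int)" where
  "frag_mult x y = frag_extend (\<lambda>(a, b). frag_extend (\<lambda>(c, d). frag_of (a * c, b * d)) y) x"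


section \<open>Hopf algebroids\<close>

definition k_algebra :: "('k::comm_ring_1 \<Rightarrow> 'a::ring_1 \<Rightarrow> 'a) \<Rightarrow> bool" where
  "k_algebra sc \<longleftrightarrow> Modules.module sc \<and>
     (\<forall>c a b. sc c (a * b) = sc c a * b \<and> sc c (a * b) = a * sc c b)"

definition algebra_map ::
  "('k::comm_ring_1 \<Rightarrow> 'a::ring_1 \<Rightarrow> 'a) \<Rightarrow> ('k \<Rightarrow> 'b::ring_1 \<Rightarrow> 'b) \<Rightarrow> ('a \<Rightarrow> 'b) \<Rightarrow> bool" where
  "algebra_map sa sb f \<longleftrightarrow> module_hom sa sb f \<and> f 1 = 1 \<and> (\<forall>x y. f (x * y) = f x * f y)"

definition anti_algebra_map ::
  "('k::comm_ring_1 \<Rightarrow> 'a::ring_1 \<Rightarrow> 'a) \<Rightarrow> ('k \<Rightarrow> 'b::ring_1 \<Rightarrow> 'b) \<Rightarrow> ('a \<Rightarrow> 'b) \<Rightarrow> bool" where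
  "anti_algebra_map sa sb f \<longleftrightarrow> module_hom sa sb f \<and> f 1 = 1 \<and> (\<forall>x y. f (x * y) = f y * f x)"

record ('k, 'l, 'r, 'h) hopf_algebroid =
  scH :: "'k \<Rightarrow> 'h \<Rightarrow> 'h"
  scL :: "'k \<Rightarrow> 'l \<Rightarrow> 'l"
  scR :: "'k \<Rightarrow> 'r \<Rightarrow> 'r"
  sL :: "'l \<Rightarrow> 'h"
  tL :: "'l \<Rightarrow> 'h"
  DeltaL :: "'h \<Rightarrow> ('h \<times> 'h \<Rightarrow>\<^sub>0 int)"
  epsL :: "'h \<Rightarrow> 'l"
  sR :: "'r \<Rightarrow> 'h"
  tR :: "'r \<Rightarrow> 'h"
  DeltaR :: "'h \<Rightarrow> ('h \<times> 'h \<Rightarrow>\<^sub>0 int)"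
  epsR :: "'h \<Rightarrow> 'r"
  antipode :: "'h \<Rightarrow> 'h"

text \<open>The one-sided actions in \<open>l \<cdot> h \<cdot> l' = s\<^sub>L(l) t\<^sub>L(l') h\<close> and \<open>r \<cdot> h \<cdot> r' = h t\<^sub>R(r) s\<^sub>R(r')\<close>.\<close>

definition lactL :: "('k, 'l, 'r, 'h::ring_1) hopf_algebroid \<Rightarrow> 'l \<Rightarrow> 'h \<Rightarrow> 'h" where
  "lactL A l h = sL A l * h"
definition ractL :: "('k, 'l, 'r, 'h::ring_1) hopf_algebroid \<Rightarrow> 'h \<Rightarrow> 'l \<Rightarrow> 'h" where
  "ractL A h l = tL A l * h"
definition lactR :: "('k, 'l, 'r, 'h::ring_1) hopf_algebroid \<Rightarrow> 'r \<Rightarrow> 'h \<Rightarrow> 'h" where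
  "lactR A r h = h * tR A r"
definition ractR :: "('k, 'l, 'r, 'h::ring_1) hopf_algebroid \<Rightarrow> 'h \<Rightarrow> 'r \<Rightarrow> 'h" where
  "ractR A h r = h * sR A r"

definition HLH_rel :: "('k, 'l, 'r, 'h::ring_1) hopf_algebroid \<Rightarrow> ('h \<times> 'h \<Rightarrow>\<^sub>0 int) set" where
  "HLH_rel A = tensor_rel (ractL A) (lactL A)"
definition HRH_rel :: "('k, 'l, 'r, 'h::ring_1) hopf_algebroid \<Rightarrow> ('h \<times> 'h \<Rightarrow>\<^sub>0 int) set" where
  "HRH_rel A = tensor_rel (ractR A) (lactR A)"

definition left_bialgebroid ::
  "('k::comm_ring_1, 'l::ring_1, 'r::ring_1, 'h::ring_1) hopf_algebroid \<Rightarrow> bool" where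
  "left_bialgebroid A \<longleftrightarrow>
     k_algebra (scH A) \<and> k_algebra (scL A) \<and>
     algebra_map (scL A) (scH A) (sL A) \<and> anti_algebra_map (scL A) (scH A) (tL A) \<and>
     (\<forall>l l'. sL A l * tL A l' = tL A l' * sL A l) \<and>
     (\<comment> \<open>coring over \<open>L\<close>\<close>
      (\<forall>g h. DeltaL A (g + h) - (DeltaL A g + DeltaL A h) \<in> HLH_rel A) \<and>
      (\<forall>l l' h. DeltaL A (sL A l * tL A l' * h)
          - frag_map2 (lactL A l) (\<lambda>g. ractL A g l') (DeltaL A h) \<in> HLH_rel A) \<and>
      (\<forall>h. cop_left (DeltaL A) (DeltaL A h) - cop_right (DeltaL A) (DeltaL A h)
          \<in> tensor3_rel (ractL A) (lactL A) (ractL A) (lactL A)) \<and>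
      (\<forall>g h. epsL A (g + h) = epsL A g + epsL A h) \<and>
      (\<forall>l l' h. epsL A (sL A l * tL A l' * h) = l * epsL A h * l') \<and>
      (\<forall>h. frag_eval (\<lambda>(a, b). lactL A (epsL A a) b) (DeltaL A h) = h) \<and>
      (\<forall>h. frag_eval (\<lambda>(a, b). ractL A a (epsL A b)) (DeltaL A h) = h)) \<and>
     (\<forall>l h. frag_map2 (\<lambda>a. a * tL A l) id (DeltaL A h)
          - frag_map2 id (\<lambda>b. b * sL A l) (DeltaL A h) \<in> HLH_rel A) \<and>
     DeltaL A 1 - frag_of (1, 1) \<in> HLH_rel A \<and>
     (\<forall>g h. DeltaL A (h * g) - frag_mult (DeltaL A h) (DeltaL A g) \<in> HLH_rel A) \<and>
     epsL A 1 = 1 \<and>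
     (\<forall>g h. epsL A (h * sL A (epsL A g)) = epsL A (h * g) \<and>
            epsL A (h * tL A (epsL A g)) = epsL A (h * g))"

definition right_bialgebroid ::
  "('k::comm_ring_1, 'l::ring_1, 'r::ring_1, 'h::ring_1) hopf_algebroid \<Rightarrow> bool" where
  "right_bialgebroid A \<longleftrightarrow>
     k_algebra (scH A) \<and> k_algebra (scR A) \<and>
     algebra_map (scR A) (scH A) (sR A) \<and> anti_algebra_map (scR A) (scH A) (tR A) \<and>
     (\<forall>r r'. sR A r * tR A r' = tR A r' * sR A r) \<and>
     (\<comment> \<open>coring over \<open>R\<close>\<close>
      (\<forall>g h. DeltaR A (g + h) - (DeltaR A g + DeltaR A h) \<in> HRH_rel A) \<and>
      (\<forall>r r' h. DeltaR A (h * tR A r * sR A r')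
          - frag_map2 (lactR A r) (\<lambda>g. ractR A g r') (DeltaR A h) \<in> HRH_rel A) \<and>
      (\<forall>h. cop_left (DeltaR A) (DeltaR A h) - cop_right (DeltaR A) (DeltaR A h)
          \<in> tensor3_rel (ractR A) (lactR A) (ractR A) (lactR A)) \<and>
      (\<forall>g h. epsR A (g + h) = epsR A g + epsR A h) \<and>
      (\<forall>r r' h. epsR A (h * tR A r * sR A r') = r * epsR A h * r') \<and>
      (\<forall>h. frag_eval (\<lambda>(a, b). lactR A (epsR A a) b) (DeltaR A h) = h) \<and>
      (\<forall>h. frag_eval (\<lambda>(a, b). ractR A a (epsR A b)) (DeltaR A h) = h)) \<and>
     (\<forall>r h. frag_map2 (\<lambda>a. sR A r * a) id (DeltaR A h)
          - frag_map2 id (\<lambda>b. tR A r * b) (DeltaR A h) \<in> HRH_rel A) \<and>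
     DeltaR A 1 - frag_of (1, 1) \<in> HRH_rel A \<and>
     (\<forall>g h. DeltaR A (h * g) - frag_mult (DeltaR A h) (DeltaR A g) \<in> HRH_rel A) \<and>
     epsR A 1 = 1 \<and>
     (\<forall>g h. epsR A (sR A (epsR A h) * g) = epsR A (h * g) \<and>
            epsR A (tR A (epsR A h) * g) = epsR A (h * g))"

definition is_hopf_algebroid ::
  "('k::comm_ring_1, 'l::ring_1, 'r::ring_1, 'h::ring_1) hopf_algebroid \<Rightarrow> bool" where
  "is_hopf_algebroid A \<longleftrightarrow>
     left_bialgebroid A \<and> right_bialgebroid A \<and> module_hom (scH A) (scH A) (antipode A) \<and>
     (\<forall>r. sL A (epsL A (tR A r)) = tR A r) \<and> (\<forall>r. tL A (epsL A (sR A r)) = sR A r) \<and>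
     (\<forall>l. sR A (epsR A (tL A l)) = tL A l) \<and> (\<forall>l. tR A (epsR A (sL A l)) = sL A l) \<and>
     (\<forall>h. cop_left (DeltaL A) (DeltaR A h) - cop_right (DeltaR A) (DeltaL A h)
          \<in> tensor3_rel (ractL A) (lactL A) (ractR A) (lactR A)) \<and>
     (\<forall>h. cop_left (DeltaR A) (DeltaL A h) - cop_right (DeltaL A) (DeltaR A h)
          \<in> tensor3_rel (ractR A) (lactR A) (ractL A) (lactL A)) \<and>
     (\<forall>l r h. antipode A (tL A l * h * tR A r) = sR A r * antipode A h * sL A l) \<and>
     (\<forall>h. frag_eval (\<lambda>(a, b). antipode A a * b) (DeltaL A h) = sR A (epsR A h)) \<and>
     (\<forall>h. frag_eval (\<lambda>(a, b). a * antipode A b) (DeltaR A h) = sL A (epsL A h))"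


section \<open>Categories with an action of a Hopf algebroid\<close>

text \<open>
  The Hom-modules are subgroups of one abelian group (for instance of their direct sum), so that
  composition, scalars and the action need not be indexed by objects. \<open>Hom C X Y\<close> consists of the
  morphisms from \<open>X\<close> to \<open>Y\<close>, and \<open>Cmp C f g\<close> is \<open>f\<close> after \<open>g\<close>.
\<close>

record ('k, 'h, 'o, 'f) hcat =
  Obj :: "'o set"
  Hom :: "'o \<Rightarrow> 'o \<Rightarrow> 'f set"
  Idm :: "'o \<Rightarrow> 'f"
  Cmp :: "'f \<Rightarrow> 'f \<Rightarrow> 'f"
  ksc :: "'k \<Rightarrow> 'f \<Rightarrow> 'f"
  hact :: "'h \<Rightarrow> 'f \<Rightarrow> 'f"

definition left_module_on ::
  "('k::comm_ring_1 \<Rightarrow> 'h::ring_1 \<Rightarrow> 'h) \<Rightarrow> 'e::ab_group_add set \<Rightarrow> ('k \<Rightarrow> 'e \<Rightarrow> 'e) \<Rightarrow> ('h \<Rightarrow> 'e \<Rightarrow> 'e) \<Rightarrow> bool"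
  where
  "left_module_on sch E sc act \<longleftrightarrow>
     0 \<in> E \<and> (\<forall>x\<in>E. \<forall>y\<in>E. x - y \<in> E) \<and>
     (\<forall>h. \<forall>x\<in>E. act h x \<in> E) \<and> (\<forall>c. \<forall>x\<in>E. sc c x \<in> E) \<and>
     (\<forall>h. \<forall>x\<in>E. \<forall>y\<in>E. act h (x + y) = act h x + act h y) \<and>
     (\<forall>g h. \<forall>x\<in>E. act (g + h) x = act g x + act h x) \<and>
     (\<forall>g h. \<forall>x\<in>E. act (g * h) x = act g (act h x)) \<and>
     (\<forall>x\<in>E. act 1 x = x) \<and>
     (\<forall>c. \<forall>x\<in>E. sc c x = act (sch c 1) x)"

definition H_category ::
  "('k::comm_ring_1, 'l::ring_1, 'r::ring_1, 'h::ring_1) hopf_algebroid \<Rightarrow>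
   ('k, 'h, 'o, 'f::ab_group_add) hcat \<Rightarrow> bool" where
  "H_category A C \<longleftrightarrow>
     (\<forall>X\<in>Obj C. \<forall>Y\<in>Obj C. left_module_on (scH A) (Hom C X Y) (ksc C) (hact C)) \<and>
     (\<comment> \<open>\<open>k\<close>-linear category\<close>
      (\<forall>X\<in>Obj C. Idm C X \<in> Hom C X X) \<and>
      (\<forall>X\<in>Obj C. \<forall>Y\<in>Obj C. \<forall>f\<in>Hom C X Y. Cmp C f (Idm C X) = f \<and> Cmp C (Idm C Y) f = f) \<and>
      (\<forall>X\<in>Obj C. \<forall>Y\<in>Obj C. \<forall>Z\<in>Obj C. \<forall>f\<in>Hom C Y Z. \<forall>g\<in>Hom C X Y. Cmp C f g \<in> Hom C X Z) \<and>
      (\<forall>W\<in>Obj C. \<forall>X\<in>Obj C. \<forall>Y\<in>Obj C. \<forall>Z\<in>Obj C.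
         \<forall>f\<in>Hom C Y Z. \<forall>g\<in>Hom C X Y. \<forall>e\<in>Hom C W X. Cmp C (Cmp C f g) e = Cmp C f (Cmp C g e)) \<and>
      (\<forall>X\<in>Obj C. \<forall>Y\<in>Obj C. \<forall>Z\<in>Obj C. \<forall>f\<in>Hom C Y Z. \<forall>f'\<in>Hom C Y Z. \<forall>g\<in>Hom C X Y.
         Cmp C (f + f') g = Cmp C f g + Cmp C f' g) \<and>
      (\<forall>X\<in>Obj C. \<forall>Y\<in>Obj C. \<forall>Z\<in>Obj C. \<forall>f\<in>Hom C Y Z. \<forall>g\<in>Hom C X Y. \<forall>g'\<in>Hom C X Y.
         Cmp C f (g + g') = Cmp C f g + Cmp C f g') \<and>
      (\<forall>X\<in>Obj C. \<forall>Y\<in>Obj C. \<forall>Z\<in>Obj C. \<forall>f\<in>Hom C Y Z. \<forall>g\<in>Hom C X Y. \<forall>c.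
         Cmp C (ksc C c f) g = ksc C c (Cmp C f g) \<and> Cmp C f (ksc C c g) = ksc C c (Cmp C f g))) \<and>
     (\<forall>X\<in>Obj C. \<forall>l. hact C (sL A l) (Idm C X) = hact C (tL A l) (Idm C X)) \<and>
     (\<forall>X\<in>Obj C. \<forall>h. hact C h (Idm C X) = hact C (sL A (epsL A h)) (Idm C X) \<and>
                      hact C h (Idm C X) = hact C (tL A (epsL A h)) (Idm C X)) \<and>
     (\<comment> \<open>\<open>h(fg) = (h\<^sub>1 f)(h\<^sub>2 g)\<close>, for every representative of \<open>h\<^sub>1 \<otimes>\<^sub>L h\<^sub>2\<close>\<close>
      \<forall>X\<in>Obj C. \<forall>Y\<in>Obj C. \<forall>Z\<in>Obj C. \<forall>f\<in>Hom C Y Z. \<forall>g\<in>Hom C X Y. \<forall>h w.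
         w - DeltaL A h \<in> HLH_rel A \<longrightarrow>
         hact C h (Cmp C f g) = frag_eval (\<lambda>(a, b). Cmp C (hact C a f) (hact C b g)) w)"

definition H_invariant ::
  "('k, 'l, 'r, 'h) hopf_algebroid \<Rightarrow> ('k, 'h, 'o, 'f) hcat \<Rightarrow> 'f \<Rightarrow> bool" where
  "H_invariant A C f \<longleftrightarrow>
     (\<forall>h. hact C h f = hact C (sL A (epsL A h)) f \<and> hact C h f = hact C (tL A (epsL A h)) f)"

definition H_functor ::
  "('k, 'h, 'o, 'f::ab_group_add) hcat \<Rightarrow> ('k, 'h, 'p, 'g::ab_group_add) hcat \<Rightarrow>
   ('o \<Rightarrow> 'p) \<Rightarrow> ('f \<Rightarrow> 'g) \<Rightarrow> bool" where
  "H_functor C D Fo Fm \<longleftrightarrow>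
     (\<forall>X\<in>Obj C. Fo X \<in> Obj D \<and> Fm (Idm C X) = Idm D (Fo X)) \<and>
     (\<forall>X\<in>Obj C. \<forall>Y\<in>Obj C. \<forall>f\<in>Hom C X Y. Fm f \<in> Hom D (Fo X) (Fo Y)) \<and>
     (\<forall>X\<in>Obj C. \<forall>Y\<in>Obj C. \<forall>Z\<in>Obj C. \<forall>f\<in>Hom C Y Z. \<forall>g\<in>Hom C X Y.
        Fm (Cmp C f g) = Cmp D (Fm f) (Fm g)) \<and>
     (\<forall>X\<in>Obj C. \<forall>Y\<in>Obj C. \<forall>f\<in>Hom C X Y. \<forall>g\<in>Hom C X Y. Fm (f + g) = Fm f + Fm g) \<and>
     (\<forall>X\<in>Obj C. \<forall>Y\<in>Obj C. \<forall>f\<in>Hom C X Y. \<forall>c. Fm (ksc C c f) = ksc D c (Fm f)) \<and>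
     (\<forall>X\<in>Obj C. \<forall>Y\<in>Obj C. \<forall>f\<in>Hom C X Y. \<forall>h. Fm (hact C h f) = hact D h (Fm f))"

text \<open>An invariant natural isomorphism from the endofunctor \<open>(Po, Pm)\<close> to the identity.\<close>

definition invariant_iso_to_id ::
  "('k, 'l, 'r, 'h) hopf_algebroid \<Rightarrow> ('k, 'h, 'o, 'f) hcat \<Rightarrow>
   ('o \<Rightarrow> 'o) \<Rightarrow> ('f \<Rightarrow> 'f) \<Rightarrow> ('o \<Rightarrow> 'f) \<Rightarrow> bool" where
  "invariant_iso_to_id A C Po Pm \<eta> \<longleftrightarrow>
     (\<forall>X\<in>Obj C. \<eta> X \<in> Hom C (Po X) X \<and> H_invariant A C (\<eta> X) \<and>
        (\<exists>\<theta>\<in>Hom C X (Po X). Cmp C (\<eta> X) \<theta> = Idm C X \<and> Cmp C \<theta> (\<eta> X) = Idm C (Po X))) \<and>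
     (\<forall>X\<in>Obj C. \<forall>Y\<in>Obj C. \<forall>f\<in>Hom C X Y. Cmp C f (\<eta> X) = Cmp C (\<eta> Y) (Pm f))"

definition equivariantly_equivalent ::
  "('k, 'l, 'r, 'h) hopf_algebroid \<Rightarrow> ('k, 'h, 'o, 'f::ab_group_add) hcat \<Rightarrow>
   ('k, 'h, 'p, 'g::ab_group_add) hcat \<Rightarrow> bool" where
  "equivariantly_equivalent A C D \<longleftrightarrow>
     (\<exists>Fo Fm Go Gm \<eta> \<theta>. H_functor C D Fo Fm \<and> H_functor D C Go Gm \<and>
        invariant_iso_to_id A C (Go \<circ> Fo) (Gm \<circ> Fm) \<eta> \<and>
        invariant_iso_to_id A D (Fo \<circ> Go) (Fm \<circ> Gm) \<theta>)"


section \<open>Coefficients\<close>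

text \<open>\<open>lML\<close>, \<open>rML\<close>, \<open>lMR\<close>, \<open>rMR\<close> are the bimodule structures belonging to the comodule structure;
  the module structure \<open>actM\<close> carries its own \<open>L\<close>-\<open>L\<close>-bimodule structure, and the two are not
  required to agree.\<close>

record ('k, 'l, 'r, 'h, 'm) mod_comod =
  scM :: "'k \<Rightarrow> 'm \<Rightarrow> 'm"
  actM :: "'h \<Rightarrow> 'm \<Rightarrow> 'm"
  lML :: "'l \<Rightarrow> 'm \<Rightarrow> 'm"
  rML :: "'m \<Rightarrow> 'l \<Rightarrow> 'm"
  lMR :: "'r \<Rightarrow> 'm \<Rightarrow> 'm"
  rMR :: "'m \<Rightarrow> 'r \<Rightarrow> 'm"
  coL :: "'m \<Rightarrow> ('h \<times> 'm \<Rightarrow>\<^sub>0 int)"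
  coR :: "'m \<Rightarrow> ('h \<times> 'm \<Rightarrow>\<^sub>0 int)"

definition bimodule ::
  "('k::comm_ring_1 \<Rightarrow> 'b::ring_1 \<Rightarrow> 'b) \<Rightarrow> ('k \<Rightarrow> 'm::ab_group_add \<Rightarrow> 'm) \<Rightarrow>
   ('b \<Rightarrow> 'm \<Rightarrow> 'm) \<Rightarrow> ('m \<Rightarrow> 'b \<Rightarrow> 'm) \<Rightarrow> bool" where
  "bimodule scb sc l r \<longleftrightarrow>
     (\<forall>a x y. l a (x + y) = l a x + l a y) \<and> (\<forall>a b x. l (a + b) x = l a x + l b x) \<and>
     (\<forall>a b x. l (a * b) x = l a (l b x)) \<and> (\<forall>x. l 1 x = x) \<and>
     (\<forall>a x y. r (x + y) a = r x a + r y a) \<and> (\<forall>a b x. r x (a + b) = r x a + r x b) \<and>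
     (\<forall>a b x. r x (a * b) = r (r x a) b) \<and> (\<forall>x. r x 1 = x) \<and>
     (\<forall>a b x. r (l a x) b = l a (r x b)) \<and>
     (\<forall>c x. l (scb c 1) x = sc c x \<and> r x (scb c 1) = sc c x)"

definition HLM_rel ::
  "('k, 'l, 'r, 'h::ring_1) hopf_algebroid \<Rightarrow> ('k, 'l, 'r, 'h, 'm::ab_group_add) mod_comod \<Rightarrow>
   ('h \<times> 'm \<Rightarrow>\<^sub>0 int) set" where
  "HLM_rel A M = tensor_rel (ractL A) (lML M)"
definition HRM_rel ::
  "('k, 'l, 'r, 'h::ring_1) hopf_algebroid \<Rightarrow> ('k, 'l, 'r, 'h, 'm::ab_group_add) mod_comod \<Rightarrow>
   ('h \<times> 'm \<Rightarrow>\<^sub>0 int) set" where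
  "HRM_rel A M = tensor_rel (ractR A) (lMR M)"

text \<open>The two conditions marked below are what makes \<open>id \<otimes>\<^sub>L \<lambda>\<^sub>R\<close> and \<open>id \<otimes>\<^sub>R \<lambda>\<^sub>L\<close> defined.\<close>

definition left_comodule ::
  "('k::comm_ring_1, 'l::ring_1, 'r::ring_1, 'h::ring_1) hopf_algebroid \<Rightarrow>
   ('k, 'l, 'r, 'h, 'm::ab_group_add) mod_comod \<Rightarrow> bool" where
  "left_comodule A M \<longleftrightarrow>
     Modules.module (scM M) \<and>
     bimodule (scL A) (scM M) (lML M) (rML M) \<and> bimodule (scR A) (scM M) (lMR M) (rMR M) \<and>
     (\<forall>l l' m. rML M (lML M l m) l' =
        rMR M (lMR M (epsR A (sL A l')) m) (epsR A (sL A l))) \<and>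
     (\<comment> \<open>comodule over the \<open>L\<close>-coring\<close>
      (\<forall>m m'. coL M (m + m') - (coL M m + coL M m') \<in> HLM_rel A M) \<and>
      (\<forall>l m. coL M (lML M l m) - frag_map2 (lactL A l) id (coL M m) \<in> HLM_rel A M) \<and>
      (\<forall>m. cop_left (DeltaL A) (coL M m) - cop_right (coL M) (coL M m)
         \<in> tensor3_rel (ractL A) (lactL A) (ractL A) (lML M)) \<and>
      (\<forall>m. frag_eval (\<lambda>(h, x). lML M (epsL A h) x) (coL M m) = m)) \<and>
     (\<comment> \<open>comodule over the \<open>R\<close>-coring\<close>
      (\<forall>m m'. coR M (m + m') - (coR M m + coR M m') \<in> HRM_rel A M) \<and>
      (\<forall>r m. coR M (lMR M r m) - frag_map2 (lactR A r) id (coR M m) \<in> HRM_rel A M) \<and>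
      (\<forall>m. cop_left (DeltaR A) (coR M m) - cop_right (coR M) (coR M m)
         \<in> tensor3_rel (ractR A) (lactR A) (ractR A) (lMR M)) \<and>
      (\<forall>m. frag_eval (\<lambda>(h, x). lMR M (epsR A h) x) (coR M m) = m)) \<and>
     (\<comment> \<open>\<open>\<lambda>\<^sub>R\<close> is \<open>L\<close>-linear and \<open>\<lambda>\<^sub>L\<close> is \<open>R\<close>-linear\<close>
      (\<forall>l m. coR M (lML M l m) - frag_map2 (lactL A l) id (coR M m) \<in> HRM_rel A M) \<and>
      (\<forall>r m. coL M (lMR M r m) - frag_map2 (lactR A r) id (coL M m) \<in> HLM_rel A M)) \<and>
     (\<forall>m. cop_right (coR M) (coL M m) - cop_left (DeltaL A) (coR M m)
         \<in> tensor3_rel (ractL A) (lactL A) (ractR A) (lMR M)) \<and>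
     (\<forall>m. cop_right (coL M) (coR M m) - cop_left (DeltaR A) (coL M m)
         \<in> tensor3_rel (ractR A) (lactR A) (ractL A) (lML M))"

text \<open>Since \<open>actM\<close> and the comodule bimodule structures are unrelated, the product
  \<open>h \<otimes> m \<mapsto> hm\<close> need not be balanced; stability is therefore asked of the given
  Sweedler representatives.\<close>

definition stable_mod_comod ::
  "('k::comm_ring_1, 'l::ring_1, 'r::ring_1, 'h::ring_1) hopf_algebroid \<Rightarrow>
   ('k, 'l, 'r, 'h, 'm::ab_group_add) mod_comod \<Rightarrow> bool" where
  "stable_mod_comod A M \<longleftrightarrow>
     left_module_on (scH A) UNIV (scM M) (actM M) \<and> left_comodule A M \<and>
     (\<forall>m. frag_eval (\<lambda>(h, x). actM M h x) (coL M m) = m \<and>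
          frag_eval (\<lambda>(h, x). actM M h x) (coR M m) = m)"


section \<open>Cyclic right modules\<close>

text \<open>The underlying abelian groups are written multiplicatively, as \<open>monoid\<close> records.
  \<open>face X n i\<close> is \<open>d\<^sub>i : X\<^sub>n \<rightarrow> X\<^sub>n\<^sub>-\<^sub>1\<close> and \<open>dgn X n i\<close> is \<open>s\<^sub>i : X\<^sub>n \<rightarrow> X\<^sub>n\<^sub>+\<^sub>1\<close>.\<close>

record ('h, 'e) cyc_data =
  grp :: "nat \<Rightarrow> 'e monoid"
  ract :: "nat \<Rightarrow> 'e \<Rightarrow> 'h \<Rightarrow> 'e"
  face :: "nat \<Rightarrow> nat \<Rightarrow> 'e \<Rightarrow> 'e"
  dgn :: "nat \<Rightarrow> nat \<Rightarrow> 'e \<Rightarrow> 'e"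
  cyc :: "nat \<Rightarrow> 'e \<Rightarrow> 'e"

definition right_module :: "'e monoid \<Rightarrow> ('e \<Rightarrow> 'h::ring_1 \<Rightarrow> 'e) \<Rightarrow> bool" where
  "right_module G a \<longleftrightarrow> comm_group G \<and> (\<forall>h. (\<lambda>x. a x h) \<in> hom G G) \<and>
     (\<forall>x\<in>carrier G. a x 1 = x \<and>
        (\<forall>g h. a x (g * h) = a (a x g) h \<and> a x (g + h) = a x g \<otimes>\<^bsub>G\<^esub> a x h))"

definition right_module_map ::
  "'e monoid \<Rightarrow> ('e \<Rightarrow> 'h \<Rightarrow> 'e) \<Rightarrow> 'd monoid \<Rightarrow> ('d \<Rightarrow> 'h \<Rightarrow> 'd) \<Rightarrow> ('e \<Rightarrow> 'd) \<Rightarrow> bool" where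
  "right_module_map G a K b f \<longleftrightarrow> f \<in> hom G K \<and> (\<forall>x\<in>carrier G. \<forall>h. f (a x h) = b (f x) h)"

definition para_cyclic_module :: "('h::ring_1, 'e) cyc_data \<Rightarrow> bool" where
  "para_cyclic_module X \<longleftrightarrow>
     (\<forall>n. right_module (grp X n) (ract X n)) \<and>
     (\<forall>n\<ge>1. \<forall>i\<le>n.
        right_module_map (grp X n) (ract X n) (grp X (n - 1)) (ract X (n - 1)) (face X n i)) \<and>
     (\<forall>n. \<forall>i\<le>n.
        right_module_map (grp X n) (ract X n) (grp X (n + 1)) (ract X (n + 1)) (dgn X n i)) \<and>
     (\<forall>n. right_module_map (grp X n) (ract X n) (grp X n) (ract X n) (cyc X n)) \<and>
     (\<comment> \<open>simplicial identities\<close>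
      (\<forall>n\<ge>2. \<forall>j\<le>n. \<forall>i<j. \<forall>x\<in>carrier (grp X n).
         face X (n - 1) i (face X n j x) = face X (n - 1) (j - 1) (face X n i x)) \<and>
      (\<forall>n. \<forall>j\<le>n. \<forall>i\<le>j. \<forall>x\<in>carrier (grp X n).
         dgn X (n + 1) i (dgn X n j x) = dgn X (n + 1) (j + 1) (dgn X n i x)) \<and>
      (\<forall>n\<ge>1. \<forall>j\<le>n. \<forall>i<j. \<forall>x\<in>carrier (grp X n).
         face X (n + 1) i (dgn X n j x) = dgn X (n - 1) (j - 1) (face X n i x)) \<and>
      (\<forall>n. \<forall>j\<le>n. \<forall>x\<in>carrier (grp X n).
         face X (n + 1) j (dgn X n j x) = x \<and> face X (n + 1) (j + 1) (dgn X n j x) = x) \<and>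
      (\<forall>n\<ge>1. \<forall>i\<le>n + 1. \<forall>j. j + 1 < i \<longrightarrow> (\<forall>x\<in>carrier (grp X n).
         face X (n + 1) i (dgn X n j x) = dgn X (n - 1) j (face X n (i - 1) x)))) \<and>
     (\<comment> \<open>compatibility with the cyclic operators\<close>
      (\<forall>n\<ge>1. \<forall>x\<in>carrier (grp X n). face X n 0 (cyc X n x) = face X n n x) \<and>
      (\<forall>n\<ge>1. \<forall>i. 1 \<le> i \<and> i \<le> n \<longrightarrow> (\<forall>x\<in>carrier (grp X n).
         face X n i (cyc X n x) = cyc X (n - 1) (face X n (i - 1) x))) \<and>
      (\<forall>n. \<forall>x\<in>carrier (grp X n).
         dgn X n 0 (cyc X n x) = cyc X (n + 1) (cyc X (n + 1) (dgn X n n x))) \<and>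
      (\<forall>n i. 1 \<le> i \<and> i \<le> n \<longrightarrow> (\<forall>x\<in>carrier (grp X n).
         dgn X n i (cyc X n x) = cyc X (n + 1) (dgn X n (i - 1) x))))"

definition cyclic_module :: "('h::ring_1, 'e) cyc_data \<Rightarrow> bool" where
  "cyclic_module X \<longleftrightarrow> para_cyclic_module X \<and>
     (\<forall>n. \<forall>x\<in>carrier (grp X n). (cyc X n ^^ (n + 1)) x = x)"

definition semi_cyclic_map ::
  "('h, 'e) cyc_data \<Rightarrow> ('h, 'd) cyc_data \<Rightarrow> (nat \<Rightarrow> 'e \<Rightarrow> 'd) \<Rightarrow> bool" where
  "semi_cyclic_map X Y f \<longleftrightarrow>
     (\<forall>n. right_module_map (grp X n) (ract X n) (grp Y n) (ract Y n) (f n)) \<and>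
     (\<forall>n\<ge>1. \<forall>i\<le>n. \<forall>x\<in>carrier (grp X n). f (n - 1) (face X n i x) = face Y n i (f n x)) \<and>
     (\<forall>n. \<forall>x\<in>carrier (grp X n). f n (cyc X n x) = cyc Y n (f n x))"

text \<open>A presimplicial homotopy through module maps, with \<open>d\<^sub>0 h\<^sub>0 = f\<close> and \<open>d\<^sub>n\<^sub>+\<^sub>1 h\<^sub>n = g\<close>.\<close>

definition homotopic ::
  "('h, 'e) cyc_data \<Rightarrow> ('h, 'd) cyc_data \<Rightarrow> (nat \<Rightarrow> 'e \<Rightarrow> 'd) \<Rightarrow> (nat \<Rightarrow> 'e \<Rightarrow> 'd) \<Rightarrow> bool" where
  "homotopic X Y f g \<longleftrightarrow> (\<exists>\<chi> :: nat \<Rightarrow> nat \<Rightarrow> 'e \<Rightarrow> 'd.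
     (\<forall>n. \<forall>j\<le>n.
        right_module_map (grp X n) (ract X n) (grp Y (n + 1)) (ract Y (n + 1)) (\<chi> n j)) \<and>
     (\<forall>n. \<forall>x\<in>carrier (grp X n).
        face Y (n + 1) 0 (\<chi> n 0 x) = f n x \<and> face Y (n + 1) (n + 1) (\<chi> n n x) = g n x) \<and>
     (\<forall>n\<ge>1. \<forall>j\<le>n. \<forall>i<j. \<forall>x\<in>carrier (grp X n).
        face Y (n + 1) i (\<chi> n j x) = \<chi> (n - 1) (j - 1) (face X n i x)) \<and>
     (\<forall>n. \<forall>j. 1 \<le> j \<and> j \<le> n \<longrightarrow> (\<forall>x\<in>carrier (grp X n).
        face Y (n + 1) j (\<chi> n j x) = face Y (n + 1) j (\<chi> n (j - 1) x))) \<and>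
     (\<forall>n\<ge>1. \<forall>i\<le>n + 1. \<forall>j. j + 1 < i \<longrightarrow> (\<forall>x\<in>carrier (grp X n).
        face Y (n + 1) i (\<chi> n j x) = \<chi> (n - 1) j (face X n (i - 1) x))))"

definition equivariantly_homotopy_equivalent ::
  "('h::ring_1, 'e) cyc_data \<Rightarrow> ('h, 'd) cyc_data \<Rightarrow> bool" where
  "equivariantly_homotopy_equivalent X Y \<longleftrightarrow> cyclic_module X \<and> cyclic_module Y \<and>
     (\<exists>\<phi> \<psi>. semi_cyclic_map X Y \<phi> \<and> semi_cyclic_map Y X \<psi> \<and>
        homotopic X X (\<lambda>n x. \<psi> n (\<phi> n x)) (\<lambda>n x. x) \<and>
        homotopic Y Y (\<lambda>n y. \<phi> n (\<psi> n y)) (\<lambda>n y. y))"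

text \<open>The operators induced on a levelwise quotient. If \<open>f\<close> does not descend to the quotients,
  \<open>induced\<close> takes some coset to a set that is not a coset.\<close>

definition induced :: "'d monoid \<Rightarrow> 'd set \<Rightarrow> ('e \<Rightarrow> 'd) \<Rightarrow> 'e set \<Rightarrow> 'd set" where
  "induced G N f E = (\<Union>x\<in>E. N #>\<^bsub>G\<^esub> f x)"

definition quotient_data :: "('h, 'e) cyc_data \<Rightarrow> (nat \<Rightarrow> 'e set) \<Rightarrow> ('h, 'e set) cyc_data" where
  "quotient_data X N =
     \<lparr>grp = (\<lambda>n. grp X n Mod N n),
      ract = (\<lambda>n E h. induced (grp X n) (N n) (\<lambda>x. ract X n x h) E),
      face = (\<lambda>n i. induced (grp X (n - 1)) (N (n - 1)) (face X n i)),
      dgn = (\<lambda>n i. induced (grp X (n + 1)) (N (n + 1)) (dgn X n i)),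
      cyc = (\<lambda>n. induced (grp X n) (N n) (cyc X n))\<rparr>"


section \<open>The modules \<open>T\<close>, \<open>Q\<^sup>H\<close> and \<open>Q\<close>\<close>

text \<open>
  A pair \<open>([(X\<^sub>0, f\<^sub>0), \<dots>, (X\<^sub>n, f\<^sub>n)], m)\<close> with \<open>f\<^sub>i \<in> Hom(X\<^sub>i\<^sub>+\<^sub>1, X\<^sub>i)\<close>, indices modulo \<open>n + 1\<close>, stands
  for \<open>f\<^sub>0 \<otimes> \<dots> \<otimes> f\<^sub>n \<otimes> m\<close>; thus \<open>X\<^sub>i\<close> is the codomain of \<open>f\<^sub>i\<close>.
\<close>

type_synonym ('o, 'f, 'm) simple = "('o \<times> 'f) list \<times> 'm"

definition simples :: "('k, 'h, 'o, 'f) hcat \<Rightarrow> nat \<Rightarrow> ('o, 'f, 'm) simple set" where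
  "simples C n = {(ps, m). length ps = n + 1 \<and>
     (\<forall>i\<le>n. fst (ps ! i) \<in> Obj C \<and>
        snd (ps ! i) \<in> Hom C (fst (ps ! ((i + 1) mod (n + 1)))) (fst (ps ! i)))}"

definition upd :: "('o \<times> 'f) list \<Rightarrow> nat \<Rightarrow> 'f \<Rightarrow> ('o \<times> 'f) list" where
  "upd ps i f = ps[i := (fst (ps ! i), f)]"

definition T_rel ::
  "('k, 'l, 'r, 'h) hopf_algebroid \<Rightarrow> ('k, 'h, 'o, 'f::ab_group_add) hcat \<Rightarrow>
   ('k, 'l, 'r, 'h, 'm::ab_group_add) mod_comod \<Rightarrow> nat \<Rightarrow> (('o, 'f, 'm) simple \<Rightarrow>\<^sub>0 int) set" where
  "T_rel A C M n =
     {frag_of (upd ps i (f + g), m) - frag_of (upd ps i f, m) - frag_of (upd ps i g, m) | ps i f g m.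
        i \<le> n \<and> (upd ps i f, m) \<in> simples C n \<and> (upd ps i g, m) \<in> simples C n} \<union>
     {frag_of (ps, m + m') - frag_of (ps, m) - frag_of (ps, m') | ps m m'.
        (ps, m) \<in> simples C n} \<union>
     {frag_of (upd ps i (hact C (tL A l) (snd (ps ! i))), m)
        - frag_of (upd ps (i + 1) (hact C (sL A l) (snd (ps ! (i + 1)))), m) | ps i l m.
        i < n \<and> (ps, m) \<in> simples C n} \<union>
     {frag_of (upd ps n (hact C (tL A l) (snd (ps ! n))), m) - frag_of (ps, actM M (sL A l) m) | ps l m.
        (ps, m) \<in> simples C n}"

text \<open>\<open>iterated_DeltaL A n h\<close> is \<open>h\<^sub>1 \<otimes> \<dots> \<otimes> h\<^sub>n\<^sub>+\<^sub>1\<close>.\<close>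

primrec iterated_DeltaL ::
  "('k, 'l, 'r, 'h) hopf_algebroid \<Rightarrow> nat \<Rightarrow> 'h \<Rightarrow> ('h list \<Rightarrow>\<^sub>0 int)" where
  "iterated_DeltaL A 0 h = frag_of [h]"
| "iterated_DeltaL A (Suc n) h =
     frag_extend (\<lambda>(a, b). frag_extend (\<lambda>hs. frag_of (a # hs)) (iterated_DeltaL A n b)) (DeltaL A h)"

definition T_act ::
  "('k, 'l, 'r, 'h) hopf_algebroid \<Rightarrow> ('k, 'h, 'o, 'f) hcat \<Rightarrow> ('k, 'l, 'r, 'h, 'm) mod_comod \<Rightarrow>
   nat \<Rightarrow> 'h \<Rightarrow> ('o, 'f, 'm) simple \<Rightarrow> (('o, 'f, 'm) simple \<Rightarrow>\<^sub>0 int)" where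
  "T_act A C M n h = (\<lambda>(ps, m). frag_extend
     (\<lambda>hs. frag_of (map2 (\<lambda>a (X, f). (X, hact C a f)) hs ps, actM M (hs ! (n + 1)) m))
     (iterated_DeltaL A (n + 1) (inv_into UNIV (antipode A) h)))"

definition T_face ::
  "('k, 'h, 'o, 'f) hcat \<Rightarrow> ('k, 'l, 'r, 'h, 'm) mod_comod \<Rightarrow>
   nat \<Rightarrow> nat \<Rightarrow> ('o, 'f, 'm) simple \<Rightarrow> (('o, 'f, 'm) simple \<Rightarrow>\<^sub>0 int)" where
  "T_face C M n i = (\<lambda>(ps, m).
     if i < n then
       frag_of (take i ps @ (fst (ps ! i), Cmp C (snd (ps ! i)) (snd (ps ! (i + 1)))) # drop (i + 2) ps, m)
     else
       frag_extend (\<lambda>(h, x). frag_of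
         ((fst (ps ! n), Cmp C (hact C h (snd (ps ! n))) (snd (ps ! 0))) # butlast (tl ps), x)) (coL M m))"

text \<open>For \<open>i = n\<close> the identity of \<open>X\<^sub>0\<close> is appended.\<close>

definition T_dgn ::
  "('k, 'h, 'o, 'f) hcat \<Rightarrow> nat \<Rightarrow> nat \<Rightarrow> ('o, 'f, 'm) simple \<Rightarrow> (('o, 'f, 'm) simple \<Rightarrow>\<^sub>0 int)" where
  "T_dgn C n i = (\<lambda>(ps, m). let X = fst (ps ! ((i + 1) mod (n + 1))) in
     frag_of (take (i + 1) ps @ (X, Idm C X) # drop (i + 1) ps, m))"

definition T_cyc ::
  "('k, 'h, 'o, 'f) hcat \<Rightarrow> ('k, 'l, 'r, 'h, 'm) mod_comod \<Rightarrow>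
   nat \<Rightarrow> ('o, 'f, 'm) simple \<Rightarrow> (('o, 'f, 'm) simple \<Rightarrow>\<^sub>0 int)" where
  "T_cyc C M n = (\<lambda>(ps, m). frag_extend (\<lambda>(h, x). frag_of
     ((fst (ps ! n), hact C h (snd (ps ! n))) # butlast ps, x)) (coL M m))"

definition free_data ::
  "('k, 'l, 'r, 'h) hopf_algebroid \<Rightarrow> ('k, 'h, 'o, 'f) hcat \<Rightarrow> ('k, 'l, 'r, 'h, 'm) mod_comod \<Rightarrow>
   ('h, ('o, 'f, 'm) simple \<Rightarrow>\<^sub>0 int) cyc_data" where
  "free_data A C M =
     \<lparr>grp = (\<lambda>n. free_Abelian_group (simples C n)),
      ract = (\<lambda>n x h. frag_extend (T_act A C M n h) x),
      face = (\<lambda>n i. frag_extend (T_face C M n i)),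
      dgn = (\<lambda>n i. frag_extend (T_dgn C n i)),
      cyc = (\<lambda>n. frag_extend (T_cyc C M n))\<rparr>"

definition T_mod ::
  "('k, 'l, 'r, 'h) hopf_algebroid \<Rightarrow> ('k, 'h, 'o, 'f::ab_group_add) hcat \<Rightarrow>
   ('k, 'l, 'r, 'h, 'm::ab_group_add) mod_comod \<Rightarrow> ('h, (('o, 'f, 'm) simple \<Rightarrow>\<^sub>0 int) set) cyc_data" where
  "T_mod A C M = quotient_data (free_data A C M)
     (\<lambda>n. generate (grp (free_data A C M) n) (T_rel A C M n))"

text \<open>The sub-\<open>R\<close>-\<open>R\<close>-bimodule generated by the differences \<open>\<tau>\<^sup>j(xh) - \<tau>\<^sup>j(x)h\<close>, for
  \<open>r \<cdot> y \<cdot> r' = y t\<^sub>R(r) s\<^sub>R(r')\<close>.\<close>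

definition coeq_rel ::
  "('k, 'l, 'r, 'h::ring_1) hopf_algebroid \<Rightarrow> ('h, 'e) cyc_data \<Rightarrow> nat \<Rightarrow> 'e set" where
  "coeq_rel A X n = generate (grp X n)
     {ract X n ((cyc X n ^^ j) (ract X n x h) \<otimes>\<^bsub>grp X n\<^esub> inv\<^bsub>grp X n\<^esub> (ract X n ((cyc X n ^^ j) x) h))
        (tR A r * sR A r') | x h j r r'. x \<in> carrier (grp X n)}"

definition QH_mod ::
  "('k, 'l, 'r, 'h::ring_1) hopf_algebroid \<Rightarrow> ('k, 'h, 'o, 'f::ab_group_add) hcat \<Rightarrow>
   ('k, 'l, 'r, 'h, 'm::ab_group_add) mod_comod \<Rightarrow>
   ('h, (('o, 'f, 'm) simple \<Rightarrow>\<^sub>0 int) set set) cyc_data" where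
  "QH_mod A C M = quotient_data (T_mod A C M) (coeq_rel A (T_mod A C M))"

definition cyclic_part :: "('h, 'e) cyc_data \<Rightarrow> ('h, 'e) cyc_data" where
  "cyclic_part X = X\<lparr>grp := (\<lambda>n. grp X n
     \<lparr>carrier := {x \<in> carrier (grp X n). (cyc X n ^^ (n + 1)) x = x}\<rparr>)\<rparr>"

definition Q_mod ::
  "('k, 'l, 'r, 'h::ring_1) hopf_algebroid \<Rightarrow> ('k, 'h, 'o, 'f::ab_group_add) hcat \<Rightarrow>
   ('k, 'l, 'r, 'h, 'm::ab_group_add) mod_comod \<Rightarrow>
   ('h, (('o, 'f, 'm) simple \<Rightarrow>\<^sub>0 int) set set) cyc_data" where
  "Q_mod A C M = cyclic_part (QH_mod A C M)"

text \<open>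
  The formula for \<open>\<tau>\<close> need not be balanced over \<open>L\<close>. For instance, take \<open>L = k \<times> k\<close> with idempotents
  \<open>e\<^sub>1\<close>, \<open>e\<^sub>2\<close>, \<open>H = L \<otimes> L\<close>, the category with one object whose endomorphisms are the \<open>2 \<times> 2\<close> matrices,
  and \<open>M = L\<close> with \<open>\<lambda>\<^sub>L(m) = s\<^sub>L(m) \<otimes> 1\<close>: then \<open>e\<^sub>1\<^sub>2 \<otimes> 1 = e\<^sub>1\<^sub>2 \<otimes> e\<^sub>2\<close>, but the formula for \<open>\<tau>\<^sub>0\<close> gives
  \<open>e\<^sub>1\<^sub>2 \<otimes> 1\<close> and \<open>e\<^sub>2e\<^sub>1\<^sub>2 \<otimes> 1 = 0\<close>. That the faces descend to \<open>Q\<^sup>H\<close> is a further condition. \<open>Q_defined\<close>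
  expresses that \<open>\<tau>\<close> exists on \<open>T\<close> and that the induced structure on \<open>Q\<^sup>H\<close> exists and is para-cyclic,
  which is what the definition of \<open>Q\<close> presupposes.
\<close>

definition Q_defined ::
  "('k, 'l, 'r, 'h::ring_1) hopf_algebroid \<Rightarrow> ('k, 'h, 'o, 'f::ab_group_add) hcat \<Rightarrow>
   ('k, 'l, 'r, 'h, 'm::ab_group_add) mod_comod \<Rightarrow> bool" where
  "Q_defined A C M \<longleftrightarrow>
     (\<forall>n. cyc (T_mod A C M) n \<in> hom (grp (T_mod A C M) n) (grp (T_mod A C M) n)) \<and>
     para_cyclic_module (QH_mod A C M)"

end

theory Submission
  imports Defs
begin

text \<open>
  Let \<open>P\<close> be the endofunctor \<open>GF\<close> of \<open>C\<close> with its invariant isomorphism \<open>\<eta> : P \<rightarrow> id\<close> and \<open>\<theta> = \<eta>\<^sup>-\<^sup>1\<close>. A label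
  \<open>a\<^sub>i \<in> {0, 1}\<close> on each object of \<open>(X\<^sub>0, \<dots>, X\<^sub>n)\<close> says whether \<open>X\<^sub>i\<close> is to be replaced by \<open>P X\<^sub>i\<close>, and replacing
  \<open>f\<^sub>i\<close> by \<open>\<theta>\<^sup>a f\<^sub>i \<eta>\<^sup>b\<close> with \<open>a = a\<^sub>i\<close>, \<open>b = a\<^sub>i\<^sub>+\<^sub>1\<close> defines an operator \<open>K\<^sub>a\<close>. Since \<open>\<eta>\<close> is invariant, \<open>K\<^sub>a\<close> is
  \<open>H\<close>-linear; it commutes with \<open>\<tau>\<close> and the faces if the labels are rotated and deleted along with the
  objects. Hence it acts on \<open>Q\<^sup>H\<close>, and it commutes with \<open>\<tau>\<^sup>n\<^sup>+\<^sup>1\<close>, so it acts on \<open>Q\<close>. For the labels all \<open>1\<close>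
  it is the map induced by \<open>P\<close>, for the labels all \<open>0\<close> it is the identity, and the homotopy between the
  two is \<open>K\<^sub>a s\<^sub>j\<close> where \<open>a\<close> is \<open>0\<close> exactly at \<open>1, \<dots>, j + 1\<close>. The homotopy identities thereby reduce to
  the simplicial identities of \<open>Q\<^sup>H\<close>.
\<close>

section \<open>Maps twisted by a labelling of the objects\<close>

text \<open>All operators are formulas on representatives, so each passage to a quotient has to be
  justified. The action descends to \<open>T\<close> because iterated coproducts satisfy the
  Takeuchi condition between neighbouring factors. For the faces nothing is assumed on
  \<open>T\<close> itself: their descent is recovered from the para-cyclic structure on the twofold
  quotient. The labels cannot be fixed from the start. The relations of \<open>Q^H\<close> contain
  powers of tau, and tau rotates labels, so \<open>K_a\<close> sends a relation built from
  \<open>tau^j x\<close> to one built from \<open>tau^j (K_b x)\<close>, where \<open>b\<close> is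
  \<open>a\<close> rotated back \<open>j\<close> steps. Hence the whole family of operators is
  carried through both quotients together, and constant labels are chosen only at the end. Two facts
  about an \<open>H\<close>-category have to be extracted from
  \<open>h(fg) = (h_1 f)(h_2 g)\<close>: that composition is balanced over \<open>L\<close>, and,
  from this, that composition with an invariant morphism is \<open>H\<close>-linear. The inverse
  theta is not given as invariant, so composition with it is treated by cancelling eta.\<close>

definition rotate_labels :: "nat \<Rightarrow> (nat \<Rightarrow> bool) \<Rightarrow> nat \<Rightarrow> bool" where
  "rotate_labels n a i = a ((i + n) mod (n + 1))"

text \<open>A face \<open>d_i\<close> with \<open>i < n\<close> composes \<open>f_i\<close> with its
  successor and so loses the object at position \<open>i + 1\<close>. The last face composes through
  the object at position \<open>0\<close>, and the object at position \<open>n\<close> moves to the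
  front.\<close>

definition delete_label :: "nat \<Rightarrow> nat \<Rightarrow> (nat \<Rightarrow> bool) \<Rightarrow> nat \<Rightarrow> bool" where
  "delete_label n i a k = (if i < n then (if k \<le> i then a k else a (k + 1)) else (if k = 0 then a n else a k))"

text \<open>Labels are total functions on \<open>nat\<close>, and the first clause says that degree
  \<open>n\<close> reads only the positions up to \<open>n\<close>. All labellings occur at once
  because a face or the cyclic operator relates \<open>K\<close> at one labelling to
  \<open>K\<close> at another.\<close>

definition twisted_map ::
  "('h, 'e) cyc_data \<Rightarrow> ('h, 'd) cyc_data \<Rightarrow> ((nat \<Rightarrow> bool) \<Rightarrow> nat \<Rightarrow> 'e \<Rightarrow> 'd) \<Rightarrow> bool" where
  "twisted_map X Y K \<longleftrightarrow>
     (\<forall>a b n. (\<forall>i\<le>n. a i = b i) \<longrightarrow> K a n = K b n) \<and>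
     (\<forall>a n. right_module_map (grp X n) (ract X n) (grp Y n) (ract Y n) (K a n)) \<and>
     (\<forall>a n i. 1 \<le> n \<and> i \<le> n \<longrightarrow> (\<forall>x\<in>carrier (grp X n).
        K (delete_label n i a) (n - 1) (face X n i x) = face Y n i (K a n x))) \<and>
     (\<forall>a n. \<forall>x\<in>carrier (grp X n). K (rotate_labels n a) n (cyc X n x) = cyc Y n (K a n x))"

lemma right_module_map_closed:
  assumes "right_module_map G a K b f" and "x \<in> carrier G"
  shows "f x \<in> carrier K"
  using assms unfolding right_module_map_def hom_def by blast

lemma right_module_map_compose:
  assumes "right_module_map G a K b f" and "right_module_map K b L c g"
  shows "right_module_map G a L c (\<lambda>x. g (f x))"
  using assms unfolding right_module_map_def hom_def by (auto simp: Pi_iff)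

lemma right_module_map_restrict:
  assumes "right_module_map G a K b f" and "H \<subseteq> carrier G" and "\<And>x. x \<in> H \<Longrightarrow> f x \<in> H'"
  shows "right_module_map (G\<lparr>carrier := H\<rparr>) a (K\<lparr>carrier := H'\<rparr>) b f"
  using assms unfolding right_module_map_def hom_def by (auto simp: subset_iff)

text \<open>One step back is the addition of \<open>n\<close> modulo \<open>n + 1\<close>, which
  avoids truncated subtraction.\<close>

lemma rotate_labels_funpow:
  "i \<le> n \<Longrightarrow> (rotate_labels n ^^ k) a i = a ((i + n * k) mod (n + 1))"
proof (induction k arbitrary: i)
  case (Suc k)
  have "(rotate_labels n ^^ Suc k) a i = (rotate_labels n ^^ k) a ((i + n) mod (n + 1))"
    by (simp add: rotate_labels_def)
  also have "\<dots> = a (((i + n) mod (n + 1) + n * k) mod (n + 1))"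
    using Suc.IH [of "(i + n) mod (n + 1)"] mod_less_divisor [of "n + 1" "i + n"] by simp
  also have "((i + n) mod (n + 1) + n * k) mod (n + 1) = (i + n * Suc k) mod (n + 1)"
    by (metis add.assoc mod_add_left_eq mult_Suc_right)
  finally show ?case .
qed simp

lemma rotate_labels_const [simp]: "rotate_labels n (\<lambda>_. c) = (\<lambda>_. c)"
  by (simp add: rotate_labels_def fun_eq_iff)

lemma delete_label_const [simp]: "delete_label n i (\<lambda>_. c) = (\<lambda>_. c)"
  by (simp add: delete_label_def fun_eq_iff)

lemma rotate_labels_full_turn: "i \<le> n \<Longrightarrow> (rotate_labels n ^^ (n + 1)) a i = a i"
  using rotate_labels_funpow [of i n "n + 1" a] mod_mult_self1 [of i n "n + 1"]
  by (simp del: funpow.simps mult_Suc_right)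

context
  fixes X :: "('h, 'e) cyc_data" and Y :: "('h, 'd) cyc_data" and K
  assumes K: "twisted_map X Y K"
begin

lemma twisted_map_cong: "(\<And>i. i \<le> n \<Longrightarrow> a i = b i) \<Longrightarrow> K a n = K b n"
  and twisted_map_module_map:
    "right_module_map (grp X n) (ract X n) (grp Y n) (ract Y n) (K a n)"
  and twisted_map_hom: "K a n \<in> hom (grp X n) (grp Y n)"
  and twisted_map_ract: "x \<in> carrier (grp X n) \<Longrightarrow> K a n (ract X n x h) = ract Y n (K a n x) h"
  and twisted_map_face: "1 \<le> n \<Longrightarrow> i \<le> n \<Longrightarrow> x \<in> carrier (grp X n) \<Longrightarrow>
    K (delete_label n i a) (n - 1) (face X n i x) = face Y n i (K a n x)"
  and twisted_map_cyc: "x \<in> carrier (grp X n) \<Longrightarrow> K (rotate_labels n a) n (cyc X n x) = cyc Y n (K a n x)"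
  using K unfolding twisted_map_def right_module_map_def by simp_all

lemmas twisted_map_closed = hom_in_carrier [OF twisted_map_hom]

end

lemma twisted_map_funpow:
  assumes K: "twisted_map X Y K"
    and closed: "\<And>x. x \<in> carrier (grp X n) \<Longrightarrow> cyc X n x \<in> carrier (grp X n)"
    and x: "x \<in> carrier (grp X n)"
  shows "K ((rotate_labels n ^^ k) a) n ((cyc X n ^^ k) x) = (cyc Y n ^^ k) (K a n x)"
proof (induction k)
  case (Suc k)
  have "(cyc X n ^^ k) x \<in> carrier (grp X n)"
    by (induction k) (use closed x in auto)
  then show ?case
    using Suc twisted_map_cyc [OF K] by simp
qed simp

text \<open>A constant labelling is unchanged by rotation and deletion, so there the twisted
  identities become genuine commutation.\<close>

lemma semi_cyclic_map_twisted:
  assumes "twisted_map X Y K"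
  shows "semi_cyclic_map X Y (K (\<lambda>_. c))"
  using assms unfolding twisted_map_def semi_cyclic_map_def
  by (metis rotate_labels_const delete_label_const)

section \<open>Full turns of the cyclic operator\<close>

context
  fixes X :: "('h::ring_1, 'e) cyc_data"
  assumes X: "para_cyclic_module X"
begin

lemma para_cyclic_right_module: "right_module (grp X n) (ract X n)"
  and para_cyclic_face_map: "n \<ge> 1 \<Longrightarrow> i \<le> n \<Longrightarrow>
    right_module_map (grp X n) (ract X n) (grp X (n - 1)) (ract X (n - 1)) (face X n i)"
  and para_cyclic_dgn_map: "i \<le> n \<Longrightarrow>
    right_module_map (grp X n) (ract X n) (grp X (n + 1)) (ract X (n + 1)) (dgn X n i)"
  and para_cyclic_cyc_map: "right_module_map (grp X n) (ract X n) (grp X n) (ract X n) (cyc X n)"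
  using X unfolding para_cyclic_module_def by metis+

lemmas para_cyclic_face_closed = right_module_map_closed [OF para_cyclic_face_map]
lemmas para_cyclic_dgn_closed = right_module_map_closed [OF para_cyclic_dgn_map]
lemmas para_cyclic_cyc_closed = right_module_map_closed [OF para_cyclic_cyc_map]

lemma para_cyclic_funpow_closed: "x \<in> carrier (grp X n) \<Longrightarrow> (cyc X n ^^ k) x \<in> carrier (grp X n)"
  by (induction k) (auto simp: para_cyclic_cyc_closed)

lemma para_cyclic_face0_cyc:
  "n \<ge> 1 \<Longrightarrow> x \<in> carrier (grp X n) \<Longrightarrow> face X n 0 (cyc X n x) = face X n n x"
  and para_cyclic_face_cyc: "1 \<le> i \<Longrightarrow> i \<le> n \<Longrightarrow> x \<in> carrier (grp X n) \<Longrightarrow>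
    face X n i (cyc X n x) = cyc X (n - 1) (face X n (i - 1) x)"
  and para_cyclic_dgn0_cyc: "x \<in> carrier (grp X n) \<Longrightarrow>
    dgn X n 0 (cyc X n x) = cyc X (n + 1) (cyc X (n + 1) (dgn X n n x))"
  and para_cyclic_dgn_cyc: "1 \<le> i \<Longrightarrow> i \<le> n \<Longrightarrow> x \<in> carrier (grp X n) \<Longrightarrow>
    dgn X n i (cyc X n x) = cyc X (n + 1) (dgn X n (i - 1) x)"
  using X unfolding para_cyclic_module_def by simp_all

lemma para_cyclic_face_funpow:
  "k \<le> i \<Longrightarrow> i \<le> n \<Longrightarrow> 1 \<le> n \<Longrightarrow> x \<in> carrier (grp X n) \<Longrightarrow>
    face X n i ((cyc X n ^^ k) x) = (cyc X (n - 1) ^^ k) (face X n (i - k) x)"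
proof (induction k arbitrary: i)
  case (Suc k)
  have "face X n i ((cyc X n ^^ Suc k) x) = cyc X (n - 1) (face X n (i - 1) ((cyc X n ^^ k) x))"
    using Suc.prems by (simp add: para_cyclic_face_cyc para_cyclic_funpow_closed)
  then show ?case using Suc by simp
qed simp

lemma para_cyclic_dgn_funpow:
  "k \<le> i \<Longrightarrow> i \<le> n \<Longrightarrow> x \<in> carrier (grp X n) \<Longrightarrow>
    dgn X n i ((cyc X n ^^ k) x) = (cyc X (n + 1) ^^ k) (dgn X n (i - k) x)"
proof (induction k arbitrary: i)
  case (Suc k)
  have "dgn X n i ((cyc X n ^^ Suc k) x) = cyc X (n + 1) (dgn X n (i - 1) ((cyc X n ^^ k) x))"
    using Suc.prems para_cyclic_dgn_cyc by (simp add: para_cyclic_funpow_closed)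
  then show ?case using Suc by simp
qed simp

text \<open>Split \<open>tau^(n+1)\<close> as \<open>tau^i tau tau^(n-i)\<close>. The left power
  turns \<open>d_i\<close> into \<open>d_0\<close>, the middle factor is swallowed by
  \<open>d_0 tau = d_n\<close>, and the right power turns \<open>d_n\<close> back into
  \<open>d_i\<close>. Exactly one factor is lost, which is the difference between full turns in
  degrees \<open>n\<close> and \<open>n - 1\<close>.\<close>

lemma para_cyclic_face_full_turn:
  assumes n: "1 \<le> n" and i: "i \<le> n" and x: "x \<in> carrier (grp X n)"
  shows "face X n i ((cyc X n ^^ (n + 1)) x) = (cyc X (n - 1) ^^ n) (face X n i x)"
proof -
  have "n + 1 = i + Suc (n - i)" using i by simp
  then have "(cyc X n ^^ (n + 1)) x = (cyc X n ^^ i) (cyc X n ((cyc X n ^^ (n - i)) x))"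
    by (simp only: funpow_add funpow.simps o_apply)
  then have "face X n i ((cyc X n ^^ (n + 1)) x)
      = (cyc X (n - 1) ^^ i) (face X n n ((cyc X n ^^ (n - i)) x))"
    using n i x by (simp add: para_cyclic_face_funpow para_cyclic_face0_cyc para_cyclic_cyc_closed
        para_cyclic_funpow_closed)
  also have "\<dots> = (cyc X (n - 1) ^^ i) ((cyc X (n - 1) ^^ (n - i)) (face X n i x))"
    using n i x by (simp add: para_cyclic_face_funpow)
  also have "\<dots> = (cyc X (n - 1) ^^ (i + (n - i))) (face X n i x)"
    by (simp only: funpow_add o_apply)
  finally show ?thesis using i by simp
qed

text \<open>The same splitting, where now \<open>s_0 tau = tau^2 s_n\<close> contributes one extra
  factor: a full turn in degree \<open>n + 1\<close> has \<open>n + 2\<close> of them.\<close>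

lemma para_cyclic_dgn_full_turn:
  assumes i: "i \<le> n" and x: "x \<in> carrier (grp X n)"
  shows "dgn X n i ((cyc X n ^^ (n + 1)) x) = (cyc X (n + 1) ^^ (n + 2)) (dgn X n i x)"
proof -
  have "n + 1 = i + Suc (n - i)" using i by simp
  then have "(cyc X n ^^ (n + 1)) x = (cyc X n ^^ i) (cyc X n ((cyc X n ^^ (n - i)) x))"
    by (simp only: funpow_add funpow.simps o_apply)
  then have "dgn X n i ((cyc X n ^^ (n + 1)) x)
      = (cyc X (n + 1) ^^ i) (cyc X (n + 1) (cyc X (n + 1) (dgn X n n ((cyc X n ^^ (n - i)) x))))"
    using i x para_cyclic_dgn_funpow [of i i n "cyc X n ((cyc X n ^^ (n - i)) x)"]
      para_cyclic_dgn0_cyc [of "(cyc X n ^^ (n - i)) x" n]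
    by (simp add: para_cyclic_cyc_closed para_cyclic_funpow_closed)
  also have "\<dots> = (cyc X (n + 1) ^^ i) ((cyc X (n + 1) ^^ 2) ((cyc X (n + 1) ^^ (n - i)) (dgn X n i x)))"
    using i x para_cyclic_dgn_funpow [of "n - i" n n x] by (simp add: eval_nat_numeral)
  also have "\<dots> = (cyc X (n + 1) ^^ (i + (2 + (n - i)))) (dgn X n i x)"
    by (simp only: funpow_add o_apply)
  also have "i + (2 + (n - i)) = n + 2" using i by simp
  finally show ?thesis .
qed

end

section \<open>Fixed points of the full turn\<close>

lemma carrier_cyclic_part:
  "carrier (grp (cyclic_part X) n) = {x \<in> carrier (grp X n). (cyc X n ^^ (n + 1)) x = x}"
  by (simp add: cyclic_part_def)

lemma cyclic_part_simps:
  "ract (cyclic_part X) = ract X" "face (cyclic_part X) = face X"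
  "dgn (cyclic_part X) = dgn X" "cyc (cyclic_part X) = cyc X"
  by (simp_all add: cyclic_part_def)

lemma right_module_map_cyclic_part:
  assumes "right_module_map (grp X n) (ract X n) (grp Y m) (ract Y m) f"
    and "\<And>x. x \<in> carrier (grp X n) \<Longrightarrow> (cyc X n ^^ (n + 1)) x = x \<Longrightarrow> (cyc Y m ^^ (m + 1)) (f x) = f x"
  shows "right_module_map (grp (cyclic_part X) n) (ract (cyclic_part X) n)
           (grp (cyclic_part Y) m) (ract (cyclic_part Y) m) f"
proof -
  have "right_module_map
      (grp X n\<lparr>carrier := {x \<in> carrier (grp X n). (cyc X n ^^ (n + 1)) x = x}\<rparr>) (ract X n)
      (grp Y m\<lparr>carrier := {x \<in> carrier (grp Y m). (cyc Y m ^^ (m + 1)) x = x}\<rparr>) (ract Y m) f"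
    using assms by (intro right_module_map_restrict) (auto dest: right_module_map_closed)
  then show ?thesis by (simp add: cyclic_part_def)
qed

text \<open>\<open>tau^(n+1)\<close> is an endomorphism of the right module, so its fixed points
  form a submodule.\<close>

lemma right_module_cyclic_part:
  assumes X: "para_cyclic_module X"
  shows "right_module (grp (cyclic_part X) n) (ract (cyclic_part X) n)"
proof -
  let ?G = "grp X n" and ?t = "cyc X n ^^ (n + 1)"
  let ?H = "{x \<in> carrier ?G. ?t x = x}"
  interpret comm_group ?G
    using para_cyclic_right_module [OF X] unfolding right_module_def by blast
  have t: "right_module_map ?G (ract X n) ?G (ract X n) (cyc X n ^^ k)" for k
  proof (induction k)
    case 0
    have "(\<lambda>x. x) \<in> hom ?G ?G" by (simp add: hom_def)
    then show ?case by (simp add: right_module_map_def id_def)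
  next
    case (Suc k)
    then show ?case
      using right_module_map_compose [OF Suc para_cyclic_cyc_map [OF X]] by (simp add: o_def)
  qed
  have hom: "?t \<in> hom ?G ?G" using t unfolding right_module_map_def by blast
  have "subgroup ?H ?G"
  proof
    show "?H \<subseteq> carrier ?G" by blast
    show "x \<otimes>\<^bsub>?G\<^esub> y \<in> ?H" if "x \<in> ?H" "y \<in> ?H" for x y
      using that hom_mult [OF hom, of x y] by simp
    show "\<one>\<^bsub>?G\<^esub> \<in> ?H" using hom_one [OF hom is_group is_group] by simp
    show "inv\<^bsub>?G\<^esub> x \<in> ?H" if "x \<in> ?H" for x
    proof -
      have "?t (inv\<^bsub>?G\<^esub> x) = inv\<^bsub>?G\<^esub> (?t x)"
        using that group_hom.hom_inv [of ?G ?G ?t x] hom is_group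
        by (simp add: group_hom_def group_hom_axioms_def)
      then show ?thesis using that by simp
    qed
  qed
  then have "comm_group (?G\<lparr>carrier := ?H\<rparr>)"
    by (intro group.group_comm_groupI subgroup_imp_group) (auto simp: m_comm)
  moreover have "(\<lambda>x. ract X n x h) \<in> hom (?G\<lparr>carrier := ?H\<rparr>) (?G\<lparr>carrier := ?H\<rparr>)" for h
  proof -
    have "(\<lambda>x. ract X n x h) \<in> hom ?G ?G"
      using para_cyclic_right_module [OF X] unfolding right_module_def by blast
    moreover have "?t (ract X n x h) = ract X n (?t x) h" if "x \<in> carrier ?G" for x
      using t that unfolding right_module_map_def by blast
    ultimately show ?thesis unfolding hom_def by (auto simp del: funpow.simps)
  qed
  ultimately have "right_module (?G\<lparr>carrier := ?H\<rparr>) (ract X n)"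
    using para_cyclic_right_module [OF X, of n] unfolding right_module_def by simp
  then show ?thesis by (simp add: cyclic_part_def)
qed

lemma cyclic_module_cyclic_part:
  assumes X: "para_cyclic_module X"
  shows "cyclic_module (cyclic_part X)"
proof -
  let ?Q = "cyclic_part X"
  have face: "right_module_map (grp ?Q n) (ract ?Q n) (grp ?Q (n - 1)) (ract ?Q (n - 1)) (face ?Q n i)"
    if "1 \<le> n" "i \<le> n" for n i
    unfolding cyclic_part_simps(2)
  proof (rule right_module_map_cyclic_part [OF para_cyclic_face_map [OF X that]])
    fix x assume "x \<in> carrier (grp X n)" "(cyc X n ^^ (n + 1)) x = x"
    then show "(cyc X (n - 1) ^^ (n - 1 + 1)) (face X n i x) = face X n i x"
      using para_cyclic_face_full_turn [OF X that, of x] that by (simp del: funpow.simps)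
  qed
  have dgn: "right_module_map (grp ?Q n) (ract ?Q n) (grp ?Q (n + 1)) (ract ?Q (n + 1)) (dgn ?Q n i)"
    if "i \<le> n" for n i
    unfolding cyclic_part_simps(3)
  proof (rule right_module_map_cyclic_part [OF para_cyclic_dgn_map [OF X that]])
    fix x assume "x \<in> carrier (grp X n)" "(cyc X n ^^ (n + 1)) x = x"
    then show "(cyc X (n + 1) ^^ (n + 1 + 1)) (dgn X n i x) = dgn X n i x"
      using para_cyclic_dgn_full_turn [OF X that, of x] by (simp del: funpow.simps)
  qed
  have cyc: "right_module_map (grp ?Q n) (ract ?Q n) (grp ?Q n) (ract ?Q n) (cyc ?Q n)" for n
    unfolding cyclic_part_simps(4)
  proof (intro right_module_map_cyclic_part para_cyclic_cyc_map [OF X])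
    fix x assume "(cyc X n ^^ (n + 1)) x = x"
    then show "(cyc X n ^^ (n + 1)) (cyc X n x) = cyc X n x"
      by (metis funpow_swap1)
  qed
  have sub: "x \<in> carrier (grp ?Q n) \<Longrightarrow> x \<in> carrier (grp X n)" for x n
    unfolding carrier_cyclic_part by blast
  have "para_cyclic_module ?Q"
    unfolding para_cyclic_module_def
  proof (intro conjI)
    show "\<forall>n. right_module (grp ?Q n) (ract ?Q n)"
      using right_module_cyclic_part [OF X] by blast
    show "\<forall>n\<ge>1. \<forall>i\<le>n. right_module_map (grp ?Q n) (ract ?Q n) (grp ?Q (n - 1)) (ract ?Q (n - 1)) (face ?Q n i)"
      using face by blast
    show "\<forall>n. \<forall>i\<le>n. right_module_map (grp ?Q n) (ract ?Q n) (grp ?Q (n + 1)) (ract ?Q (n + 1)) (dgn ?Q n i)"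
      using dgn by blast
    show "\<forall>n. right_module_map (grp ?Q n) (ract ?Q n) (grp ?Q n) (ract ?Q n) (cyc ?Q n)"
      using cyc by blast
  qed (use X sub in \<open>simp_all add: para_cyclic_module_def cyclic_part_simps\<close>)
  then show ?thesis
    unfolding cyclic_module_def by (auto simp: carrier_cyclic_part cyclic_part_simps)
qed

text \<open>Moving \<open>K a\<close> past \<open>tau^(n+1)\<close> rotates the labels by a full
  turn, which restores the positions \<open>0\<close> to \<open>n\<close>. So fixed points go to
  fixed points although \<open>K a\<close> need not commute with a single tau.\<close>

lemma twisted_map_cyclic_part:
  assumes X: "para_cyclic_module X" and Y: "para_cyclic_module Y" and K: "twisted_map X Y K"
  shows "twisted_map (cyclic_part X) (cyclic_part Y) K"
proof -
  have pow: "K ((rotate_labels n ^^ k) a) n ((cyc X n ^^ k) x) = (cyc Y n ^^ k) (K a n x)"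
    if "x \<in> carrier (grp X n)" for a n k x
    using that by (intro twisted_map_funpow [OF K] para_cyclic_cyc_closed [OF X])
  have "right_module_map (grp (cyclic_part X) n) (ract (cyclic_part X) n)
      (grp (cyclic_part Y) n) (ract (cyclic_part Y) n) (K a n)" for a n
  proof (rule right_module_map_cyclic_part)
    show "right_module_map (grp X n) (ract X n) (grp Y n) (ract Y n) (K a n)"
      by (rule twisted_map_module_map [OF K])
    fix x assume x: "x \<in> carrier (grp X n)" "(cyc X n ^^ (n + 1)) x = x"
    have "K ((rotate_labels n ^^ (n + 1)) a) n = K a n"
      by (rule twisted_map_cong [OF K rotate_labels_full_turn])
    then show "(cyc Y n ^^ (n + 1)) (K a n x) = K a n x"
      using pow [OF x(1), of "n + 1" a] x(2) by simp
  qed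
  moreover have "x \<in> carrier (grp (cyclic_part X) n) \<Longrightarrow> x \<in> carrier (grp X n)" for x n
    unfolding carrier_cyclic_part by blast
  ultimately show ?thesis
    using K unfolding twisted_map_def cyclic_part_simps(2-4) by simp
qed

text \<open>For the twist by eta : P -> id with inverse theta this is the classical homotopy
  \<open>h_j(f_0, ..., f_n) = (theta f_0, f_1, ..., f_j, eta, P f_{j+1}, ..., P f_n)\<close>: the
  degeneracy doubles an object, its two copies get different labels, and the inserted identity
  becomes eta. Position \<open>0\<close> is labelled True so that \<open>d_0 h_0\<close> has only
  True labels; the last face removes this position and thereby leaves only False labels for
  \<open>j = n\<close>.\<close>

lemma homotopic_twisted:
  assumes X: "para_cyclic_module X" and K: "twisted_map X X K"
    and id: "\<And>n x. x \<in> carrier (grp X n) \<Longrightarrow> K (\<lambda>_. False) n x = x"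
  shows "homotopic X X (K (\<lambda>_. True)) (\<lambda>n x. x)"
proof -
  define a where "a j k \<longleftrightarrow> k = 0 \<or> Suc j < k" for j k :: nat
  define \<chi> where "\<chi> n j x = K (a j) (n + 1) (dgn X n j x)" for n j x
  note cong = twisted_map_cong [OF K]
  have face: "face X (n + 1) i (\<chi> n j x) = K (delete_label (n + 1) i (a j)) n (face X (n + 1) i (dgn X n j x))"
    if "i \<le> n + 1" "j \<le> n" "x \<in> carrier (grp X n)" for n i j x
    using that twisted_map_face [OF K, of "n + 1" i "dgn X n j x" "a j"]
      para_cyclic_dgn_closed [OF X, of j n x] by (simp add: \<chi>_def)
  have simplicial:
    "n \<ge> 1 \<Longrightarrow> j \<le> n \<Longrightarrow> i < j \<Longrightarrow> x \<in> carrier (grp X n) \<Longrightarrow>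
      face X (n + 1) i (dgn X n j x) = dgn X (n - 1) (j - 1) (face X n i x)"
    "j \<le> n \<Longrightarrow> x \<in> carrier (grp X n) \<Longrightarrow> face X (n + 1) j (dgn X n j x) = x"
    "j \<le> n \<Longrightarrow> x \<in> carrier (grp X n) \<Longrightarrow> face X (n + 1) (j + 1) (dgn X n j x) = x"
    "n \<ge> 1 \<Longrightarrow> i \<le> n + 1 \<Longrightarrow> j + 1 < i \<Longrightarrow> x \<in> carrier (grp X n) \<Longrightarrow>
      face X (n + 1) i (dgn X n j x) = dgn X (n - 1) j (face X n (i - 1) x)" for n i j x
    using X unfolding para_cyclic_module_def by simp_all
  show ?thesis
    unfolding homotopic_def
  proof (intro exI [of _ \<chi>] conjI allI impI ballI)
    show "right_module_map (grp X n) (ract X n) (grp X (n + 1)) (ract X (n + 1)) (\<chi> n j)"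
      if "j \<le> n" for n j
      using right_module_map_compose [OF para_cyclic_dgn_map [OF X that] twisted_map_module_map [OF K]]
      unfolding \<chi>_def .
    show "face X (n + 1) 0 (\<chi> n 0 x) = K (\<lambda>_. True) n x" if x: "x \<in> carrier (grp X n)" for n x
    proof -
      have "K (delete_label (n + 1) 0 (a 0)) n = K (\<lambda>_. True) n"
        by (rule cong) (auto simp: a_def delete_label_def)
      then show ?thesis using face [of 0 n 0 x] simplicial(2) [of 0 n x] x by simp
    qed
    show "face X (n + 1) (n + 1) (\<chi> n n x) = x" if x: "x \<in> carrier (grp X n)" for n x
    proof -
      have "K (delete_label (n + 1) (n + 1) (a n)) n = K (\<lambda>_. False) n"
        by (rule cong) (auto simp: a_def delete_label_def)
      then show ?thesis using face [of "n + 1" n n x] simplicial(3) [of n n x] x id by simp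
    qed
    show "face X (n + 1) i (\<chi> n j x) = \<chi> (n - 1) (j - 1) (face X n i x)"
      if "1 \<le> n" "j \<le> n" "i < j" "x \<in> carrier (grp X n)" for n j i x
    proof -
      have "K (delete_label (n + 1) i (a j)) n = K (a (j - 1)) n"
        using that by (intro cong) (auto simp: a_def delete_label_def)
      then show ?thesis
        using face [of i n j x] simplicial(1) [of n j i x] that by (simp add: \<chi>_def)
    qed
    show "face X (n + 1) j (\<chi> n j x) = face X (n + 1) j (\<chi> n (j - 1) x)"
      if "1 \<le> j \<and> j \<le> n" "x \<in> carrier (grp X n)" for n j x
    proof -
      \<comment> \<open>Both sides delete position \<open>j + 1\<close>, where \<open>a j\<close>
        has its last False and \<open>a (j - 1)\<close> its first True after the block. Either way
        False remains exactly at \<open>1, ..., j\<close>.\<close>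
      have "K (delete_label (n + 1) j (a j)) n = K (delete_label (n + 1) j (a (j - 1))) n"
        using that by (intro cong) (auto simp: a_def delete_label_def)
      then show ?thesis
        using face [of j n j x] face [of j n "j - 1" x] simplicial(2) [of j n x]
          simplicial(3) [of "j - 1" n x] that by (simp add: le_diff_conv)
    qed
    show "face X (n + 1) i (\<chi> n j x) = \<chi> (n - 1) j (face X n (i - 1) x)"
      if "1 \<le> n" "i \<le> n + 1" "j + 1 < i" "x \<in> carrier (grp X n)" for n i j x
    proof -
      have "K (delete_label (n + 1) i (a j)) n = K (a j) n"
        using that by (intro cong) (auto simp: a_def delete_label_def)
      then show ?thesis
        using face [of i n j x] simplicial(4) [of n i j x] that by (simp add: \<chi>_def)
    qed
  qed
qed

section \<open>Passage to quotients\<close>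

definition descends :: "'e monoid \<Rightarrow> 'e set \<Rightarrow> 'd monoid \<Rightarrow> 'd set \<Rightarrow> ('e \<Rightarrow> 'd) \<Rightarrow> bool" where
  "descends G N K N' f \<longleftrightarrow> f \<in> hom G K \<and> f ` N \<subseteq> N'"

locale quotient_pair =
  G: comm_group G + K: comm_group K + N: subgroup N G + N': subgroup N' K
  for G :: "'e monoid" and K :: "'d monoid" and N N'
begin

text \<open>The cosets whose union defines \<open>induced\<close> all agree because \<open>f\<close>
  maps \<open>N\<close> into \<open>N'\<close>, and there is at least one since \<open>x\<close>
  lies in its own coset.\<close>

lemma induced_coset:
  assumes f: "descends G N K N' f" and x: "x \<in> carrier G"
  shows "induced K N' f (N #>\<^bsub>G\<^esub> x) = N' #>\<^bsub>K\<^esub> f x"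
proof -
  have hom: "f \<in> hom G K" and sub: "f ` N \<subseteq> N'"
    using f unfolding descends_def by auto
  have fx: "f x \<in> carrier K" using hom x by (rule hom_in_carrier)
  have "N' #>\<^bsub>K\<^esub> f y = N' #>\<^bsub>K\<^esub> f x" if y: "y \<in> N #>\<^bsub>G\<^esub> x" for y
  proof -
    obtain n where n: "n \<in> N" "y = n \<otimes>\<^bsub>G\<^esub> x" using y by (auto simp: r_coset_def)
    have "f y = f n \<otimes>\<^bsub>K\<^esub> f x" using n x hom_mult [OF hom] by simp
    moreover have "f n \<in> N'" using n sub by blast
    ultimately show ?thesis
      using fx K.coset_mult_assoc [of N' "f n" "f x"] K.coset_join2 [OF _ N'.subgroup_axioms, of "f n"]
        N'.subset by auto
  qed
  moreover have "N #>\<^bsub>G\<^esub> x \<noteq> {}"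
    using G.rcos_self [OF x N.subgroup_axioms] by blast
  ultimately show ?thesis unfolding induced_def by simp
qed

lemma induced_hom:
  assumes f: "descends G N K N' f"
  shows "induced K N' f \<in> hom (G Mod N) (K Mod N')"
proof -
  have hom: "f \<in> hom G K" using f unfolding descends_def by auto
  have normal: "N \<lhd> G" "N' \<lhd> K"
    using G.subgroup_imp_normal K.subgroup_imp_normal N.subgroup_axioms N'.subgroup_axioms by auto
  show ?thesis
  proof (rule homI)
    fix E assume "E \<in> carrier (G Mod N)"
    then obtain x where x: "x \<in> carrier G" "E = N #>\<^bsub>G\<^esub> x" by (auto simp: carrier_FactGroup)
    then show "induced K N' f E \<in> carrier (K Mod N')"
      using hom_in_carrier [OF hom] by (auto simp: carrier_FactGroup induced_coset [OF f])
    fix E' assume "E' \<in> carrier (G Mod N)"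
    then obtain y where y: "y \<in> carrier G" "E' = N #>\<^bsub>G\<^esub> y" by (auto simp: carrier_FactGroup)
    show "induced K N' f (E \<otimes>\<^bsub>G Mod N\<^esub> E') = induced K N' f E \<otimes>\<^bsub>K Mod N'\<^esub> induced K N' f E'"
      using x y hom_in_carrier [OF hom] hom_mult [OF hom]
      by (simp add: induced_coset [OF f] normal.rcos_sum [OF normal(1)] normal.rcos_sum [OF normal(2)])
  qed
qed

text \<open>Testing the trivial coset is enough. If the image of \<open>N\<close> is a coset, it
  contains \<open>f 1 = 1\<close> and so equals \<open>N'\<close>; as it also contains
  \<open>f x\<close> for every \<open>x\<close> in \<open>N\<close>, descent follows.\<close>

lemma descends_if_induced:
  assumes hom: "f \<in> hom G K" and cos: "induced K N' f N \<in> carrier (K Mod N')"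
  shows "descends G N K N' f"
proof -
  obtain y where y: "y \<in> carrier K" "induced K N' f N = N' #>\<^bsub>K\<^esub> y"
    using cos by (auto simp: carrier_FactGroup)
  have self: "f x \<in> N' #>\<^bsub>K\<^esub> y" if "x \<in> N" for x
    using that K.rcos_self [OF hom_in_carrier [OF hom N.mem_carrier [OF that]] N'.subgroup_axioms]
    unfolding y(2) [symmetric] induced_def by blast
  have "N' #>\<^bsub>K\<^esub> y = N'"
    using K.repr_independence [OF self [OF N.one_closed] y(1) N'.subgroup_axioms]
      hom_one [OF hom G.is_group K.is_group] N'.subset by simp
  then show ?thesis using hom self unfolding descends_def by blast
qed

end

text \<open>Degeneracies are absent since twisted maps do not mention them; the homotopy takes them
  from the para-cyclic structure of the final quotient.\<close>

definition compatible :: "('h, 'e) cyc_data \<Rightarrow> (nat \<Rightarrow> 'e set) \<Rightarrow> bool" where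
  "compatible X N \<longleftrightarrow>
     (\<forall>n. comm_group (grp X n)) \<and> (\<forall>n. subgroup (N n) (grp X n)) \<and>
     (\<forall>n h. descends (grp X n) (N n) (grp X n) (N n) (\<lambda>x. ract X n x h)) \<and>
     (\<forall>n i. 1 \<le> n \<and> i \<le> n \<longrightarrow> descends (grp X n) (N n) (grp X (n - 1)) (N (n - 1)) (face X n i)) \<and>
     (\<forall>n. descends (grp X n) (N n) (grp X n) (N n) (cyc X n))"

lemma quotient_pair_compatible:
  "compatible X N \<Longrightarrow> compatible Y N' \<Longrightarrow> quotient_pair (grp X n) (grp Y m) (N n) (N' m)"
  by (simp add: compatible_def quotient_pair_def)

lemma quotient_data_simps:
  "grp (quotient_data X N) n = grp X n Mod N n"
  "ract (quotient_data X N) n E h = induced (grp X n) (N n) (\<lambda>x. ract X n x h) E"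
  "face (quotient_data X N) n i = induced (grp X (n - 1)) (N (n - 1)) (face X n i)"
  "cyc (quotient_data X N) n = induced (grp X n) (N n) (cyc X n)"
  by (simp_all add: quotient_data_def)

context
  fixes X :: "('h, 'e) cyc_data" and N
  assumes X: "compatible X N"
begin

interpretation XX: quotient_pair "grp X n" "grp X m" "N n" "N m" for n m
  using quotient_pair_compatible [OF X X] .

lemma quotient_ract:
    "x \<in> carrier (grp X n) \<Longrightarrow> ract (quotient_data X N) n (N n #>\<^bsub>grp X n\<^esub> x) h = N n #>\<^bsub>grp X n\<^esub> ract X n x h"
  and quotient_face: "1 \<le> n \<Longrightarrow> i \<le> n \<Longrightarrow> x \<in> carrier (grp X n) \<Longrightarrow>
    face (quotient_data X N) n i (N n #>\<^bsub>grp X n\<^esub> x) = N (n - 1) #>\<^bsub>grp X (n - 1)\<^esub> face X n i x"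
  and quotient_cyc: "x \<in> carrier (grp X n) \<Longrightarrow>
    cyc (quotient_data X N) n (N n #>\<^bsub>grp X n\<^esub> x) = N n #>\<^bsub>grp X n\<^esub> cyc X n x"
  using X unfolding compatible_def quotient_data_simps by (simp_all add: XX.induced_coset)

lemma quotient_ract_hom:
    "(\<lambda>E. ract (quotient_data X N) n E h) \<in> hom (grp (quotient_data X N) n) (grp (quotient_data X N) n)"
  and quotient_face_hom: "1 \<le> n \<Longrightarrow> i \<le> n \<Longrightarrow>
    face (quotient_data X N) n i \<in> hom (grp (quotient_data X N) n) (grp (quotient_data X N) (n - 1))"
  and quotient_cyc_hom:
    "cyc (quotient_data X N) n \<in> hom (grp (quotient_data X N) n) (grp (quotient_data X N) n)"
  using X unfolding compatible_def quotient_data_simps by (simp_all add: XX.induced_hom)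

lemma compatible_closed:
  assumes "x \<in> carrier (grp X n)"
  shows "ract X n x h \<in> carrier (grp X n)" and "cyc X n x \<in> carrier (grp X n)"
    and "1 \<le> n \<Longrightarrow> i \<le> n \<Longrightarrow> face X n i x \<in> carrier (grp X (n - 1))"
proof -
  have "(\<lambda>x. ract X n x h) \<in> hom (grp X n) (grp X n)" "cyc X n \<in> hom (grp X n) (grp X n)"
    using X unfolding compatible_def descends_def by blast+
  then show "ract X n x h \<in> carrier (grp X n)" "cyc X n x \<in> carrier (grp X n)"
    using assms by (auto dest: hom_in_carrier)
  assume "1 \<le> n" "i \<le> n"
  then have "face X n i \<in> hom (grp X n) (grp X (n - 1))"
    using X unfolding compatible_def descends_def by blast
  then show "face X n i x \<in> carrier (grp X (n - 1))"
    using assms by (rule hom_in_carrier)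
qed

end

lemma twisted_map_quotient:
  assumes X: "compatible X N" and Y: "compatible Y N'" and K: "twisted_map X Y K"
    and KN: "\<And>a n. K a n ` N n \<subseteq> N' n"
  shows "twisted_map (quotient_data X N) (quotient_data Y N') (\<lambda>a n. induced (grp Y n) (N' n) (K a n))"
    (is "twisted_map ?X ?Y ?K")
proof -
  interpret XY: quotient_pair "grp X n" "grp Y m" "N n" "N' m" for n m
    using quotient_pair_compatible [OF X Y] .
  have desc: "descends (grp X n) (N n) (grp Y n) (N' n) (K a n)" for a n
    using twisted_map_hom [OF K] KN unfolding descends_def by simp
  note coset = XY.induced_coset [OF desc]
  note closed = twisted_map_closed [OF K]
  show ?thesis
    unfolding twisted_map_def
  proof (intro conjI allI impI ballI)
    show "?K a n = ?K b n" if "\<forall>i\<le>n. a i = b i" for a b n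
      using twisted_map_cong [OF K] that by metis
    show "right_module_map (grp ?X n) (ract ?X n) (grp ?Y n) (ract ?Y n) (?K a n)" for a n
      unfolding right_module_map_def
    proof (intro conjI ballI allI)
      show "?K a n \<in> hom (grp ?X n) (grp ?Y n)"
        using XY.induced_hom [OF desc] by (simp add: quotient_data_simps)
      fix E h assume "E \<in> carrier (grp ?X n)"
      then obtain x where x: "x \<in> carrier (grp X n)" "E = N n #>\<^bsub>grp X n\<^esub> x"
        by (auto simp: quotient_data_simps carrier_FactGroup)
      then show "?K a n (ract ?X n E h) = ract ?Y n (?K a n E) h"
        by (simp add: quotient_ract [OF X] quotient_ract [OF Y] coset closed compatible_closed [OF X]
            twisted_map_ract [OF K])
    qed
    show "?K (delete_label n i a) (n - 1) (face ?X n i E) = face ?Y n i (?K a n E)"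
      if ni: "1 \<le> n \<and> i \<le> n" and E: "E \<in> carrier (grp ?X n)" for a n i E
    proof -
      obtain x where x: "x \<in> carrier (grp X n)" "E = N n #>\<^bsub>grp X n\<^esub> x"
        using E by (auto simp: quotient_data_simps carrier_FactGroup)
      then show ?thesis
        using ni compatible_closed(3) [OF X x(1), of i] twisted_map_face [OF K, of n i x a]
        by (simp add: quotient_face [OF X] quotient_face [OF Y] coset closed)
    qed
    show "?K (rotate_labels n a) n (cyc ?X n E) = cyc ?Y n (?K a n E)" if E: "E \<in> carrier (grp ?X n)" for a n E
    proof -
      obtain x where x: "x \<in> carrier (grp X n)" "E = N n #>\<^bsub>grp X n\<^esub> x"
        using E by (auto simp: quotient_data_simps carrier_FactGroup)
      then show ?thesis
        by (simp add: quotient_cyc [OF X] quotient_cyc [OF Y] coset closed compatible_closed [OF X]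
            twisted_map_cyc [OF K])
    qed
  qed
qed

section \<open>The relations that make powers of the cyclic operator linear\<close>

definition coeq_gen ::
  "('k, 'l, 'r, 'h::ring_1) hopf_algebroid \<Rightarrow> ('h, 'e) cyc_data \<Rightarrow> nat \<Rightarrow> nat \<Rightarrow> 'e \<Rightarrow> 'h \<Rightarrow> 'h \<Rightarrow> 'e" where
  "coeq_gen A X n j x h u =
     ract X n ((cyc X n ^^ j) (ract X n x h) \<otimes>\<^bsub>grp X n\<^esub> inv\<^bsub>grp X n\<^esub> (ract X n ((cyc X n ^^ j) x) h)) u"

lemma coeq_rel_eq:
  "coeq_rel A X n = generate (grp X n)
     {coeq_gen A X n j x h (tR A r * sR A r') | x h j r r'. x \<in> carrier (grp X n)}"
  by (simp add: coeq_rel_def coeq_gen_def)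

lemma coeq_gen_closed:
  assumes "group (grp X n)" and "\<And>h. (\<lambda>x. ract X n x h) \<in> hom (grp X n) (grp X n)"
    and "cyc X n \<in> hom (grp X n) (grp X n)" and "x \<in> carrier (grp X n)"
  shows "coeq_gen A X n j x h u \<in> carrier (grp X n)"
proof -
  interpret group "grp X n" by fact
  have r: "ract X n y g \<in> carrier (grp X n)" if "y \<in> carrier (grp X n)" for y g
    using assms(2) [of g] that unfolding hom_def by blast
  have "(cyc X n ^^ j) y \<in> carrier (grp X n)" if "y \<in> carrier (grp X n)" for y
    using assms(3) that by (induction j) (auto simp: hom_def)
  then show ?thesis unfolding coeq_gen_def using r assms(4) by simp
qed

lemma subgroup_coeq_rel:
  assumes "group (grp X n)" and "\<And>h. (\<lambda>x. ract X n x h) \<in> hom (grp X n) (grp X n)"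
    and "cyc X n \<in> hom (grp X n) (grp X n)"
  shows "subgroup (coeq_rel A X n) (grp X n)"
  unfolding coeq_rel_eq
  by (rule group.generate_is_subgroup) (use assms coeq_gen_closed [OF assms] in auto)

text \<open>Rotation has finite order: \<open>n * j\<close> steps followed by \<open>j\<close> more
  make \<open>j\<close> full turns, so the labelling rotated \<open>n * j\<close> times is a
  preimage.\<close>

lemma rotate_labels_surj: "\<exists>b. \<forall>i\<le>n. (rotate_labels n ^^ j) b i = a i"
proof (intro exI allI impI)
  fix i assume "i \<le> n"
  have "(rotate_labels n ^^ j) ((rotate_labels n ^^ (n * j)) a) i = (rotate_labels n ^^ (j + n * j)) a i"
    by (simp add: funpow_add)
  also have "\<dots> = a ((i + (n * j) * (n + 1)) mod (n + 1))"
    using \<open>i \<le> n\<close> by (simp add: rotate_labels_funpow algebra_simps)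
  also have "\<dots> = a i"
    using \<open>i \<le> n\<close> by (simp only: mod_mult_self1) simp
  finally show "(rotate_labels n ^^ j) ((rotate_labels n ^^ (n * j)) a) i = a i" .
qed

text \<open>The generator given by \<open>j\<close>, \<open>h\<close>, \<open>u\<close> at
  \<open>x\<close> goes to the generator given by the same \<open>j\<close>, \<open>h\<close>,
  \<open>u\<close> at \<open>K b x\<close>, where \<open>b\<close> is a labelling that
  \<open>j\<close> rotations turn into \<open>a\<close>. Since \<open>b\<close> varies with
  \<open>j\<close>, the argument needs the operators for all labellings.\<close>

lemma twisted_map_coeq_rel:
  assumes "group (grp X n)" and "group (grp Y n)"
    and "\<And>h. (\<lambda>x. ract X n x h) \<in> hom (grp X n) (grp X n)"
    and "cyc X n \<in> hom (grp X n) (grp X n)"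
    and K: "twisted_map X Y K"
  shows "K a n ` coeq_rel A X n \<subseteq> coeq_rel A Y n"
proof -
  interpret X: group "grp X n" by fact
  interpret Y: group "grp Y n" by fact
  let ?S = "{coeq_gen A X n j x h (tR A r * sR A r') | x h j r r'. x \<in> carrier (grp X n)}"
  let ?S' = "{coeq_gen A Y n j x h (tR A r * sR A r') | x h j r r'. x \<in> carrier (grp Y n)}"
  interpret K: group_hom "grp X n" "grp Y n" "K a n"
    by unfold_locales (rule twisted_map_hom [OF K])
  have ract: "ract X n y g \<in> carrier (grp X n)" if "y \<in> carrier (grp X n)" for y g
    using assms(3) [of g] that unfolding hom_def by blast
  have cyc: "cyc X n y \<in> carrier (grp X n)" if "y \<in> carrier (grp X n)" for y
    using assms(4) that by (auto simp: hom_def)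
  have pow: "(cyc X n ^^ j) y \<in> carrier (grp X n)" if "y \<in> carrier (grp X n)" for j y
    by (induction j) (use that cyc in auto)
  have "K a n (coeq_gen A X n j x h u) \<in> {coeq_gen A Y n j x h u | x. x \<in> carrier (grp Y n)}"
    if x: "x \<in> carrier (grp X n)" for x h j u
  proof -
    obtain b where b: "\<forall>i\<le>n. (rotate_labels n ^^ j) b i = a i" using rotate_labels_surj by blast
    have eq: "K a n = K ((rotate_labels n ^^ j) b) n" by (rule twisted_map_cong [OF K]) (simp add: b)
    have Kpow: "K a n ((cyc X n ^^ j) y) = (cyc Y n ^^ j) (K b n y)" if "y \<in> carrier (grp X n)" for y
      unfolding eq by (rule twisted_map_funpow [OF K cyc that])
    have "K a n (coeq_gen A X n j x h u) = coeq_gen A Y n j (K b n x) h u"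
      unfolding coeq_gen_def using x ract pow by (simp add: twisted_map_ract [OF K] Kpow)
    then show ?thesis using twisted_map_closed [OF K x] by blast
  qed
  then have "K a n ` ?S \<subseteq> ?S'" by blast
  moreover have "?S \<subseteq> carrier (grp X n)"
    using coeq_gen_closed [OF assms(1,3,4)] by auto
  ultimately show ?thesis
    unfolding coeq_rel_eq using K.generate_img [of ?S] Y.mono_generate [of "K a n ` ?S" ?S'] by simp
qed

text \<open>A union of cosets of \<open>N\<close> absorbs \<open>N\<close>, even if it is not a
  single coset. So the neutral element of the quotient group acts trivially on values of an induced
  map that is not yet known to be well defined.\<close>

lemma set_mult_induced:
  assumes "comm_group K" and "subgroup N K" and "\<And>x. x \<in> E \<Longrightarrow> f x \<in> carrier K"
  shows "N <#>\<^bsub>K\<^esub> induced K N f E = induced K N f E"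
proof -
  interpret comm_group K by fact
  have "N <#>\<^bsub>K\<^esub> (N #>\<^bsub>K\<^esub> f x) = N #>\<^bsub>K\<^esub> f x" if "x \<in> E" for x
    using subgroup_mult_id [OF assms(2)] assms(3) [OF that] subgroup.subset [OF assms(2)]
    by (simp add: setmult_rcos_assoc)
  moreover have "N <#>\<^bsub>K\<^esub> (\<Union>x\<in>E. B x) = (\<Union>x\<in>E. N <#>\<^bsub>K\<^esub> B x)" for B
    unfolding set_mult_def by blast
  ultimately show ?thesis unfolding induced_def by simp
qed

text \<open>The cosets of \<open>coeq_rel\<close> are sets of cosets of \<open>N\<close>. So if an induced face takes cosets of
  \<open>coeq_rel\<close> to cosets, then already the face on \<open>X/N\<close> takes cosets to cosets.\<close>

lemma compatible_iterated_quotient: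
  assumes grp: "\<And>n. comm_group (grp X n)" and N: "\<And>n. subgroup (N n) (grp X n)"
    and ract: "\<And>n h. descends (grp X n) (N n) (grp X n) (N n) (\<lambda>x. ract X n x h)"
    and face: "\<And>n i. 1 \<le> n \<Longrightarrow> i \<le> n \<Longrightarrow> face X n i \<in> hom (grp X n) (grp X (n - 1))"
    and cyc: "\<And>n. cyc X n \<in> hom (grp X n) (grp X n)"
    and T: "T = quotient_data X N"
    and cycT: "\<And>n. cyc T n \<in> hom (grp T n) (grp T n)"
    and para: "para_cyclic_module (quotient_data T (coeq_rel A T))"
  shows "compatible X N" and "compatible T (coeq_rel A T)"
proof -
  interpret X: quotient_pair "grp X n" "grp X m" "N n" "N m" for n m
    using grp N by (simp add: quotient_pair_def)
  have grpT: "comm_group (grp T n)" for n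
    unfolding T quotient_data_simps using X.G.abelian_FactGroup X.N.subgroup_axioms by blast
  have ractT: "(\<lambda>x. ract T n x h) \<in> hom (grp T n) (grp T n)" for n h
    unfolding T quotient_data_simps by (rule X.induced_hom [OF ract])
  have coeq: "subgroup (coeq_rel A T n) (grp T n)" for n
    by (rule subgroup_coeq_rel [OF comm_group.axioms(2) [OF grpT] ractT cycT])
  interpret T: quotient_pair "grp T n" "grp T m" "coeq_rel A T n" "coeq_rel A T m" for n m
    using grpT coeq by (simp add: quotient_pair_def)
  have NT: "N n \<in> carrier (grp T n)" for n
    using X.N.subgroup_in_rcosets [OF X.G.is_group] unfolding T quotient_data_simps FactGroup_def by simp
  have face_desc: "descends (grp X n) (N n) (grp X (n - 1)) (N (n - 1)) (face X n i)"
    if ni: "1 \<le> n" "i \<le> n" for n i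
  proof (rule X.descends_if_induced [OF face [OF ni]])
    let ?Q = "quotient_data T (coeq_rel A T)"
    let ?E = "coeq_rel A T n #>\<^bsub>grp T n\<^esub> N n" and ?U = "face T n i (N n)"
    have U: "?U = induced (grp X (n - 1)) (N (n - 1)) (face X n i) (N n)"
      unfolding T quotient_data_simps ..
    have "?E \<in> carrier (grp ?Q n)"
      using NT by (auto simp: quotient_data_simps carrier_FactGroup)
    then have "face ?Q n i ?E \<in> carrier (grp ?Q (n - 1))"
      using para_cyclic_face_closed [OF para ni] by blast
    then have "face ?Q n i ?E \<subseteq> carrier (grp T (n - 1))"
      using T.N.rcosets_carrier [OF T.G.is_group] unfolding quotient_data_simps FactGroup_def by simp
    moreover have "N n \<in> ?E"
      using T.G.rcos_self NT coeq by blast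
    moreover have "\<one>\<^bsub>grp T (n - 1)\<^esub> \<in> coeq_rel A T (n - 1)"
      using T.N.one_closed .
    \<comment> \<open>The set \<open>?U\<close> is not yet known to be an element of the group
      \<open>T\<close>. But the image of the trivial coset under the induced face lies in the
      carrier of \<open>T\<close> and contains \<open>1 * ?U\<close>, and absorption of
      \<open>N (n - 1)\<close> identifies this product with \<open>?U\<close>.\<close>
    ultimately have "\<one>\<^bsub>grp T (n - 1)\<^esub> \<otimes>\<^bsub>grp T (n - 1)\<^esub> ?U \<in> carrier (grp T (n - 1))"
      unfolding quotient_data_simps(3) induced_def r_coset_def by blast
    moreover have "\<one>\<^bsub>grp T (n - 1)\<^esub> \<otimes>\<^bsub>grp T (n - 1)\<^esub> ?U = ?U"
    proof -
      have "N (n - 1) <#>\<^bsub>grp X (n - 1)\<^esub> ?U = ?U"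
        unfolding U using hom_in_carrier [OF face [OF ni]] X.N.subset
        by (intro set_mult_induced grp N) blast
      then show ?thesis unfolding T quotient_data_simps by simp
    qed
    ultimately show "induced (grp X (n - 1)) (N (n - 1)) (face X n i) (N n)
        \<in> carrier (grp X (n - 1) Mod N (n - 1))"
      unfolding U T quotient_data_simps by simp
  qed
  have cyc_desc: "descends (grp X n) (N n) (grp X n) (N n) (cyc X n)" for n
  proof (rule X.descends_if_induced [OF cyc])
    show "induced (grp X n) (N n) (cyc X n) (N n) \<in> carrier (grp X n Mod N n)"
      using hom_in_carrier [OF cycT NT] unfolding T quotient_data_simps .
  qed
  show X: "compatible X N"
    unfolding compatible_def using grp N ract face_desc cyc_desc by blast
  have coeqQ: "coeq_rel A T n \<in> carrier (grp (quotient_data T (coeq_rel A T)) n)" for n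
    using T.N.subgroup_in_rcosets [OF T.G.is_group] unfolding quotient_data_simps FactGroup_def by simp
  show "compatible T (coeq_rel A T)"
    unfolding compatible_def
  proof (intro conjI allI impI)
    fix n
    show "comm_group (grp T n)" by (rule grpT)
    show "subgroup (coeq_rel A T n) (grp T n)" by (rule coeq)
    show "descends (grp T n) (coeq_rel A T n) (grp T n) (coeq_rel A T n) (\<lambda>x. ract T n x h)" for h
    proof (rule T.descends_if_induced [OF ractT])
      have "(\<lambda>x. ract (quotient_data T (coeq_rel A T)) n x h)
          \<in> hom (grp (quotient_data T (coeq_rel A T)) n) (grp (quotient_data T (coeq_rel A T)) n)"
        using para_cyclic_right_module [OF para] unfolding right_module_def by blast
      from hom_in_carrier [OF this coeqQ]
      show "induced (grp T n) (coeq_rel A T n) (\<lambda>x. ract T n x h) (coeq_rel A T n)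
          \<in> carrier (grp T n Mod coeq_rel A T n)"
        unfolding quotient_data_simps .
    qed
    show "descends (grp T n) (coeq_rel A T n) (grp T (n - 1)) (coeq_rel A T (n - 1)) (face T n i)"
      if "1 \<le> n \<and> i \<le> n" for i
    proof (rule T.descends_if_induced)
      show "face T n i \<in> hom (grp T n) (grp T (n - 1))"
        unfolding T using that by (intro quotient_face_hom [OF X]) auto
      show "induced (grp T (n - 1)) (coeq_rel A T (n - 1)) (face T n i) (coeq_rel A T n)
          \<in> carrier (grp T (n - 1) Mod coeq_rel A T (n - 1))"
        using para_cyclic_face_closed [OF para _ _ coeqQ, of n i] that
        unfolding quotient_data_simps by blast
    qed
    show "descends (grp T n) (coeq_rel A T n) (grp T n) (coeq_rel A T n) (cyc T n)"
    proof (rule T.descends_if_induced [OF cycT])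
      show "induced (grp T n) (coeq_rel A T n) (cyc T n) (coeq_rel A T n)
          \<in> carrier (grp T n Mod coeq_rel A T n)"
        using para_cyclic_cyc_closed [OF para coeqQ, of n] unfolding quotient_data_simps .
    qed
  qed
qed

section \<open>Maps on the twofold quotient\<close>

definition double_coset ::
  "('k, 'l, 'r, 'h::ring_1) hopf_algebroid \<Rightarrow> ('h, 'e) cyc_data \<Rightarrow> (nat \<Rightarrow> 'e set) \<Rightarrow> nat \<Rightarrow> 'e \<Rightarrow> 'e set set"
  where
  "double_coset A X N n c =
     coeq_rel A (quotient_data X N) n #>\<^bsub>grp (quotient_data X N) n\<^esub> (N n #>\<^bsub>grp X n\<^esub> c)"

lemma carrier_iterated_quotient:
  "carrier (grp (quotient_data (quotient_data X N) (coeq_rel A (quotient_data X N))) n)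
     = double_coset A X N n ` carrier (grp X n)"
  by (auto simp: quotient_data_simps carrier_FactGroup double_coset_def)

text \<open>The value on double cosets is recorded because it allows the operators at constant
  labellings to be recognised from free representatives.\<close>

lemma twisted_map_iterated_quotient:
  assumes X: "compatible X N" "compatible (quotient_data X N) (coeq_rel A (quotient_data X N))"
    and Y: "compatible Y N'" "compatible (quotient_data Y N') (coeq_rel A (quotient_data Y N'))"
    and K: "twisted_map X Y K" and KN: "\<And>a n. K a n ` N n \<subseteq> N' n"
  shows "\<exists>L. twisted_map (quotient_data (quotient_data X N) (coeq_rel A (quotient_data X N)))
      (quotient_data (quotient_data Y N') (coeq_rel A (quotient_data Y N'))) L \<and>
    (\<forall>a n. \<forall>c\<in>carrier (grp X n). L a n (double_coset A X N n c) = double_coset A Y N' n (K a n c))"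
proof -
  let ?X = "quotient_data X N" and ?Y = "quotient_data Y N'"
  let ?K = "\<lambda>a n. induced (grp Y n) (N' n) (K a n)"
  let ?L = "\<lambda>a n. induced (grp ?Y n) (coeq_rel A ?Y n) (?K a n)"
  interpret P: quotient_pair "grp X n" "grp Y m" "N n" "N' m" for n m
    using quotient_pair_compatible [OF X(1) Y(1)] .
  interpret Q: quotient_pair "grp ?X n" "grp ?Y m" "coeq_rel A ?X n" "coeq_rel A ?Y m" for n m
    using quotient_pair_compatible [OF X(2) Y(2)] .
  have K1: "twisted_map ?X ?Y ?K"
    by (rule twisted_map_quotient [OF X(1) Y(1) K KN])
  have KN1: "?K a n ` coeq_rel A ?X n \<subseteq> coeq_rel A ?Y n" for a n
    by (rule twisted_map_coeq_rel [OF Q.G.is_group Q.K.is_group quotient_ract_hom [OF X(1)]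
          quotient_cyc_hom [OF X(1)] K1])
  have "descends (grp X n) (N n) (grp Y n) (N' n) (K a n)" for a n
    using twisted_map_hom [OF K] KN unfolding descends_def by simp
  note coset = P.induced_coset [OF this]
  have "descends (grp ?X n) (coeq_rel A ?X n) (grp ?Y n) (coeq_rel A ?Y n) (?K a n)" for a n
    using twisted_map_hom [OF K1] KN1 unfolding descends_def by simp
  note coset1 = Q.induced_coset [OF this]
  have "?L a n (double_coset A X N n c) = double_coset A Y N' n (K a n c)"
    if "c \<in> carrier (grp X n)" for a n c
  proof -
    have "N n #>\<^bsub>grp X n\<^esub> c \<in> carrier (grp ?X n)"
      using that by (auto simp: quotient_data_simps carrier_FactGroup)
    then show ?thesis
      using that by (simp add: double_coset_def coset1 coset)
  qed
  then show ?thesis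
    using twisted_map_quotient [OF X(2) Y(2) K1 KN1] by blast
qed

section \<open>The free level\<close>

lemma frag_extend_frag_extend:
  "frag_extend f (frag_extend g x) = frag_extend (\<lambda>s. frag_extend f (g s)) x"
  using subset_UNIV by (induction x rule: frag_induction) (auto simp: frag_extend_diff)

lemma keys_frag_extend_subset:
  assumes "\<And>s. s \<in> Poly_Mapping.keys x \<Longrightarrow> Poly_Mapping.keys (f s) \<subseteq> S"
  shows "Poly_Mapping.keys (frag_extend f x) \<subseteq> S"
  using keys_frag_extend [of f x] assms by blast

lemma frag_extend_hom:
  assumes "\<And>s. s \<in> S \<Longrightarrow> Poly_Mapping.keys (f s) \<subseteq> S'"
  shows "frag_extend f \<in> hom (free_Abelian_group S) (free_Abelian_group S')"
proof (rule homI)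
  fix x assume "x \<in> carrier (free_Abelian_group S)"
  then show "frag_extend f x \<in> carrier (free_Abelian_group S')"
    using assms keys_frag_extend_subset [of x f S'] by auto
qed (simp add: frag_extend_add)

lemma keys_diff_subset:
  fixes x y :: "'a \<Rightarrow>\<^sub>0 int"
  assumes "Poly_Mapping.keys x \<subseteq> S" and "Poly_Mapping.keys y \<subseteq> S"
  shows "Poly_Mapping.keys (x - y) \<subseteq> S"
  using assms keys_diff [of x y] by blast

text \<open>A bridge between two notions of generated subgroup: the quotients are formed with
  \<open>generate\<close> in a group record, while membership of differences is handled with
  \<open>group_closure\<close> on the type of formal sums.\<close>

lemma generate_free_Abelian_group:
  assumes R: "R \<subseteq> carrier (free_Abelian_group S)"
  shows "generate (free_Abelian_group S) R = group_closure R"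
proof
  interpret group "free_Abelian_group S" by simp
  have "subgroup (group_closure R) (free_Abelian_group S)"
  proof
    show sub: "group_closure R \<subseteq> carrier (free_Abelian_group S)"
    proof
      fix x assume "x \<in> group_closure R"
      then show "x \<in> carrier (free_Abelian_group S)"
      proof induction
        case (base s)
        then show ?case using R by (cases "s = 0") (simp_all add: subset_iff)
      next
        case (diff s t)
        then show ?case using keys_diff_subset [of s S t] by simp
      qed
    qed
    show "inv\<^bsub>free_Abelian_group S\<^esub> x \<in> group_closure R" if "x \<in> group_closure R" for x
      using that sub by (auto simp: subset_iff)
  qed (auto intro: group_closure_add)
  then show "generate (free_Abelian_group S) R \<subseteq> group_closure R"
    by (intro generate_subgroup_incl) (auto intro: group_closure.base)
  show "group_closure R \<subseteq> generate (free_Abelian_group S) R"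
  proof
    fix x assume "x \<in> group_closure R"
    then show "x \<in> generate (free_Abelian_group S) R"
    proof induction
      case (base s)
      then show ?case
        using generate.one [of "free_Abelian_group S" R] generate.incl [of s R] by auto
    next
      case (diff s t)
      have "inv\<^bsub>free_Abelian_group S\<^esub> t \<in> generate (free_Abelian_group S) R"
        using generate_m_inv_closed [OF R diff.IH(2)] .
      moreover have "inv\<^bsub>free_Abelian_group S\<^esub> t = - t"
        using generate_in_carrier [OF R diff.IH(2)] by simp
      ultimately show ?case
        using generate.eng [OF diff.IH(1), of "- t"] by simp
    qed
  qed
qed

lemma frag_extend_group_closure:
  assumes "x \<in> group_closure R" and "\<And>r. r \<in> R \<Longrightarrow> frag_extend f r \<in> group_closure R'"
  shows "frag_extend f x \<in> group_closure R'"
  using assms(1)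
  by induction (use assms(2) in \<open>auto simp: frag_extend_diff intro: group_closure.diff\<close>)

lemma Suc_mod_Suc: "i \<le> n \<Longrightarrow> (i + 1) mod (n + 1) = (if i = n then 0 else i + 1)" for i n :: nat
  by auto

lemma fst_upd [simp]: "fst (upd ps i f ! j) = fst (ps ! j)"
  by (cases "i < length ps") (auto simp: upd_def nth_list_update list_update_beyond)

lemma snd_upd: "i < length ps \<Longrightarrow> snd (upd ps i f ! j) = (if j = i then f else snd (ps ! j))"
  by (simp add: upd_def nth_list_update)

lemma length_upd [simp]: "length (upd ps i f) = length ps"
  by (simp add: upd_def)

lemma upd_nth_eq:
  "i < length ps \<Longrightarrow> j < length ps \<Longrightarrow> upd ps i f ! j = (fst (ps ! j), if j = i then f else snd (ps ! j))"
  by (rule prod_eqI) (simp_all add: snd_upd)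

lemma simples_iff:
  "(ps, m) \<in> simples C n \<longleftrightarrow> length ps = n + 1 \<and>
     (\<forall>i\<le>n. fst (ps ! i) \<in> Obj C \<and>
        snd (ps ! i) \<in> Hom C (fst (ps ! ((i + 1) mod (n + 1)))) (fst (ps ! i)))"
  by (simp add: simples_def)

lemma simplesD:
  assumes "(ps, m) \<in> simples C n"
  shows "length ps = n + 1" and "i \<le> n \<Longrightarrow> fst (ps ! i) \<in> Obj C"
    and "i \<le> n \<Longrightarrow> snd (ps ! i) \<in> Hom C (fst (ps ! (if i = n then 0 else i + 1))) (fst (ps ! i))"
    and "i \<le> n \<Longrightarrow> fst (ps ! (if i = n then 0 else i + 1)) \<in> Obj C"
  using assms unfolding simples_iff by (auto simp: Suc_mod_Suc)

section \<open>Hom-modules and composition\<close>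

context
  fixes A :: "('k::comm_ring_1, 'l::ring_1, 'r::ring_1, 'h::ring_1) hopf_algebroid"
    and C :: "('k, 'h, 'o, 'f::ab_group_add) hcat"
  assumes C: "H_category A C"
begin

lemma Hom_module: "X \<in> Obj C \<Longrightarrow> Y \<in> Obj C \<Longrightarrow> left_module_on (scH A) (Hom C X Y) (ksc C) (hact C)"
  using C [unfolded H_category_def, THEN conjunct1] by blast

lemma Hom_zero: "X \<in> Obj C \<Longrightarrow> Y \<in> Obj C \<Longrightarrow> 0 \<in> Hom C X Y"
  and Hom_diff: "X \<in> Obj C \<Longrightarrow> Y \<in> Obj C \<Longrightarrow> f \<in> Hom C X Y \<Longrightarrow> g \<in> Hom C X Y \<Longrightarrow> f - g \<in> Hom C X Y"
  and Hom_hact: "X \<in> Obj C \<Longrightarrow> Y \<in> Obj C \<Longrightarrow> f \<in> Hom C X Y \<Longrightarrow> hact C h f \<in> Hom C X Y"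
  and hact_add: "X \<in> Obj C \<Longrightarrow> Y \<in> Obj C \<Longrightarrow> f \<in> Hom C X Y \<Longrightarrow> g \<in> Hom C X Y \<Longrightarrow>
    hact C h (f + g) = hact C h f + hact C h g"
  and hact_add_left: "X \<in> Obj C \<Longrightarrow> Y \<in> Obj C \<Longrightarrow> f \<in> Hom C X Y \<Longrightarrow>
    hact C (h + h') f = hact C h f + hact C h' f"
  and hact_mult: "X \<in> Obj C \<Longrightarrow> Y \<in> Obj C \<Longrightarrow> f \<in> Hom C X Y \<Longrightarrow>
    hact C (h * h') f = hact C h (hact C h' f)"
  and hact_one: "X \<in> Obj C \<Longrightarrow> Y \<in> Obj C \<Longrightarrow> f \<in> Hom C X Y \<Longrightarrow> hact C 1 f = f"
  using Hom_module [of X Y] unfolding left_module_on_def by simp_all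

lemma Hom_add: "X \<in> Obj C \<Longrightarrow> Y \<in> Obj C \<Longrightarrow> f \<in> Hom C X Y \<Longrightarrow> g \<in> Hom C X Y \<Longrightarrow> f + g \<in> Hom C X Y"
  using Hom_diff [of X Y f "0 - g"] Hom_diff [of X Y 0 g] Hom_zero by simp

lemmas category_axioms = C [unfolded H_category_def, THEN conjunct2, THEN conjunct1]
lemmas Idm_Cmp = category_axioms [THEN conjunct2, THEN conjunct1, rule_format, THEN conjunct2]
lemmas Hom_Cmp = category_axioms [THEN conjunct2, THEN conjunct2, THEN conjunct1, rule_format]
lemmas Cmp_assoc = category_axioms [THEN conjunct2, THEN conjunct2, THEN conjunct2, THEN conjunct1,
  rule_format]
lemmas Cmp_add_left = category_axioms [THEN conjunct2, THEN conjunct2, THEN conjunct2, THEN conjunct2,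
  THEN conjunct1, rule_format]
lemmas Cmp_add_right = category_axioms [THEN conjunct2, THEN conjunct2, THEN conjunct2, THEN conjunct2,
  THEN conjunct2, THEN conjunct1, rule_format]

end

section \<open>The operators on free chains\<close>

lemma length_iterated_DeltaL:
  "hs \<in> Poly_Mapping.keys (iterated_DeltaL A n h) \<Longrightarrow> length hs = n + 1"
proof (induction n arbitrary: h hs)
  case (Suc n)
  have "Poly_Mapping.keys (iterated_DeltaL A (Suc n) h) \<subseteq> {hs. length hs = n + 2}"
    unfolding iterated_DeltaL.simps
  proof (rule keys_frag_extend_subset)
    fix s
    show "Poly_Mapping.keys (case s of (a, b) \<Rightarrow>
        frag_extend (\<lambda>hs. frag_of (a # hs)) (iterated_DeltaL A n b)) \<subseteq> {hs. length hs = n + 2}"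
      using Suc.IH by (cases s) (auto intro!: keys_frag_extend_subset)
  qed
  then show ?case using Suc.prems by auto
qed simp

abbreviation act_list :: "('k, 'h, 'o, 'f) hcat \<Rightarrow> 'h list \<Rightarrow> ('o \<times> 'f) list \<Rightarrow> ('o \<times> 'f) list" where
  "act_list C hs ps \<equiv> map2 (\<lambda>a (X, f). (X, hact C a f)) hs ps"

lemma length_act_list:
  "length hs = n + 2 \<Longrightarrow> length ps = n + 1 \<Longrightarrow> length (act_list C hs ps) = n + 1"
  by (simp add: min_def)

lemma nth_act_list:
  "length hs = n + 2 \<Longrightarrow> length ps = n + 1 \<Longrightarrow> i \<le> n \<Longrightarrow>
    act_list C hs ps ! i = (fst (ps ! i), hact C (hs ! i) (snd (ps ! i)))"
  by (simp add: case_prod_beta)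

lemma nth_rotated_list:
  "length ps = n + 1 \<Longrightarrow> i \<le> n \<Longrightarrow> (q # butlast ps) ! i = (if i = 0 then q else ps ! (i - 1))"
  by (simp add: nth_Cons nth_butlast split: nat.split)

lemma nth_contracted_list:
  "length ps = n + 1 \<Longrightarrow> i < n \<Longrightarrow> k < n \<Longrightarrow>
    (take i ps @ q # drop (i + 2) ps) ! k = (if k < i then ps ! k else if k = i then q else ps ! (k + 1))"
  by (auto simp: nth_append nth_Cons' min_def)

text \<open>\<open>d_n = d_0 tau\<close> holds already before any quotient is taken, since both
  sides use the same Sweedler representative of the coaction. It reduces statements about the last
  face to the contraction at \<open>0\<close>.\<close>

lemma T_face_last:
  assumes "1 \<le> n" and "length (fst s) = n + 1"
  shows "T_face C M n n s = frag_extend (T_face C M n 0) (T_cyc C M n s)"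
proof -
  obtain ps m where s: "s = (ps, m)" by fastforce
  have "length ps = n + 1" using assms s by simp
  then have "butlast ps ! 0 = ps ! 0" "butlast (tl ps) = tl (butlast ps)"
    using assms(1) by (auto simp: nth_butlast butlast_tl)
  then show ?thesis
    using assms(1) unfolding s T_face_def T_cyc_def case_prod_conv frag_extend_frag_extend
    by (auto simp: drop_Suc intro!: frag_extend_eq)
qed

context
  fixes A :: "('k::comm_ring_1, 'l::ring_1, 'r::ring_1, 'h::ring_1) hopf_algebroid"
    and C :: "('k, 'h, 'o, 'f::ab_group_add) hcat"
    and M :: "('k, 'l, 'r, 'h, 'm::ab_group_add) mod_comod"
  assumes C: "H_category A C"
begin

lemma act_list_simples:
  assumes s: "(ps, m) \<in> simples C n" and hs: "length hs = n + 2"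
  shows "(act_list C hs ps, m') \<in> simples C n"
  unfolding simples_iff
proof (intro conjI allI impI)
  have len: "length ps = n + 1" using s unfolding simples_iff by blast
  then show "length (act_list C hs ps) = n + 1" by (rule length_act_list [OF hs])
  fix i assume i: "i \<le> n"
  let ?j = "(i + 1) mod (n + 1)"
  have j: "?j \<le> n" using mod_less_divisor [of "n + 1" "i + 1"] by linarith
  have "fst (ps ! i) \<in> Obj C" "fst (ps ! ?j) \<in> Obj C"
    "snd (ps ! i) \<in> Hom C (fst (ps ! ?j)) (fst (ps ! i))"
    using s i j unfolding simples_iff by blast+
  then show "fst (act_list C hs ps ! i) \<in> Obj C"
    "snd (act_list C hs ps ! i) \<in> Hom C (fst (act_list C hs ps ! ?j)) (fst (act_list C hs ps ! i))"
    unfolding nth_act_list [OF hs len i] nth_act_list [OF hs len j]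
    using Hom_hact [OF C] by simp_all
qed

lemma keys_T_act:
  assumes "s \<in> simples C n"
  shows "Poly_Mapping.keys (T_act A C M n h s) \<subseteq> simples C n"
proof -
  obtain ps m where ps: "s = (ps, m)" by fastforce
  show ?thesis
    unfolding T_act_def ps case_prod_conv
  proof (rule keys_frag_extend_subset)
    fix hs assume "hs \<in> Poly_Mapping.keys (iterated_DeltaL A (n + 1) (inv_into UNIV (antipode A) h))"
    then have "length hs = n + 2" using length_iterated_DeltaL by fastforce
    then show "Poly_Mapping.keys (frag_of (act_list C hs ps, actM M (hs ! (n + 1)) m)) \<subseteq> simples C n"
      using act_list_simples [of ps m n hs] assms by (simp add: ps)
  qed
qed

lemma keys_T_cyc: "s \<in> simples C n \<Longrightarrow> Poly_Mapping.keys (T_cyc C M n s) \<subseteq> simples C n"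
proof -
  assume s: "s \<in> simples C n"
  obtain ps m where ps: "s = (ps, m)" by fastforce
  have len: "length ps = n + 1" using s unfolding ps simples_iff by blast
  have "((fst (ps ! n), hact C h (snd (ps ! n))) # butlast ps, x) \<in> simples C n" for h x
    unfolding simples_iff
  proof (intro conjI allI impI)
    let ?qs = "(fst (ps ! n), hact C h (snd (ps ! n))) # butlast ps"
    show "length ?qs = n + 1" using len by simp
    fix k assume k: "k \<le> n"
    have obj: "fst (ps ! k) \<in> Obj C"
      and hom: "snd (ps ! k) \<in> Hom C (fst (ps ! (if k = n then 0 else k + 1))) (fst (ps ! k))"
      if "k \<le> n" for k
      using s that unfolding ps simples_iff by (auto simp: Suc_mod_Suc)
    show "fst (?qs ! k) \<in> Obj C"
      using k obj by (subst nth_rotated_list [OF len]) auto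
    have "snd (?qs ! k) \<in> Hom C (fst (?qs ! (if k = n then 0 else k + 1))) (fst (?qs ! k))"
      using k hom [of "k - 1", simplified] Hom_hact [OF C _ _ hom [of n]] obj [of 0] obj [of n]
      by (cases k) (auto simp: nth_butlast len split: if_splits)
    then show "snd (?qs ! k) \<in> Hom C (fst (?qs ! ((k + 1) mod (n + 1)))) (fst (?qs ! k))"
      unfolding Suc_mod_Suc [OF k] .
  qed
  then show ?thesis
    unfolding T_cyc_def ps case_prod_conv by (intro keys_frag_extend_subset) auto
qed

lemma keys_T_face:
  assumes n: "1 \<le> n" and i: "i \<le> n" and s: "s \<in> simples C n"
  shows "Poly_Mapping.keys (T_face C M n i s) \<subseteq> simples C (n - 1)"
proof -
  have less: "Poly_Mapping.keys (T_face C M n j t) \<subseteq> simples C (n - 1)"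
    if j: "j < n" and t: "t \<in> simples C n" for j t
  proof -
    obtain ps m where ps: "t = (ps, m)" by fastforce
    have len: "length ps = n + 1" using t unfolding ps simples_iff by blast
    define qs where "qs = take j ps @ (fst (ps ! j), Cmp C (snd (ps ! j)) (snd (ps ! (j + 1)))) # drop (j + 2) ps"
    have nth: "qs ! k = (if k < j then ps ! k else if k = j
        then (fst (ps ! j), Cmp C (snd (ps ! j)) (snd (ps ! (j + 1)))) else ps ! (k + 1))" if "k < n" for k
      unfolding qs_def by (rule nth_contracted_list [OF len j that])
    have obj: "fst (ps ! k) \<in> Obj C"
      and hom: "snd (ps ! k) \<in> Hom C (fst (ps ! (if k = n then 0 else k + 1))) (fst (ps ! k))"
      if "k \<le> n" for k
      using t that unfolding ps simples_iff by (auto simp: Suc_mod_Suc)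
    have comp: "Cmp C (snd (ps ! j)) (snd (ps ! (j + 1)))
        \<in> Hom C (fst (ps ! (if j + 1 = n then 0 else j + 2))) (fst (ps ! j))"
      using hom [of j] hom [of "j + 1"] j
      by (intro Hom_Cmp [OF C obj obj obj]) (auto split: if_splits)
    have "(qs, m) \<in> simples C (n - 1)"
      unfolding simples_iff
    proof (intro conjI allI impI)
      show "length qs = n - 1 + 1" using len j by (simp add: qs_def)
      fix k assume k: "k \<le> n - 1"
      then have kn: "k < n" using n by simp
      show "fst (qs ! k) \<in> Obj C"
        using kn j obj by (simp add: nth)
      \<comment> \<open>Entry \<open>k\<close> must be composable with its cyclic successor, so the
        cases record where \<open>k\<close> and \<open>k + 1\<close> lie relative to the contracted
        place, together with the wrap-around at \<open>n - 1\<close>.\<close>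
      consider "k + 1 < j" | "k + 1 = j" | "k = j" | "j < k" "k < n - 1" | "j < k" "k = n - 1"
        using k by linarith
      then show "snd (qs ! k) \<in> Hom C (fst (qs ! ((k + 1) mod (n - 1 + 1)))) (fst (qs ! k))"
        unfolding Suc_mod_Suc [OF k] using kn j comp hom [of k] hom [of "k + 1"]
        by cases (cases "j = 0"; auto simp: nth split: if_splits)+
    qed
    then show ?thesis using j unfolding T_face_def ps qs_def by simp
  qed
  show ?thesis
  proof (cases "i < n")
    case True then show ?thesis using less s by blast
  next
    case False
    have len: "length (fst s) = n + 1" using s by (auto simp: simples_def)
    have "i = n" using False i by simp
    moreover have "Poly_Mapping.keys (frag_extend (T_face C M n 0) (T_cyc C M n s)) \<subseteq> simples C (n - 1)"
      using keys_T_cyc [OF s] n by (intro keys_frag_extend_subset less) auto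
    ultimately show ?thesis
      using T_face_last [OF n len, of C M] by simp
  qed
qed

end

text \<open>A functor to \<open>D\<close> from the product of \<open>C\<close> with the category that has the two objects \<open>False\<close>
  and \<open>True\<close> and one isomorphism between them; \<open>u b c Y X\<close> is its effect on the morphisms from \<open>(X, c)\<close>
  to \<open>(Y, b)\<close>.\<close>

definition twisted_functor ::
  "('k, 'h, 'o, 'f::ab_group_add) hcat \<Rightarrow> ('k, 'h, 'p, 'g::ab_group_add) hcat \<Rightarrow>
   (bool \<Rightarrow> 'o \<Rightarrow> 'p) \<Rightarrow> (bool \<Rightarrow> bool \<Rightarrow> 'o \<Rightarrow> 'o \<Rightarrow> 'f \<Rightarrow> 'g) \<Rightarrow> bool" where
  "twisted_functor C D p u \<longleftrightarrow>
     (\<forall>b. \<forall>X\<in>Obj C. p b X \<in> Obj D) \<and>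
     (\<forall>b c. \<forall>X\<in>Obj C. \<forall>Y\<in>Obj C. \<forall>f\<in>Hom C X Y. u b c Y X f \<in> Hom D (p c X) (p b Y)) \<and>
     (\<forall>b c. \<forall>X\<in>Obj C. \<forall>Y\<in>Obj C. \<forall>f\<in>Hom C X Y. \<forall>g\<in>Hom C X Y.
        u b c Y X (f + g) = u b c Y X f + u b c Y X g) \<and>
     (\<forall>b c. \<forall>X\<in>Obj C. \<forall>Y\<in>Obj C. \<forall>f\<in>Hom C X Y. \<forall>h. u b c Y X (hact C h f) = hact D h (u b c Y X f)) \<and>
     (\<forall>a b c. \<forall>X\<in>Obj C. \<forall>Y\<in>Obj C. \<forall>Z\<in>Obj C. \<forall>f\<in>Hom C Y Z. \<forall>g\<in>Hom C X Y.
        u a c Z X (Cmp C f g) = Cmp D (u a b Z Y f) (u b c Y X g))"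

text \<open>An entry stores only the codomain of its morphism. The domain is the object of the
  cyclic successor \<open>j\<close>, whose label is therefore the second argument of
  \<open>u\<close>.\<close>

definition twist_list ::
  "(bool \<Rightarrow> 'o \<Rightarrow> 'p) \<Rightarrow> (bool \<Rightarrow> bool \<Rightarrow> 'o \<Rightarrow> 'o \<Rightarrow> 'f \<Rightarrow> 'g) \<Rightarrow> (nat \<Rightarrow> bool) \<Rightarrow> nat \<Rightarrow>
   ('o \<times> 'f) list \<Rightarrow> ('p \<times> 'g) list" where
  "twist_list p u a n ps = map (\<lambda>i. let j = if i = n then 0 else i + 1 in
     (p (a i) (fst (ps ! i)), u (a i) (a j) (fst (ps ! i)) (fst (ps ! j)) (snd (ps ! i)))) [0..<n + 1]"

definition twist ::
  "(bool \<Rightarrow> 'o \<Rightarrow> 'p) \<Rightarrow> (bool \<Rightarrow> bool \<Rightarrow> 'o \<Rightarrow> 'o \<Rightarrow> 'f \<Rightarrow> 'g) \<Rightarrow> (nat \<Rightarrow> bool) \<Rightarrow> nat \<Rightarrow>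
   ('o, 'f, 'm) simple \<Rightarrow> ('p, 'g, 'm) simple" where
  "twist p u a n s = (twist_list p u a n (fst s), snd s)"

lemma length_twist_list [simp]: "length (twist_list p u a n ps) = n + 1"
  by (simp add: twist_list_def)

lemma nth_twist_list:
  "i \<le> n \<Longrightarrow> twist_list p u a n ps ! i =
     (p (a i) (fst (ps ! i)), u (a i) (a (if i = n then 0 else i + 1)) (fst (ps ! i))
        (fst (ps ! (if i = n then 0 else i + 1))) (snd (ps ! i)))"
  by (simp add: twist_list_def Let_def del: upt_Suc)

lemma twist_list_cong: "(\<And>i. i \<le> n \<Longrightarrow> a i = b i) \<Longrightarrow> twist_list p u a n ps = twist_list p u b n ps"
  by (simp add: twist_list_def Let_def cong: map_cong)

lemma rotate_labels_eq: "i \<le> n \<Longrightarrow> rotate_labels n a i = a (if i = 0 then n else i - 1)"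
  using mod_add_self2 [of "i - 1" "n + 1"] by (cases i) (simp_all add: rotate_labels_def)

section \<open>Twisting free chains\<close>

context
  fixes A :: "('k::comm_ring_1, 'l::ring_1, 'r::ring_1, 'h::ring_1) hopf_algebroid"
    and C :: "('k, 'h, 'o, 'f::ab_group_add) hcat"
    and D :: "('k, 'h, 'p, 'g::ab_group_add) hcat"
    and M :: "('k, 'l, 'r, 'h, 'm::ab_group_add) mod_comod"
    and p u
  assumes C: "H_category A C" and D: "H_category A D" and U: "twisted_functor C D p u"
begin

lemmas twisted_functor_Obj = U [unfolded twisted_functor_def, THEN conjunct1, rule_format]
lemmas twisted_functor_Hom =
  U [unfolded twisted_functor_def, THEN conjunct2, THEN conjunct1, rule_format]
lemmas twisted_functor_add =
  U [unfolded twisted_functor_def, THEN conjunct2, THEN conjunct2, THEN conjunct1, rule_format]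
lemmas twisted_functor_hact =
  U [unfolded twisted_functor_def, THEN conjunct2, THEN conjunct2, THEN conjunct2, THEN conjunct1,
     rule_format]
lemmas twisted_functor_Cmp =
  U [unfolded twisted_functor_def, THEN conjunct2, THEN conjunct2, THEN conjunct2, THEN conjunct2,
     rule_format]

lemma twist_simples:
  assumes s: "(ps, m) \<in> simples C n"
  shows "(twist_list p u a n ps, m') \<in> simples D n"
  unfolding simples_iff
proof (intro conjI allI impI)
  fix i assume i: "i \<le> n"
  note D = simplesD [OF s]
  show "fst (twist_list p u a n ps ! i) \<in> Obj D"
    using D(2) [OF i] i by (simp add: nth_twist_list twisted_functor_Obj)
  show "snd (twist_list p u a n ps ! i) \<in> Hom D (fst (twist_list p u a n ps ! ((i + 1) mod (n + 1))))
      (fst (twist_list p u a n ps ! i))"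
    unfolding Suc_mod_Suc [OF i]
    using D(2) [OF i] D(3) [OF i] D(4) [OF i] i
    by (auto simp: nth_twist_list intro!: twisted_functor_Hom)
qed simp

lemma twist_act_list:
  assumes s: "(ps, m) \<in> simples C n" and hs: "length hs = n + 2"
  shows "twist_list p u a n (act_list C hs ps)
    = act_list D hs (twist_list p u a n ps)"
proof (rule nth_equalityI)
  show "length (twist_list p u a n (act_list C hs ps))
      = length (act_list D hs (twist_list p u a n ps))"
    using length_act_list [OF hs length_twist_list] by simp
  fix i assume "i < length (twist_list p u a n (act_list C hs ps))"
  then have i: "i \<le> n" by simp
  note D = simplesD [OF s]
  have j: "(if i = n then 0 else i + 1) \<le> n" using i by simp
  show "twist_list p u a n (act_list C hs ps) ! i
      = act_list D hs (twist_list p u a n ps) ! i"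
    unfolding nth_act_list [OF hs length_twist_list i] nth_twist_list [OF i]
      nth_act_list [OF hs D(1) i] nth_act_list [OF hs D(1) j]
    using twisted_functor_hact [OF D(4) D(2) D(3), OF i i i] by simp
qed

lemma twist_rotated_list:
  assumes s: "(ps, m) \<in> simples C n"
  shows "twist_list p u (rotate_labels n a) n ((fst (ps ! n), hact C h (snd (ps ! n))) # butlast ps)
    = (fst (twist_list p u a n ps ! n), hact D h (snd (twist_list p u a n ps ! n)))
        # butlast (twist_list p u a n ps)" (is "?L = ?R")
proof (rule nth_equalityI)
  fix i assume "i < length ?L"
  then have i: "i \<le> n" by simp
  note D = simplesD [OF s]
  show "?L ! i = ?R ! i"
  proof (cases "i = 0")
    case True
    have "snd (ps ! n) \<in> Hom C (fst (ps ! 0)) (fst (ps ! n))" "fst (ps ! 0) \<in> Obj C" "fst (ps ! n) \<in> Obj C"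
      using D(3) [of n] D(2) [of 0] D(2) [of n] by simp_all
    then show ?thesis
      using True twisted_functor_hact [of "fst (ps ! 0)" "fst (ps ! n)" "snd (ps ! n)"]
      by (cases "n = 0") (auto simp: nth_twist_list rotate_labels_eq nth_Cons' nth_butlast D(1))
  next
    case False
    then show ?thesis
      using i by (auto simp: nth_twist_list rotate_labels_eq nth_Cons' nth_butlast D(1))
  qed
qed simp

text \<open>Functoriality of \<open>u\<close> leaves the label of the middle object free. The choice
  \<open>a (i + 1)\<close>, the label of the object that the face deletes, matches the two twisted
  factors.\<close>

lemma twist_contracted_list:
  assumes s: "(ps, m) \<in> simples C n" and i: "i < n"
  shows "twist_list p u (delete_label n i a) (n - 1)
      (take i ps @ (fst (ps ! i), Cmp C (snd (ps ! i)) (snd (ps ! (i + 1)))) # drop (i + 2) ps)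
    = take i (twist_list p u a n ps) @ (fst (twist_list p u a n ps ! i),
        Cmp D (snd (twist_list p u a n ps ! i)) (snd (twist_list p u a n ps ! (i + 1))))
        # drop (i + 2) (twist_list p u a n ps)" (is "?L = ?R")
proof (rule nth_equalityI)
  show "length ?L = length ?R" using i by simp
  fix k assume "k < length ?L"
  then have k: "k < n" "k \<le> n - 1" using i by simp_all
  note D = simplesD [OF s]
  have j: "(if k = n - 1 then 0 else k + 1) < n" using k by (cases "k = n - 1") auto
  note nth = nth_contracted_list [OF length_twist_list i k(1)] nth_twist_list [OF k(2)]
    nth_contracted_list [OF D(1) i k(1)] nth_contracted_list [OF D(1) i j]
  show "?L ! k = ?R ! k"
  proof (cases "k = i")
    case True
    let ?X = "fst (ps ! (if i + 1 = n then 0 else i + 2))"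
    have "fst (ps ! i) \<in> Obj C" "fst (ps ! (i + 1)) \<in> Obj C" "?X \<in> Obj C"
      "snd (ps ! i) \<in> Hom C (fst (ps ! (i + 1))) (fst (ps ! i))"
      "snd (ps ! (i + 1)) \<in> Hom C ?X (fst (ps ! (i + 1)))"
      using D(2) [of i] D(2) [of "i + 1"] D(3) [of i] D(3) [of "i + 1"] D(4) [of "i + 1"] i
      by (simp_all split: if_splits)
    note comp = twisted_functor_Cmp [OF this(3,2,1,4,5)]
    show ?thesis
      unfolding nth
      using True i comp [of "a i" "a (if i + 1 = n then 0 else i + 2)" "a (i + 1)"]
      by (cases "i = 0") (auto simp: nth_twist_list delete_label_def)
  next
    case False
    then show ?thesis
      unfolding nth using i k by (auto simp: nth_twist_list delete_label_def)
  qed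
qed

lemma frag_extend_twist_act:
  assumes "s \<in> simples C n"
  shows "frag_extend (\<lambda>s. frag_of (twist p u a n s)) (T_act A C M n h s) = T_act A D M n h (twist p u a n s)"
proof -
  obtain ps m where ps: "s = (ps, m)" by fastforce
  have s: "(ps, m) \<in> simples C n" using assms ps by simp
  show ?thesis
    unfolding ps T_act_def twist_def case_prod_conv frag_extend_frag_extend fst_conv snd_conv
  proof (rule frag_extend_eq)
    fix hs assume "hs \<in> Poly_Mapping.keys (iterated_DeltaL A (n + 1) (inv_into UNIV (antipode A) h))"
    then have "length hs = n + 2" using length_iterated_DeltaL by fastforce
    then show "frag_extend (\<lambda>s. frag_of (twist_list p u a n (fst s), snd s))
        (frag_of (act_list C hs ps, actM M (hs ! (n + 1)) m))
      = frag_of (act_list D hs (twist_list p u a n ps), actM M (hs ! (n + 1)) m)"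
      using twist_act_list [OF s] by simp
  qed
qed

lemma frag_extend_twist_cyc:
  assumes "s \<in> simples C n"
  shows "frag_extend (\<lambda>s. frag_of (twist p u (rotate_labels n a) n s)) (T_cyc C M n s) = T_cyc D M n (twist p u a n s)"
proof -
  obtain ps m where ps: "s = (ps, m)" by fastforce
  have s: "(ps, m) \<in> simples C n" using assms ps by simp
  show ?thesis
    unfolding ps T_cyc_def twist_def case_prod_conv frag_extend_frag_extend fst_conv snd_conv
    using twist_rotated_list [OF s] by (intro frag_extend_eq) (auto simp: case_prod_beta)
qed

lemma frag_extend_twist_face_less:
  assumes "s \<in> simples C n" and i: "i < n"
  shows "frag_extend (\<lambda>s. frag_of (twist p u (delete_label n i a) (n - 1) s)) (T_face C M n i s)
    = T_face D M n i (twist p u a n s)"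
proof -
  obtain ps m where ps: "s = (ps, m)" by fastforce
  have s: "(ps, m) \<in> simples C n" using assms ps by simp
  show ?thesis
    using i twist_contracted_list [OF s i] unfolding ps T_face_def twist_def by simp
qed

text \<open>For \<open>i = n\<close> the relation \<open>d_n = d_0 tau\<close> has a counterpart for
  labels: deletion at \<open>n\<close> is rotation followed by deletion at \<open>0\<close>. So the
  last face follows from tau and the contraction at \<open>0\<close>.\<close>

lemma frag_extend_twist_face:
  assumes s: "s \<in> simples C n" and n: "1 \<le> n" and i: "i \<le> n"
  shows "frag_extend (\<lambda>s. frag_of (twist p u (delete_label n i a) (n - 1) s)) (T_face C M n i s)
    = T_face D M n i (twist p u a n s)"
proof (cases "i < n")
  case True
  then show ?thesis using frag_extend_twist_face_less [OF s] by blast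
next
  case False
  then have i: "i = n" using i by simp
  have len: "length (fst s) = n + 1" using s by (auto simp: simples_def)
  have eq: "twist p u (delete_label n n a) (n - 1) = twist p u (delete_label n 0 (rotate_labels n a)) (n - 1)"
    unfolding twist_def fun_eq_iff
    using n by (intro allI prod_eqI) (auto simp: delete_label_def rotate_labels_eq intro!: twist_list_cong)
  have "frag_extend (\<lambda>s. frag_of (twist p u (delete_label n i a) (n - 1) s)) (T_face C M n i s)
    = frag_extend (\<lambda>t. frag_extend (\<lambda>s. frag_of (twist p u (delete_label n 0 (rotate_labels n a)) (n - 1) s)) (T_face C M n 0 t))
        (T_cyc C M n s)"
    using n len T_face_last [of n s C M] unfolding i eq by (auto simp: frag_extend_frag_extend)
  also have "\<dots> = frag_extend (\<lambda>t. T_face D M n 0 (twist p u (rotate_labels n a) n t)) (T_cyc C M n s)"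
    using n keys_T_cyc [OF C s] by (intro frag_extend_eq frag_extend_twist_face_less) auto
  also have "\<dots> = frag_extend (T_face D M n 0) (T_cyc D M n (twist p u a n s))"
    unfolding frag_extend_twist_cyc [OF s, symmetric] frag_extend_frag_extend by simp
  also have "\<dots> = T_face D M n i (twist p u a n s)"
    using n T_face_last [of n "twist p u a n s" D M] i length_twist_list [of p u a n "fst s"]
    by (simp add: twist_def)
  finally show ?thesis .
qed

lemma twisted_map_free:
  "twisted_map (free_data A C M) (free_data A D M) (\<lambda>a n. frag_extend (\<lambda>s. frag_of (twist p u a n s)))"
  unfolding twisted_map_def right_module_map_def
proof (intro conjI allI impI ballI)
  show "frag_extend (\<lambda>s. frag_of (twist p u a n s)) = frag_extend (\<lambda>s. frag_of (twist p u b n s))"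
    if "\<forall>i\<le>n. a i = b i" for a b n
    using that twist_list_cong [of n a b p u] by (simp add: twist_def)
  show "frag_extend (\<lambda>s. frag_of (twist p u a n s))
      \<in> hom (grp (free_data A C M) n) (grp (free_data A D M) n)" for a n
    unfolding free_data_def
    by (auto intro!: frag_extend_hom simp: twist_def twist_simples)
  fix a n x assume "x \<in> carrier (grp (free_data A C M) n)"
  then have x: "Poly_Mapping.keys x \<subseteq> simples C n" by (simp add: free_data_def)
  show "frag_extend (\<lambda>s. frag_of (twist p u a n s)) (ract (free_data A C M) n x h)
      = ract (free_data A D M) n (frag_extend (\<lambda>s. frag_of (twist p u a n s)) x) h" for h
    unfolding free_data_def using x
    by (auto simp: frag_extend_frag_extend intro!: frag_extend_eq frag_extend_twist_act)
  show "frag_extend (\<lambda>s. frag_of (twist p u (rotate_labels n a) n s)) (cyc (free_data A C M) n x)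
      = cyc (free_data A D M) n (frag_extend (\<lambda>s. frag_of (twist p u a n s)) x)"
    unfolding free_data_def using x
    by (auto simp: frag_extend_frag_extend intro!: frag_extend_eq frag_extend_twist_cyc)
  show "frag_extend (\<lambda>s. frag_of (twist p u (delete_label n i a) (n - 1) s)) (face (free_data A C M) n i x)
      = face (free_data A D M) n i (frag_extend (\<lambda>s. frag_of (twist p u a n s)) x)"
    if "1 \<le> n \<and> i \<le> n" for i
    unfolding free_data_def using x that
    by (auto simp: frag_extend_frag_extend intro!: frag_extend_eq frag_extend_twist_face [simplified])
qed

end

section \<open>Iterated coproducts\<close>

lemma frag_extend_fun_diff: "frag_extend (\<lambda>x. f x - g x) w = frag_extend f w - frag_extend g w"
  using subset_UNIV by (induction w rule: frag_induction) (auto simp: frag_extend_diff)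

lemma frag_extend_in_group_closure:
  assumes "\<And>x. x \<in> Poly_Mapping.keys w \<Longrightarrow> f x \<in> group_closure R"
  shows "frag_extend f w \<in> group_closure R"
proof -
  have "w = w \<Longrightarrow> frag_extend f w \<in> group_closure R"
    using subset_refl [of "Poly_Mapping.keys w"]
  proof (induction w rule: frag_induction)
    case (one x)
    then show ?case using assms by simp
  qed (auto simp: frag_extend_diff intro: group_closure.diff)
  then show ?thesis by simp
qed

lemma group_closure_trans:
  "x - y \<in> group_closure R \<Longrightarrow> y - z \<in> group_closure R \<Longrightarrow> x - z \<in> group_closure R"
  using group_closure_add [of "x - y" R "y - z"] by simp

lemma group_closure_sym: "x - y \<in> group_closure R \<Longrightarrow> y - x \<in> group_closure R"
  using group_closure_minus_iff [of "x - y" R] by simp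

definition HLH_gen :: "('k, 'l, 'r, 'h::ring_1) hopf_algebroid \<Rightarrow> ('h \<times> 'h \<Rightarrow>\<^sub>0 int) set" where
  "HLH_gen A =
     {frag_of (a + a', b) - frag_of (a, b) - frag_of (a', b) | a a' b. True} \<union>
     {frag_of (a, b + b') - frag_of (a, b) - frag_of (a, b') | a b b'. True} \<union>
     {frag_of (tL A s * a, b) - frag_of (a, sL A s * b) | a s b. True}"

lemma HLH_rel_closure: "HLH_rel A = group_closure (HLH_gen A)"
  by (simp add: HLH_rel_def tensor_rel_def ractL_def lactL_def HLH_gen_def)

lemma HLH_rel_gens:
  "frag_of (a + a', b) - frag_of (a, b) - frag_of (a', b) \<in> HLH_rel A"
  "frag_of (a, b + b') - frag_of (a, b) - frag_of (a, b') \<in> HLH_rel A"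
  "frag_of (tL A s * a, b) - frag_of (a, sL A s * b) \<in> HLH_rel A"
  unfolding HLH_rel_closure HLH_gen_def by (rule group_closure.base, blast)+

lemma frag_extend_HLH_rel:
  assumes "x \<in> HLH_rel A"
    and "\<And>a a' b. f (a + a', b) - f (a, b) - f (a', b) \<in> group_closure R"
    and "\<And>a b b'. f (a, b + b') - f (a, b) - f (a, b') \<in> group_closure R"
    and "\<And>a s b. f (tL A s * a, b) - f (a, sL A s * b) \<in> group_closure R"
  shows "frag_extend f x \<in> group_closure R"
  using assms(1) unfolding HLH_rel_closure
  by (rule frag_extend_group_closure)
     (use assms(2-4) in \<open>auto simp: HLH_gen_def frag_extend_diff\<close>)

text \<open>The relations of the \<open>(n + 1)\<close>-fold tensor power of \<open>H\<close> over
  \<open>L\<close>, for the bimodule structure by left multiplication with \<open>sL\<close> and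
  \<open>tL\<close>.\<close>

definition list_gen :: "('k, 'l, 'r, 'h::ring_1) hopf_algebroid \<Rightarrow> nat \<Rightarrow> ('h list \<Rightarrow>\<^sub>0 int) set" where
  "list_gen A n =
     {frag_of (hs[i := a + b]) - frag_of (hs[i := a]) - frag_of (hs[i := b]) | hs i a b.
        length hs = n + 1 \<and> i \<le> n} \<union>
     {frag_of (hs[i := tL A l * hs ! i]) - frag_of (hs[i + 1 := sL A l * hs ! (i + 1)]) | hs i l.
        length hs = n + 1 \<and> i < n}"

lemma list_rel_add: "length hs = n + 1 \<Longrightarrow> i \<le> n \<Longrightarrow>
    frag_of (hs[i := a + b]) - frag_of (hs[i := a]) - frag_of (hs[i := b]) \<in> group_closure (list_gen A n)"
  and list_rel_balanced: "length hs = n + 1 \<Longrightarrow> i < n \<Longrightarrow>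
    frag_of (hs[i := tL A l * hs ! i]) - frag_of (hs[i + 1 := sL A l * hs ! (i + 1)])
      \<in> group_closure (list_gen A n)"
  unfolding list_gen_def by (rule group_closure.base, blast)+

definition cons_frag :: "'h \<Rightarrow> ('h list \<Rightarrow>\<^sub>0 int) \<Rightarrow> ('h list \<Rightarrow>\<^sub>0 int)" where
  "cons_frag a = frag_extend (\<lambda>hs. frag_of (a # hs))"

definition lmult :: "nat \<Rightarrow> 'h::times \<Rightarrow> ('h list \<Rightarrow>\<^sub>0 int) \<Rightarrow> ('h list \<Rightarrow>\<^sub>0 int)" where
  "lmult i x = frag_extend (\<lambda>hs. frag_of (hs[i := x * hs ! i]))"

definition rmult :: "nat \<Rightarrow> 'h::times \<Rightarrow> ('h list \<Rightarrow>\<^sub>0 int) \<Rightarrow> ('h list \<Rightarrow>\<^sub>0 int)" where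
  "rmult i x = frag_extend (\<lambda>hs. frag_of (hs[i := hs ! i * x]))"

text \<open>This is the identity tensored with the \<open>n\<close>-th iterated coproduct, on an
  arbitrary representative. Separating it from \<open>DeltaL\<close> lets an identity in the twofold
  tensor product be pushed into longer ones.\<close>

definition DeltaL_step ::
  "('k, 'l, 'r, 'h) hopf_algebroid \<Rightarrow> nat \<Rightarrow> ('h \<times> 'h \<Rightarrow>\<^sub>0 int) \<Rightarrow> ('h list \<Rightarrow>\<^sub>0 int)" where
  "DeltaL_step A n = frag_extend (\<lambda>(a, b). cons_frag a (iterated_DeltaL A n b))"

lemma iterated_DeltaL_Suc: "iterated_DeltaL A (Suc n) h = DeltaL_step A n (DeltaL A h)"
  by (simp add: DeltaL_step_def cons_frag_def)

lemma cons_frag_list_rel: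
  assumes "w \<in> group_closure (list_gen A n)"
  shows "cons_frag a w \<in> group_closure (list_gen A (n + 1))"
  unfolding cons_frag_def using assms
proof (rule frag_extend_group_closure)
  fix r assume "r \<in> list_gen A n"
  then consider hs i b c where "r = frag_of (hs[i := b + c]) - frag_of (hs[i := b]) - frag_of (hs[i := c])"
      "length hs = n + 1" "i \<le> n"
    | hs i l where "r = frag_of (hs[i := tL A l * hs ! i]) - frag_of (hs[i + 1 := sL A l * hs ! (i + 1)])"
      "length hs = n + 1" "i < n"
    unfolding list_gen_def by blast
  then show "frag_extend (\<lambda>hs. frag_of (a # hs)) r \<in> group_closure (list_gen A (n + 1))"
  proof cases
    case 1
    then show ?thesis using list_rel_add [of "a # hs" "n + 1" "i + 1" b c A] by (simp add: frag_extend_diff)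
  next
    case 2
    then show ?thesis using list_rel_balanced [of "a # hs" "n + 1" "i + 1" A l] by (simp add: frag_extend_diff)
  qed
qed

lemma cons_frag_diff: "cons_frag a (x - y) = cons_frag a x - cons_frag a y"
  by (simp add: cons_frag_def frag_extend_diff)

lemma cons_frag_add_rel:
  assumes "\<And>hs. hs \<in> Poly_Mapping.keys w \<Longrightarrow> length hs = n + 1"
  shows "cons_frag (a + a') w - cons_frag a w - cons_frag a' w \<in> group_closure (list_gen A (n + 1))"
proof -
  have "frag_extend (\<lambda>hs. frag_of ((a + a') # hs) - frag_of (a # hs) - frag_of (a' # hs)) w
      \<in> group_closure (list_gen A (n + 1))"
  proof (rule frag_extend_in_group_closure)
    fix hs assume "hs \<in> Poly_Mapping.keys w"
    then show "frag_of ((a + a') # hs) - frag_of (a # hs) - frag_of (a' # hs) \<in> group_closure (list_gen A (n + 1))"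
      using list_rel_add [of "a # hs" "n + 1" 0 a a' A] assms by simp
  qed
  then show ?thesis by (simp add: cons_frag_def frag_extend_fun_diff)
qed

lemma cons_frag_balanced_rel:
  assumes "\<And>hs. hs \<in> Poly_Mapping.keys w \<Longrightarrow> length hs = n + 1"
  shows "cons_frag (tL A l * a) w - cons_frag a (lmult 0 (sL A l) w) \<in> group_closure (list_gen A (n + 1))"
proof -
  have "frag_extend (\<lambda>hs. frag_of ((tL A l * a) # hs) - frag_of (a # hs[0 := sL A l * hs ! 0])) w
      \<in> group_closure (list_gen A (n + 1))"
  proof (rule frag_extend_in_group_closure)
    fix hs assume "hs \<in> Poly_Mapping.keys w"
    then show "frag_of ((tL A l * a) # hs) - frag_of (a # hs[0 := sL A l * hs ! 0])
        \<in> group_closure (list_gen A (n + 1))"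
      using list_rel_balanced [of "a # hs" "n + 1" 0 A l] assms by simp
  qed
  then show ?thesis by (simp add: cons_frag_def lmult_def frag_extend_fun_diff frag_extend_frag_extend)
qed

lemma DeltaL_step_lmult:
  "DeltaL_step A n (frag_map2 (\<lambda>a. x * a) id w) = lmult 0 x (DeltaL_step A n w)"
  unfolding DeltaL_step_def lmult_def frag_map2_def cons_frag_def frag_extend_frag_extend
  by (rule frag_extend_eq) (auto simp: frag_extend_frag_extend split: prod.splits)

lemma DeltaL_step_rmult_0:
  "DeltaL_step A n (frag_map2 (\<lambda>a. a * x) id w) = rmult 0 x (DeltaL_step A n w)"
  unfolding DeltaL_step_def rmult_def frag_map2_def cons_frag_def frag_extend_frag_extend
  by (rule frag_extend_eq) (auto simp: frag_extend_frag_extend split: prod.splits)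

lemma rmult_Suc_DeltaL_step:
  "rmult (Suc i) x (DeltaL_step A n w)
    = frag_extend (\<lambda>(a, b). cons_frag a (rmult i x (iterated_DeltaL A n b))) w"
  unfolding DeltaL_step_def rmult_def cons_frag_def frag_extend_frag_extend
  by (rule frag_extend_eq) (auto simp: frag_extend_frag_extend split: prod.splits)

section \<open>The Takeuchi condition for iterated coproducts\<close>

context
  fixes A :: "('k::comm_ring_1, 'l::ring_1, 'r::ring_1, 'h::ring_1) hopf_algebroid"
  assumes B: "left_bialgebroid A"
begin

lemma tL_one: "tL A 1 = 1"
  using B unfolding left_bialgebroid_def anti_algebra_map_def by blast

lemma sL_tL_commute: "sL A l * tL A l' = tL A l' * sL A l"
  using B unfolding left_bialgebroid_def by metis

lemma DeltaL_add: "DeltaL A (g + h) - (DeltaL A g + DeltaL A h) \<in> HLH_rel A"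
  and DeltaL_act: "DeltaL A (sL A l * tL A l' * h)
    - frag_map2 (lactL A l) (\<lambda>g. ractL A g l') (DeltaL A h) \<in> HLH_rel A"
  and DeltaL_Takeuchi: "frag_map2 (\<lambda>a. a * tL A l) id (DeltaL A h)
    - frag_map2 id (\<lambda>b. b * sL A l) (DeltaL A h) \<in> HLH_rel A"
  and DeltaL_one: "DeltaL A 1 - frag_of (1, 1) \<in> HLH_rel A"
  and DeltaL_mult: "DeltaL A (h * g) - frag_mult (DeltaL A h) (DeltaL A g) \<in> HLH_rel A"
  and epsL_DeltaL_left: "frag_eval (\<lambda>(a, b). lactL A (epsL A a) b) (DeltaL A h) = h"
  and epsL_DeltaL_right: "frag_eval (\<lambda>(a, b). ractL A a (epsL A b)) (DeltaL A h) = h"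
  using B unfolding left_bialgebroid_def by blast+

lemma DeltaL_lmult: "DeltaL A (sL A l * h) - frag_map2 (\<lambda>a. sL A l * a) id (DeltaL A h) \<in> HLH_rel A"
  using DeltaL_act [of l 1 h] by (simp add: tL_one lactL_def [abs_def] ractL_def id_def)

lemma frag_map2_rmult_HLH_rel:
  assumes "w \<in> HLH_rel A"
  shows "frag_map2 (\<lambda>a. a * c) (\<lambda>b. b * d) w \<in> HLH_rel A"
  using assms unfolding frag_map2_def HLH_rel_closure
  by (rule frag_extend_HLH_rel [unfolded HLH_rel_closure])
     (simp_all add: distrib_right mult.assoc HLH_rel_gens [unfolded HLH_rel_closure])

text \<open>Left multiplication by an arbitrary element need not respect the balancing by
  \<open>tL\<close>; multiplication by \<open>sL A l\<close> does because the images of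
  \<open>sL\<close> and \<open>tL\<close> commute.\<close>

lemma frag_map2_lmult_HLH_rel:
  assumes "w \<in> HLH_rel A"
  shows "frag_map2 (\<lambda>a. sL A l * a) id w \<in> HLH_rel A"
  using assms unfolding frag_map2_def HLH_rel_closure
proof (rule frag_extend_HLH_rel [unfolded HLH_rel_closure])
  fix a s b
  have "sL A l * (tL A s * a) = tL A s * (sL A l * a)"
    by (simp add: sL_tL_commute flip: mult.assoc)
  then show "(case (tL A s * a, b) of (a, b) \<Rightarrow> frag_of (sL A l * a, id b))
      - (case (a, sL A s * b) of (a, b) \<Rightarrow> frag_of (sL A l * a, id b)) \<in> group_closure (HLH_gen A)"
    using HLH_rel_gens(3) [of A s "sL A l * a" b] by (simp add: HLH_rel_closure)
qed (simp_all add: distrib_left HLH_rel_gens [unfolded HLH_rel_closure])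

text \<open>Factorwise multiplication need not be well defined on the tensor product over
  \<open>L\<close>. It respects relations in its second argument when the first is a coproduct,
  since coproducts lie in the Takeuchi product.\<close>

lemma frag_mult_DeltaL_HLH_rel:
  assumes "y \<in> HLH_rel A"
  shows "frag_mult (DeltaL A h) y \<in> HLH_rel A"
proof -
  let ?x = "DeltaL A h"
  \<comment> \<open>The two sums are exchanged, so that \<open>y\<close> is outermost and its
    generating relations can be checked one by one.\<close>
  have "frag_mult ?x y = frag_extend (\<lambda>(c, d). frag_map2 (\<lambda>a. a * c) (\<lambda>b. b * d) ?x) y"
    unfolding frag_mult_def frag_map2_def using subset_UNIV
  proof (induction y rule: frag_induction)
    case (one z)
    then show ?case by (cases z) (auto simp: case_prod_beta)
  next
    case (diff a b)
    have "frag_extend (\<lambda>(a', b'). frag_extend (\<lambda>(c, d). frag_of (a' * c, b' * d)) (a - b)) ?x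
      = frag_extend (\<lambda>(a', b'). frag_extend (\<lambda>(c, d). frag_of (a' * c, b' * d)) a) ?x
      - frag_extend (\<lambda>(a', b'). frag_extend (\<lambda>(c, d). frag_of (a' * c, b' * d)) b) ?x"
      unfolding frag_extend_fun_diff [symmetric]
      by (rule arg_cong2 [where f = frag_extend]) (auto simp: frag_extend_diff)
    then show ?case using diff by (simp add: frag_extend_diff)
  qed (auto simp: case_prod_beta frag_extend_eq_0)
  moreover have "frag_extend (\<lambda>(c, d). frag_map2 (\<lambda>a. a * c) (\<lambda>b. b * d) ?x) y \<in> HLH_rel A"
    unfolding HLH_rel_closure
  proof (rule frag_extend_HLH_rel [OF assms]; unfold case_prod_conv)
    fix c c' d :: 'h and l
    have "frag_extend (\<lambda>(a, b). frag_of (a * (c + c'), b * d) - frag_of (a * c, b * d) - frag_of (a * c', b * d)) ?x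
        \<in> group_closure (HLH_gen A)"
      by (rule frag_extend_in_group_closure)
         (auto simp: distrib_left HLH_rel_gens [unfolded HLH_rel_closure])
    then show "frag_map2 (\<lambda>a. a * (c + c')) (\<lambda>b. b * d) ?x - frag_map2 (\<lambda>a. a * c) (\<lambda>b. b * d) ?x
        - frag_map2 (\<lambda>a. a * c') (\<lambda>b. b * d) ?x \<in> group_closure (HLH_gen A)"
      unfolding frag_map2_def case_prod_beta by (simp add: frag_extend_fun_diff)
    have "frag_extend (\<lambda>(a, b). frag_of (a * d, b * (c + c')) - frag_of (a * d, b * c) - frag_of (a * d, b * c')) ?x
        \<in> group_closure (HLH_gen A)"
      by (rule frag_extend_in_group_closure)
         (auto simp: distrib_left HLH_rel_gens [unfolded HLH_rel_closure])
    then show "frag_map2 (\<lambda>a. a * d) (\<lambda>b. b * (c + c')) ?x - frag_map2 (\<lambda>a. a * d) (\<lambda>b. b * c) ?x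
        - frag_map2 (\<lambda>a. a * d) (\<lambda>b. b * c') ?x \<in> group_closure (HLH_gen A)"
      unfolding frag_map2_def case_prod_beta by (simp add: frag_extend_fun_diff)
    \<comment> \<open>The Takeuchi condition moves \<open>tL A l\<close> across the tensor sign as
      \<open>sL A l\<close>; only then are \<open>c\<close> and \<open>d\<close> multiplied on from
      the right.\<close>
    have "frag_map2 (\<lambda>a. a * c) (\<lambda>b. b * d) (frag_map2 (\<lambda>a. a * tL A l) id ?x
        - frag_map2 id (\<lambda>b. b * sL A l) ?x) \<in> group_closure (HLH_gen A)"
      using frag_map2_rmult_HLH_rel [OF DeltaL_Takeuchi] unfolding HLH_rel_closure .
    then show "frag_map2 (\<lambda>a. a * (tL A l * c)) (\<lambda>b. b * d) ?x
        - frag_map2 (\<lambda>a. a * c) (\<lambda>b. b * (sL A l * d)) ?x \<in> group_closure (HLH_gen A)"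
      unfolding frag_map2_def case_prod_beta
      by (simp add: frag_extend_diff frag_extend_frag_extend mult.assoc)
  qed
  ultimately show ?thesis by simp
qed

lemma DeltaL_sL: "DeltaL A (sL A l) - frag_of (sL A l, 1) \<in> HLH_rel A"
proof -
  have "DeltaL A (sL A l) - frag_map2 (\<lambda>a. sL A l * a) id (DeltaL A 1) \<in> HLH_rel A"
    using DeltaL_lmult [of l 1] by simp
  moreover have "frag_map2 (\<lambda>a. sL A l * a) id (DeltaL A 1) - frag_of (sL A l, 1) \<in> HLH_rel A"
    using frag_map2_lmult_HLH_rel [OF DeltaL_one, of l] by (simp add: frag_map2_def frag_extend_diff)
  ultimately show ?thesis
    unfolding HLH_rel_closure by (rule group_closure_trans)
qed

text \<open>The coring axioms give linearity for left multiplication. For right multiplication the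
  source is multiplicativity together with the fact that the coproduct of \<open>sL A l\<close> is
  \<open>sL A l\<close> tensored with \<open>1\<close>.\<close>

lemma DeltaL_rmult: "DeltaL A (h * sL A l) - frag_map2 (\<lambda>a. a * sL A l) id (DeltaL A h) \<in> HLH_rel A"
proof -
  have "frag_mult (DeltaL A h) (DeltaL A (sL A l) - frag_of (sL A l, 1)) \<in> HLH_rel A"
    by (rule frag_mult_DeltaL_HLH_rel [OF DeltaL_sL])
  moreover have "frag_mult (DeltaL A h) (DeltaL A (sL A l) - frag_of (sL A l, 1))
      = frag_mult (DeltaL A h) (DeltaL A (sL A l)) - frag_map2 (\<lambda>a. a * sL A l) id (DeltaL A h)"
    unfolding frag_mult_def frag_map2_def case_prod_beta
    by (simp add: frag_extend_diff frag_extend_fun_diff)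
  ultimately show ?thesis
    using DeltaL_mult [of h "sL A l"] unfolding HLH_rel_closure by (auto intro: group_closure_trans)
qed

text \<open>Additivity and linearity of \<open>iterated_DeltaL A n\<close> are hypotheses because
  this is the induction step by which they are proved one level up.\<close>

lemma DeltaL_step_HLH_rel:
  assumes add: "\<And>g h. iterated_DeltaL A n (g + h) - (iterated_DeltaL A n g + iterated_DeltaL A n h)
      \<in> group_closure (list_gen A n)"
    and lmult: "\<And>l h. iterated_DeltaL A n (sL A l * h) - lmult 0 (sL A l) (iterated_DeltaL A n h)
      \<in> group_closure (list_gen A n)"
    and w: "w \<in> HLH_rel A"
  shows "DeltaL_step A n w \<in> group_closure (list_gen A (n + 1))"
  unfolding DeltaL_step_def
proof (rule frag_extend_HLH_rel [OF w]; unfold case_prod_conv)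
  fix a a' b b' :: 'h and l
  show "cons_frag (a + a') (iterated_DeltaL A n b) - cons_frag a (iterated_DeltaL A n b)
      - cons_frag a' (iterated_DeltaL A n b) \<in> group_closure (list_gen A (n + 1))"
    by (rule cons_frag_add_rel) (rule length_iterated_DeltaL)
  show "cons_frag a (iterated_DeltaL A n (b + b')) - cons_frag a (iterated_DeltaL A n b)
      - cons_frag a (iterated_DeltaL A n b') \<in> group_closure (list_gen A (n + 1))"
    using cons_frag_list_rel [OF add [of b b'], of a]
    by (simp add: cons_frag_def frag_extend_diff frag_extend_add diff_diff_eq)
  have "cons_frag (tL A l * a) (iterated_DeltaL A n b)
      - cons_frag a (lmult 0 (sL A l) (iterated_DeltaL A n b)) \<in> group_closure (list_gen A (n + 1))"
    by (rule cons_frag_balanced_rel) (rule length_iterated_DeltaL)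
  moreover have "cons_frag a (lmult 0 (sL A l) (iterated_DeltaL A n b))
      - cons_frag a (iterated_DeltaL A n (sL A l * b)) \<in> group_closure (list_gen A (n + 1))"
    using cons_frag_list_rel [OF group_closure_sym [OF lmult [of l b]], of a]
    by (simp add: cons_frag_diff)
  ultimately show "cons_frag (tL A l * a) (iterated_DeltaL A n b)
      - cons_frag a (iterated_DeltaL A n (sL A l * b)) \<in> group_closure (list_gen A (n + 1))"
    by (rule group_closure_trans)
qed

lemma DeltaL_step_diff: "DeltaL_step A n (x - y) = DeltaL_step A n x - DeltaL_step A n y"
  and DeltaL_step_add: "DeltaL_step A n (x + y) = DeltaL_step A n x + DeltaL_step A n y"
  by (simp_all add: DeltaL_step_def frag_extend_diff frag_extend_add)

lemma iterated_DeltaL_linear: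
  "iterated_DeltaL A n (g + h) - (iterated_DeltaL A n g + iterated_DeltaL A n h)
      \<in> group_closure (list_gen A n)"
  "iterated_DeltaL A n (sL A l * h) - lmult 0 (sL A l) (iterated_DeltaL A n h)
      \<in> group_closure (list_gen A n)"
proof (induction n arbitrary: g h l)
  case 0
  {
    case 1
    then show ?case using list_rel_add [of "[g]" 0 0 g h A] by (simp add: diff_diff_eq)
  next
    case 2
    then show ?case by (simp add: lmult_def)
  }
next
  case (Suc n)
  note step = DeltaL_step_HLH_rel [OF Suc.IH]
  {
    case 1
    then show ?case
      using step [OF DeltaL_add [of g h]] unfolding iterated_DeltaL_Suc
      by (simp add: DeltaL_step_diff DeltaL_step_add)
  next
    case 2
    then show ?case
      using step [OF DeltaL_lmult] unfolding iterated_DeltaL_Suc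
      by (simp add: DeltaL_step_diff DeltaL_step_lmult)
  }
qed

lemmas DeltaL_step_rel = DeltaL_step_HLH_rel [OF iterated_DeltaL_linear]

lemma iterated_DeltaL_rmult:
  "iterated_DeltaL A n (h * sL A l) - rmult 0 (sL A l) (iterated_DeltaL A n h)
     \<in> group_closure (list_gen A n)"
proof (cases n)
  case 0
  then show ?thesis by (simp add: rmult_def)
next
  case (Suc k)
  then show ?thesis
    using DeltaL_step_rel [OF DeltaL_rmult [of h l], of k] unfolding Suc iterated_DeltaL_Suc
    by (simp add: DeltaL_step_diff DeltaL_step_rmult_0)
qed

text \<open>This is what makes the diagonal action respect the tensors over \<open>L\<close>. At
  position \<open>0\<close> it comes from the condition for \<open>DeltaL\<close>, after which
  \<open>sL A l\<close> is carried through the remaining coproduct; further right it is the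
  induction hypothesis for the tail.\<close>

lemma iterated_DeltaL_Takeuchi:
  "i < n \<Longrightarrow> rmult i (tL A l) (iterated_DeltaL A n h) - rmult (i + 1) (sL A l) (iterated_DeltaL A n h)
     \<in> group_closure (list_gen A n)"
proof (induction n arbitrary: i h)
  case (Suc n)
  let ?w = "DeltaL A h"
  show ?case
  proof (cases i)
    case 0
    have "DeltaL_step A n (frag_map2 (\<lambda>a. a * tL A l) id ?w) - DeltaL_step A n (frag_map2 id (\<lambda>b. b * sL A l) ?w)
        \<in> group_closure (list_gen A (n + 1))"
      using DeltaL_step_rel [OF DeltaL_Takeuchi [of l h], of n] by (simp add: DeltaL_step_diff)
    moreover have "DeltaL_step A n (frag_map2 id (\<lambda>b. b * sL A l) ?w)
        = frag_extend (\<lambda>(a, b). cons_frag a (iterated_DeltaL A n (b * sL A l))) ?w"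
      unfolding DeltaL_step_def frag_map2_def frag_extend_frag_extend
      by (rule frag_extend_eq) auto
    moreover have "frag_extend (\<lambda>(a, b). cons_frag a (iterated_DeltaL A n (b * sL A l))) ?w
        - frag_extend (\<lambda>(a, b). cons_frag a (rmult 0 (sL A l) (iterated_DeltaL A n b))) ?w
        \<in> group_closure (list_gen A (n + 1))"
      unfolding case_prod_beta frag_extend_fun_diff [symmetric] cons_frag_diff [symmetric]
      by (intro frag_extend_in_group_closure cons_frag_list_rel iterated_DeltaL_rmult)
    ultimately show ?thesis
      unfolding 0 iterated_DeltaL_Suc DeltaL_step_rmult_0 [symmetric] One_nat_def add_0 rmult_Suc_DeltaL_step
      by (auto intro: group_closure_trans)
  next
    case (Suc j)
    have "frag_extend (\<lambda>(a, b). cons_frag a (rmult j (tL A l) (iterated_DeltaL A n b))) ?w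
        - frag_extend (\<lambda>(a, b). cons_frag a (rmult (j + 1) (sL A l) (iterated_DeltaL A n b))) ?w
        \<in> group_closure (list_gen A (n + 1))"
      unfolding case_prod_beta frag_extend_fun_diff [symmetric] cons_frag_diff [symmetric]
      using Suc.prems Suc by (intro frag_extend_in_group_closure cons_frag_list_rel Suc.IH) simp
    then show ?thesis
      unfolding Suc iterated_DeltaL_Suc add_Suc rmult_Suc_DeltaL_step by simp
  qed
qed simp

end

section \<open>The relations defining \<open>T\<close>\<close>

lemma upd_simples_iff:
  assumes "length ps = n + 1" and "i \<le> n"
  shows "(upd ps i f, m) \<in> simples C n \<longleftrightarrow>
    (\<forall>j\<le>n. fst (ps ! j) \<in> Obj C \<and> (j \<noteq> i \<longrightarrow>
       snd (ps ! j) \<in> Hom C (fst (ps ! ((j + 1) mod (n + 1)))) (fst (ps ! j)))) \<and>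
    f \<in> Hom C (fst (ps ! ((i + 1) mod (n + 1)))) (fst (ps ! i))"
  using assms by (auto simp: simples_iff snd_upd)

lemma act_list_list_update:
  assumes "length hs = n + 2" and "length ps = n + 1" and "i \<le> n"
  shows "act_list C (hs[i := a]) ps = upd (act_list C hs ps) i (hact C a (snd (ps ! i)))"
proof (rule nth_equalityI)
  fix j assume "j < length (act_list C (hs[i := a]) ps)"
  then have "j \<le> n" using assms(2) by simp
  then show "act_list C (hs[i := a]) ps ! j = upd (act_list C hs ps) i (hact C a (snd (ps ! i))) ! j"
    using nth_act_list [of "hs[i := a]" n ps j C] nth_act_list [of hs n ps j C]
      upd_nth_eq [of i "act_list C hs ps" j] assms length_act_list [OF assms(1,2), of C] by auto
qed (use assms in simp)

lemma act_list_list_update_last: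
  assumes "length hs = n + 2" and "length ps = n + 1"
  shows "act_list C (hs[n + 1 := a]) ps = act_list C hs ps"
proof (rule nth_equalityI)
  fix j assume "j < length (act_list C (hs[n + 1 := a]) ps)"
  then have "j \<le> n" using assms(2) by simp
  then show "act_list C (hs[n + 1 := a]) ps ! j = act_list C hs ps ! j"
    using nth_act_list [of "hs[n + 1 := a]" n ps j C] nth_act_list [of hs n ps j C] assms by auto
qed (use assms in simp)

lemma act_list_upd:
  assumes "length hs = n + 2" and "length ps = n + 1" and "i \<le> n"
  shows "act_list C hs (upd ps i f) = upd (act_list C hs ps) i (hact C (hs ! i) f)"
proof (rule nth_equalityI)
  fix j assume "j < length (act_list C hs (upd ps i f))"
  then have "j \<le> n" using assms(2) by simp
  then show "act_list C hs (upd ps i f) ! j = upd (act_list C hs ps) i (hact C (hs ! i) f) ! j"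
    using nth_act_list [of hs n "upd ps i f" j C] nth_act_list [of hs n ps j C]
      upd_nth_eq [of i "act_list C hs ps" j] upd_nth_eq [of i ps j] assms
      length_act_list [OF assms(1,2), of C] by auto
qed (use assms in simp)

lemma T_rel_cases:
  assumes "r \<in> T_rel A C M n"
  obtains (add) ps i f g m where
      "r = frag_of (upd ps i (f + g), m) - frag_of (upd ps i f, m) - frag_of (upd ps i g, m)"
      "i \<le> n" "(upd ps i f, m) \<in> simples C n" "(upd ps i g, m) \<in> simples C n"
    | (add_last) ps m m' where "r = frag_of (ps, m + m') - frag_of (ps, m) - frag_of (ps, m')"
      "(ps, m) \<in> simples C n"
    | (balanced) ps i l m where
      "r = frag_of (upd ps i (hact C (tL A l) (snd (ps ! i))), m)
        - frag_of (upd ps (i + 1) (hact C (sL A l) (snd (ps ! (i + 1)))), m)"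
      "i < n" "(ps, m) \<in> simples C n"
    | (balanced_last) ps l m where
      "r = frag_of (upd ps n (hact C (tL A l) (snd (ps ! n))), m) - frag_of (ps, actM M (sL A l) m)"
      "(ps, m) \<in> simples C n"
  using assms unfolding T_rel_def by blast

lemma T_relI:
  "i \<le> n \<Longrightarrow> (upd ps i f, m) \<in> simples C n \<Longrightarrow> (upd ps i g, m) \<in> simples C n \<Longrightarrow>
    frag_of (upd ps i (f + g), m) - frag_of (upd ps i f, m) - frag_of (upd ps i g, m)
      \<in> group_closure (T_rel A C M n)"
  "(ps, m) \<in> simples C n \<Longrightarrow>
    frag_of (ps, m + m') - frag_of (ps, m) - frag_of (ps, m') \<in> group_closure (T_rel A C M n)"
  "i < n \<Longrightarrow> (ps, m) \<in> simples C n \<Longrightarrow>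
    frag_of (upd ps i (hact C (tL A l) (snd (ps ! i))), m)
      - frag_of (upd ps (i + 1) (hact C (sL A l) (snd (ps ! (i + 1)))), m) \<in> group_closure (T_rel A C M n)"
  "(ps, m) \<in> simples C n \<Longrightarrow>
    frag_of (upd ps n (hact C (tL A l) (snd (ps ! n))), m) - frag_of (ps, actM M (sL A l) m)
      \<in> group_closure (T_rel A C M n)"
  unfolding T_rel_def by (rule group_closure.base, blast)+

section \<open>Descent of the diagonal action\<close>

context
  fixes A :: "('k::comm_ring_1, 'l::ring_1, 'r::ring_1, 'h::ring_1) hopf_algebroid"
    and C :: "('k, 'h, 'o, 'f::ab_group_add) hcat"
    and M :: "('k, 'l, 'r, 'h, 'm::ab_group_add) mod_comod"
  assumes C: "H_category A C"
begin

lemma upd_hact_simples: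
  assumes s: "(ps, m) \<in> simples C n" and "i \<le> n"
  shows "(upd ps i (hact C h (snd (ps ! i))), m') \<in> simples C n"
proof -
  let ?j = "(i + 1) mod (n + 1)"
  have j: "?j \<le> n" using mod_less_divisor [of "n + 1" "i + 1"] by linarith
  have len: "length ps = n + 1"
    and hom: "\<forall>i\<le>n. fst (ps ! i) \<in> Obj C \<and>
        snd (ps ! i) \<in> Hom C (fst (ps ! ((i + 1) mod (n + 1)))) (fst (ps ! i))"
    using s unfolding simples_iff by blast+
  then have "hact C h (snd (ps ! i)) \<in> Hom C (fst (ps ! ?j)) (fst (ps ! i))"
    using j assms(2) by (intro Hom_hact [OF C]) blast+
  then show ?thesis
    unfolding upd_simples_iff [OF len assms(2)] using hom by simp
qed

lemma upd_add_simples: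
  assumes "(upd ps i f, m) \<in> simples C n" and "(upd ps i g, m) \<in> simples C n" and i: "i \<le> n"
  shows "(upd ps i (f + g), m) \<in> simples C n"
proof -
  have len: "length ps = n + 1" using assms(1) by (simp add: simples_iff)
  have j: "(i + 1) mod (n + 1) \<le> n" using mod_less_divisor [of "n + 1" "i + 1"] by linarith
  note iff = upd_simples_iff [OF len i, of _ m C]
  have obj: "fst (ps ! j) \<in> Obj C" if "j \<le> n" for j
    using assms(1) [unfolded iff, THEN conjunct1] that by blast
  have "f + g \<in> Hom C (fst (ps ! ((i + 1) mod (n + 1)))) (fst (ps ! i))"
    using obj [OF j] obj [OF i] assms(1) [unfolded iff, THEN conjunct2]
      assms(2) [unfolded iff, THEN conjunct2] by (rule Hom_add [OF C])
  then show ?thesis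
    unfolding iff using assms(1) [unfolded iff, THEN conjunct1] by blast
qed

lemma T_rel_subset: "T_rel A C M n \<subseteq> carrier (free_Abelian_group (simples C n))"
proof
  fix r assume "r \<in> T_rel A C M n"
  then show "r \<in> carrier (free_Abelian_group (simples C n))"
  proof (cases rule: T_rel_cases)
    case (add ps i f g m)
    then show ?thesis
      using upd_add_simples [OF add(3,4,2)] unfolding add(1) carrier_free_Abelian_group_iff by (intro keys_diff_subset) simp_all
  next
    case add_last
    then show ?thesis unfolding add_last(1) carrier_free_Abelian_group_iff by (intro keys_diff_subset) (simp_all add: simples_iff)
  next
    case (balanced ps i l m)
    then show ?thesis
      using upd_hact_simples [of ps m n i _ m] upd_hact_simples [of ps m n "i + 1" _ m]
      unfolding balanced(1) carrier_free_Abelian_group_iff by (intro keys_diff_subset) simp_all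
  next
    case (balanced_last ps l m)
    moreover have "(ps, actM M (sL A l) m) \<in> simples C n" using balanced_last(2) by (simp add: simples_iff)
    ultimately show ?thesis
      using upd_hact_simples [of ps m n n _ m] unfolding balanced_last(1) carrier_free_Abelian_group_iff
      by (intro keys_diff_subset) simp_all
  qed
qed

lemma generate_T_rel:
  "generate (free_Abelian_group (simples C n)) (T_rel A C M n) = group_closure (T_rel A C M n)"
  by (rule generate_free_Abelian_group [OF T_rel_subset])

lemma free_data_hom:
  "(\<lambda>x. ract (free_data A C M) n x h) \<in> hom (grp (free_data A C M) n) (grp (free_data A C M) n)"
  "cyc (free_data A C M) n \<in> hom (grp (free_data A C M) n) (grp (free_data A C M) n)"
  "1 \<le> n \<Longrightarrow> i \<le> n \<Longrightarrow> face (free_data A C M) n i \<in> hom (grp (free_data A C M) n) (grp (free_data A C M) (n - 1))"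
  unfolding free_data_def cyc_data.select_convs
  by (simp_all add: frag_extend_hom keys_T_act [OF C] keys_T_cyc [OF C] keys_T_face [OF C] del: One_nat_def)

context
  assumes B: "left_bialgebroid A" and M: "left_module_on (scH A) UNIV (scM M) (actM M)"
begin

text \<open>The lists have \<open>n + 2\<close> entries, for \<open>n + 1\<close> morphisms and the
  coefficient, hence \<open>list_gen A (n + 1)\<close>. The balancing of coproduct factors turns
  into that of chains since \<open>tL A l * a\<close> acts as \<open>a\<close> followed by
  \<open>tL A l\<close>, and likewise for \<open>sL\<close>.\<close>

lemma frag_extend_act_list_rel:
  assumes s: "(ps, m) \<in> simples C n" and w: "w \<in> group_closure (list_gen A (n + 1))"
  shows "frag_extend (\<lambda>hs. frag_of (act_list C hs ps, actM M (hs ! (n + 1)) m)) w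
    \<in> group_closure (T_rel A C M n)" (is "frag_extend ?e w \<in> _")
  using w
proof (rule frag_extend_group_closure)
  have len: "length ps = n + 1" and hom: "i \<le> n \<Longrightarrow> fst (ps ! i) \<in> Obj C"
    "i \<le> n \<Longrightarrow> snd (ps ! i) \<in> Hom C (fst (ps ! ((i + 1) mod (n + 1)))) (fst (ps ! i))" for i
    using s unfolding simples_iff by blast+
  have dom: "fst (ps ! ((i + 1) mod (n + 1))) \<in> Obj C" for i
    using hom(1) mod_less_divisor [of "n + 1" "i + 1"] by (simp add: less_Suc_eq_le)
  have act: "hact C (a + b) (snd (ps ! i)) = hact C a (snd (ps ! i)) + hact C b (snd (ps ! i))"
    "hact C (a * b) (snd (ps ! i)) = hact C a (hact C b (snd (ps ! i)))" if "i \<le> n" for a b i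
    using that hom dom hact_add_left [OF C, of "fst (ps ! ((i + 1) mod (n + 1)))" "fst (ps ! i)"]
      hact_mult [OF C, of "fst (ps ! ((i + 1) mod (n + 1)))" "fst (ps ! i)"] by simp_all
  have actM: "actM M (a + b) m = actM M a m + actM M b m" "actM M (a * b) m = actM M a (actM M b m)" for a b
    using M unfolding left_module_on_def by simp_all
  fix r assume "r \<in> list_gen A (n + 1)"
  then consider (add) hs i b c where "r = frag_of (hs[i := b + c]) - frag_of (hs[i := b]) - frag_of (hs[i := c])"
      "length hs = n + 2" "i \<le> n + 1"
    | (bal) hs i l where "r = frag_of (hs[i := tL A l * hs ! i]) - frag_of (hs[i + 1 := sL A l * hs ! (i + 1)])"
      "length hs = n + 2" "i \<le> n"
    unfolding list_gen_def by fastforce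
  then show "frag_extend ?e r \<in> group_closure (T_rel A C M n)"
  proof cases
    case add
    let ?qs = "act_list C hs ps" and ?m = "actM M (hs ! (n + 1)) m"
    show ?thesis
    proof (cases "i = n + 1")
      case True
      then show ?thesis
        using T_relI(2) [OF act_list_simples [OF C s add(2)], where m' = "actM M c m"]
        by (simp add: add(1) frag_extend_diff act_list_list_update_last [OF add(2) len, simplified] add(2) actM)
    next
      case False
      then have i: "i \<le> n" using add(3) by simp
      have "(upd ?qs i (hact C b (snd (ps ! i))), ?m) \<in> simples C n" for b
        using act_list_simples [OF C s, of "hs[i := b]"] act_list_list_update [OF add(2) len i, of C b] add(2)
        by simp
      from T_relI(1) [OF i this this, of b c]
      show ?thesis
        using False act(1) [OF i]
        by (simp add: add(1) frag_extend_diff act_list_list_update [OF add(2) len i])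
    qed
  next
    case bal
    let ?qs = "act_list C hs ps" and ?m = "actM M (hs ! (n + 1)) m"
    have snd: "hact C (hs ! j) (snd (ps ! j)) = snd (?qs ! j)" if "j \<le> n" for j
      using nth_act_list [OF bal(2) len that, of C] by simp
    have qs: "(?qs, m') \<in> simples C n" for m'
      using act_list_simples [OF C s bal(2)] .
    show ?thesis
    \<comment> \<open>At \<open>i = n\<close> the right neighbour is the coefficient, so the last
      family of relations applies.\<close>
    proof (cases "i = n")
      case True
      then show ?thesis
        using T_relI(4) [OF qs [of ?m], where l = l and A = A and M = M]
        by (simp add: bal(1) frag_extend_diff act_list_list_update [OF bal(2) len]
            act_list_list_update_last [OF bal(2) len, simplified] bal(2) actM act(2) snd)
    next
      case False
      then show ?thesis
        using T_relI(3) [OF _ qs [of ?m], where l = l and A = A and M = M] bal(3)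
        by (simp add: bal(1) frag_extend_diff act_list_list_update [OF bal(2) len] act(2) snd)
    qed
  qed
qed

text \<open>Acting by \<open>x\<close> on one factor beforehand amounts to right multiplication of
  the corresponding coproduct factor. This turns the balancing relations of \<open>T\<close> into
  instances of the Takeuchi condition.\<close>

lemma T_act_upd:
  assumes s: "(ps, m) \<in> simples C n" and i: "i \<le> n"
  shows "T_act A C M n h (upd ps i (hact C x (snd (ps ! i))), m)
    = frag_extend (\<lambda>hs. frag_of (act_list C hs ps, actM M (hs ! (n + 1)) m))
        (rmult i x (iterated_DeltaL A (n + 1) (inv_into UNIV (antipode A) h)))"
  unfolding T_act_def case_prod_conv rmult_def frag_extend_frag_extend
proof (rule frag_extend_eq)
  have len: "length ps = n + 1" using s unfolding simples_iff by blast
  have "(i + 1) mod (n + 1) \<le> n" using mod_less_divisor [of "n + 1" "i + 1"] by linarith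
  then have hact: "hact C (a * x) (snd (ps ! i)) = hact C a (hact C x (snd (ps ! i)))" for a
    using s i hact_mult [OF C, of "fst (ps ! ((i + 1) mod (n + 1)))" "fst (ps ! i)"]
    unfolding simples_iff by simp
  fix hs assume "hs \<in> Poly_Mapping.keys (iterated_DeltaL A (n + 1) (inv_into UNIV (antipode A) h))"
  then have hs: "length hs = n + 2" using length_iterated_DeltaL by fastforce
  show "frag_of (act_list C hs (upd ps i (hact C x (snd (ps ! i)))), actM M (hs ! (n + 1)) m)
    = frag_extend (\<lambda>hs. frag_of (act_list C hs ps, actM M (hs ! (n + 1)) m)) (frag_of (hs[i := hs ! i * x]))"
    using i by (simp add: act_list_upd [OF hs len i] act_list_list_update [OF hs len i] hact)
qed

lemma T_act_last:
  assumes s: "(ps, m) \<in> simples C n"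
  shows "T_act A C M n h (ps, actM M x m)
    = frag_extend (\<lambda>hs. frag_of (act_list C hs ps, actM M (hs ! (n + 1)) m))
        (rmult (n + 1) x (iterated_DeltaL A (n + 1) (inv_into UNIV (antipode A) h)))"
  unfolding T_act_def case_prod_conv rmult_def frag_extend_frag_extend
proof (rule frag_extend_eq)
  have len: "length ps = n + 1" using s unfolding simples_iff by blast
  fix hs assume "hs \<in> Poly_Mapping.keys (iterated_DeltaL A (n + 1) (inv_into UNIV (antipode A) h))"
  then have hs: "length hs = n + 2" using length_iterated_DeltaL by fastforce
  show "frag_of (act_list C hs ps, actM M (hs ! (n + 1)) (actM M x m))
    = frag_extend (\<lambda>hs. frag_of (act_list C hs ps, actM M (hs ! (n + 1)) m))
        (frag_of (hs[n + 1 := hs ! (n + 1) * x]))"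
    using M hs unfolding left_module_on_def frag_extend_of act_list_list_update_last [OF hs len] by simp
qed

text \<open>The additive relations are preserved term by term in the coproduct, the balancing
  relations only after summation, through the Takeuchi condition.\<close>

lemma T_act_descends:
  assumes "x \<in> group_closure (T_rel A C M n)"
  shows "frag_extend (T_act A C M n h) x \<in> group_closure (T_rel A C M n)"
  using assms
proof (rule frag_extend_group_closure)
  let ?D = "iterated_DeltaL A (n + 1) (inv_into UNIV (antipode A) h)"
  have keys: "length hs = n + 2" if "hs \<in> Poly_Mapping.keys ?D" for hs
    using length_iterated_DeltaL that by fastforce
  fix r assume "r \<in> T_rel A C M n"
  then show "frag_extend (T_act A C M n h) r \<in> group_closure (T_rel A C M n)"
  proof (cases rule: T_rel_cases)
    case (add ps i f g m)
    have len: "length ps = n + 1" using add(3) by (simp add: simples_iff)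
    let ?j = "(i + 1) mod (n + 1)"
    have "?j \<le> n" using mod_less_divisor [of "n + 1" "i + 1"] by linarith
    then have hact: "hact C a (f + g) = hact C a f + hact C a g" for a
      using add(2-4) hact_add [OF C, of "fst (ps ! ?j)" "fst (ps ! i)" f g]
      unfolding upd_simples_iff [OF len add(2)] by simp
    have "frag_extend (\<lambda>hs. frag_of (act_list C hs (upd ps i (f + g)), actM M (hs ! (n + 1)) m)
        - frag_of (act_list C hs (upd ps i f), actM M (hs ! (n + 1)) m)
        - frag_of (act_list C hs (upd ps i g), actM M (hs ! (n + 1)) m)) ?D \<in> group_closure (T_rel A C M n)"
    proof (rule frag_extend_in_group_closure)
      fix hs assume "hs \<in> Poly_Mapping.keys ?D"
      then have hs: "length hs = n + 2" by (rule keys)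
      show "frag_of (act_list C hs (upd ps i (f + g)), actM M (hs ! (n + 1)) m)
        - frag_of (act_list C hs (upd ps i f), actM M (hs ! (n + 1)) m)
        - frag_of (act_list C hs (upd ps i g), actM M (hs ! (n + 1)) m) \<in> group_closure (T_rel A C M n)"
        using act_list_simples [OF C add(3) hs] act_list_simples [OF C add(4) hs]
        unfolding act_list_upd [OF hs len add(2)] hact by (rule T_relI(1) [OF add(2)])
    qed
    then show ?thesis
      by (simp add: add(1) T_act_def frag_extend_diff frag_extend_fun_diff)
  next
    case (add_last ps m m')
    have actM: "actM M a (m + m') = actM M a m + actM M a m'" for a
      using M unfolding left_module_on_def by simp
    have "frag_extend (\<lambda>hs. frag_of (act_list C hs ps, actM M (hs ! (n + 1)) (m + m'))
        - frag_of (act_list C hs ps, actM M (hs ! (n + 1)) m)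
        - frag_of (act_list C hs ps, actM M (hs ! (n + 1)) m')) ?D \<in> group_closure (T_rel A C M n)"
      unfolding actM
      by (intro frag_extend_in_group_closure T_relI(2) act_list_simples [OF C add_last(2)] keys)
    then show ?thesis
      by (simp add: add_last(1) T_act_def frag_extend_diff frag_extend_fun_diff)
  next
    case (balanced ps i l m)
    show ?thesis
      using frag_extend_act_list_rel [OF balanced(3) iterated_DeltaL_Takeuchi [OF B, of i "n + 1"]] balanced(2)
        T_act_upd [OF balanced(3), of i] T_act_upd [OF balanced(3), of "i + 1"]
      by (simp add: balanced(1) frag_extend_diff)
  next
    case (balanced_last ps l m)
    show ?thesis
      using frag_extend_act_list_rel [OF balanced_last(2) iterated_DeltaL_Takeuchi [OF B, of n "n + 1"]]
        T_act_upd [OF balanced_last(2), of n] T_act_last [OF balanced_last(2)]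
      by (simp add: balanced_last(1) frag_extend_diff)
  qed
qed

text \<open>The descent of the action to \<open>T\<close> comes from the bialgebroid axioms; all the
  other descents are extracted from \<open>Q_defined\<close>.\<close>

lemma compatible_Q:
  assumes Q: "Q_defined A C M"
  defines "N \<equiv> \<lambda>n. generate (grp (free_data A C M) n) (T_rel A C M n)"
  shows "compatible (free_data A C M) N"
    and "compatible (T_mod A C M) (coeq_rel A (T_mod A C M))"
proof -
  have grp: "grp (free_data A C M) n = free_Abelian_group (simples C n)" for n
    by (simp add: free_data_def)
  have sub: "subgroup (N n) (grp (free_data A C M) n)" for n
    unfolding N_def grp by (rule group.generate_is_subgroup [OF _ T_rel_subset]) simp
  have ract: "descends (grp (free_data A C M) n) (N n) (grp (free_data A C M) n) (N n)
      (\<lambda>x. ract (free_data A C M) n x h)" for n h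
    unfolding descends_def using free_data_hom(1) [of n h] T_act_descends [of _ n h]
    unfolding N_def grp generate_T_rel by (auto simp: free_data_def)
  have T: "T_mod A C M = quotient_data (free_data A C M) N"
    by (simp add: T_mod_def N_def)
  note * = compatible_iterated_quotient [of "free_data A C M" N "T_mod A C M" A,
      OF _ sub ract free_data_hom(3) free_data_hom(2) T]
  show "compatible (free_data A C M) N" "compatible (T_mod A C M) (coeq_rel A (T_mod A C M))"
    using Q unfolding Q_defined_def QH_mod_def
    by (auto simp: grp abelian_free_Abelian_group intro!: * )
qed

end

end

section \<open>Invariant isomorphisms\<close>

lemma int_scale_zero [simp]: "int_scale 0 x = 0" and int_scale_one [simp]: "int_scale 1 x = x"
  by (simp_all add: int_scale_def)

lemma int_scale_plus_one: "int_scale (n + 1) x = int_scale n x + x"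
proof (cases "n \<ge> 0")
  case True
  then have "nat (n + 1) = Suc (nat n)" "nat (- n) = 0" "nat (- (n + 1)) = 0" by simp_all
  then show ?thesis unfolding int_scale_def by simp
next
  case False
  then have "nat (- n) = Suc (nat (- (n + 1)))" "nat n = 0" "nat (n + 1) = 0" by simp_all
  then show ?thesis unfolding int_scale_def by simp
qed

lemma int_scale_add: "int_scale (m + n) x = int_scale m x + int_scale n x"
proof (induction n rule: int_induct [where k = 0])
  case (step1 i)
  then show ?case
    using int_scale_plus_one [of "m + i" x] int_scale_plus_one [of i x] by (simp add: add.assoc)
next
  case (step2 i)
  then show ?case
    using int_scale_plus_one [of "m + (i - 1)" x] int_scale_plus_one [of "i - 1" x]
    by (simp add: algebra_simps)
qed simp

lemma frag_eval_superset:
  assumes "finite K" and "Poly_Mapping.keys c \<subseteq> K"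
  shows "frag_eval f c = (\<Sum>x\<in>K. int_scale (Poly_Mapping.lookup c x) (f x))"
  unfolding frag_eval_def
  by (rule sum.mono_neutral_left) (use assms in \<open>auto simp: in_keys_iff\<close>)

lemma frag_eval_add: "frag_eval f (x + y) = frag_eval f x + frag_eval f y"
proof -
  let ?K = "Poly_Mapping.keys x \<union> Poly_Mapping.keys y"
  have "frag_eval f (x + y) = (\<Sum>z\<in>?K. int_scale (Poly_Mapping.lookup (x + y) z) (f z))"
    by (rule frag_eval_superset) (use keys_add [of x y] in auto)
  also have "\<dots> = (\<Sum>z\<in>?K. int_scale (Poly_Mapping.lookup x z) (f z))
      + (\<Sum>z\<in>?K. int_scale (Poly_Mapping.lookup y z) (f z))"
    by (simp add: lookup_add int_scale_add sum.distrib)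
  also have "\<dots> = frag_eval f x + frag_eval f y"
    by (simp add: frag_eval_superset [of ?K])
  finally show ?thesis .
qed

lemma frag_eval_of [simp]: "frag_eval f (frag_of x) = f x"
  by (simp add: frag_eval_def)

lemma additive_frag_eval:
  fixes \<phi> :: "'a::ab_group_add \<Rightarrow> 'b::ab_group_add"
  assumes add: "\<And>x y. \<phi> (x + y) = \<phi> x + \<phi> y"
  shows "\<phi> (frag_eval f c) = frag_eval (\<lambda>x. \<phi> (f x)) c"
proof -
  have zero: "\<phi> 0 = 0" using add [of 0 0] by simp
  have diff: "\<phi> (x - y) = \<phi> x - \<phi> y" for x y using add [of "x - y" y] by simp
  have sum: "\<phi> (sum g K) = (\<Sum>x\<in>K. \<phi> (g x))" for g :: "'z \<Rightarrow> 'a" and K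
    by (induction K rule: infinite_finite_induct) (simp_all add: zero add)
  have sum': "\<phi> (\<Sum>i<(k::nat). x) = (\<Sum>i<k. \<phi> x)" for k x
    by (induction k) (simp_all add: zero add)
  have "\<phi> (int_scale n x) = int_scale n (\<phi> x)" for n x
    unfolding int_scale_def diff sum' ..
  then show ?thesis unfolding frag_eval_def sum by simp
qed

lemma H_functor_Obj: "H_functor C D Fo Fm \<Longrightarrow> X \<in> Obj C \<Longrightarrow> Fo X \<in> Obj D"
  unfolding H_functor_def by (drule conjunct1) simp

lemma H_functor_Hom:
  "H_functor C D Fo Fm \<Longrightarrow> X \<in> Obj C \<Longrightarrow> Y \<in> Obj C \<Longrightarrow> f \<in> Hom C X Y \<Longrightarrow> Fm f \<in> Hom D (Fo X) (Fo Y)"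
  unfolding H_functor_def by (drule conjunct2, drule conjunct1) simp

lemma twisted_functor_H_functor:
  assumes "H_functor C D Fo Fm"
  shows "twisted_functor C D (\<lambda>_. Fo) (\<lambda>_ _ _ _. Fm)"
  using assms unfolding H_functor_def twisted_functor_def by simp

section \<open>Composition with invariant morphisms\<close>

context
  fixes A :: "('k::comm_ring_1, 'l::ring_1, 'r::ring_1, 'h::ring_1) hopf_algebroid"
    and C :: "('k, 'h, 'o, 'f::ab_group_add) hcat"
  assumes B: "left_bialgebroid A" and C: "H_category A C"
begin

lemmas hact_Cmp = C [unfolded H_category_def, THEN conjunct2, THEN conjunct2, THEN conjunct2,
  THEN conjunct2, rule_format]

text \<open>Balancing of composition is hidden in the requirement that \<open>h(fg)\<close> may be
  computed with every representative of the coproduct. For \<open>h = 1\<close> this compares two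
  representatives that differ by a balancing relation.\<close>

lemma Cmp_balanced:
  assumes obj: "X \<in> Obj C" "Y \<in> Obj C" "Z \<in> Obj C" and f: "f \<in> Hom C Y Z" and g: "g \<in> Hom C X Y"
  shows "Cmp C (hact C (tL A l) f) g = Cmp C f (hact C (sL A l) g)"
proof -
  let ?F = "\<lambda>(a, b). Cmp C (hact C a f) (hact C b g)"
  \<comment> \<open>A second representative of \<open>DeltaL A 1\<close>: since
    \<open>frag_of (1, 1)\<close> evaluates to \<open>fg\<close> as well, the added difference must
    evaluate to zero.\<close>
  let ?w = "frag_of (1, 1) + (frag_of (tL A l, 1) - frag_of (1, sL A l))"
  have "frag_of (1, 1) - DeltaL A 1 \<in> group_closure (HLH_gen A)"
    using group_closure_sym DeltaL_one [OF B] unfolding HLH_rel_closure by blast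
  moreover have "frag_of (tL A l, 1) - frag_of (1, sL A l) \<in> group_closure (HLH_gen A)"
    using HLH_rel_gens(3) [of A l 1 1] unfolding HLH_rel_closure by simp
  ultimately have "(frag_of (1, 1) - DeltaL A 1) + (frag_of (tL A l, 1) - frag_of (1, sL A l))
      \<in> group_closure (HLH_gen A)"
    by (rule group_closure_add)
  then have "?w - DeltaL A 1 \<in> HLH_rel A"
    unfolding HLH_rel_closure by (simp add: algebra_simps)
  then have "hact C 1 (Cmp C f g) = frag_eval ?F ?w"
    by (rule hact_Cmp [OF obj f g])
  moreover have "hact C 1 (Cmp C f g) = Cmp C f g"
    using hact_one [OF C obj(1,3) Hom_Cmp [OF C obj f g]] .
  moreover have "frag_eval ?F ?w + frag_eval ?F (frag_of (1, sL A l))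
      = frag_eval ?F (frag_of (1, 1)) + frag_eval ?F (frag_of (tL A l, 1))"
    unfolding frag_eval_add [symmetric] by simp
  ultimately show ?thesis
    using hact_one [OF C obj(2,3) f] hact_one [OF C obj(1,2) g] by simp
qed

lemma hact_Cmp_DeltaL:
  assumes "X \<in> Obj C" "Y \<in> Obj C" "Z \<in> Obj C" and "f \<in> Hom C Y Z" and "g \<in> Hom C X Y"
  shows "hact C h (Cmp C f g) = frag_eval (\<lambda>(a, b). Cmp C (hact C a f) (hact C b g)) (DeltaL A h)"
  by (rule hact_Cmp [OF assms]) (simp add: HLH_rel_closure)

text \<open>\<open>(h_1 f)(h_2 g) = (t_L eps(h_1) f)(h_2 g) = f (s_L eps(h_1) h_2 g) = f (h
  g)\<close>, by invariance, balancing and the counit law. Every term is a value of the additive map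
  \<open>?\<phi>\<close>, so the counit law can be applied to the Sweedler representative inside
  it.\<close>

lemma hact_Cmp_invariant_left:
  assumes obj: "X \<in> Obj C" "Y \<in> Obj C" "Z \<in> Obj C" and f: "f \<in> Hom C Y Z" and g: "g \<in> Hom C X Y"
    and inv: "H_invariant A C f"
  shows "hact C h (Cmp C f g) = Cmp C f (hact C h g)"
proof -
  let ?\<phi> = "\<lambda>x. Cmp C f (hact C x g)"
  have hg: "hact C x g \<in> Hom C X Y" for x using Hom_hact [OF C obj(1,2) g] .
  have "?\<phi> (x + y) = ?\<phi> x + ?\<phi> y" for x y
    using hact_add_left [OF C obj(1,2) g] Cmp_add_right [OF C obj f hg hg] by simp
  note \<phi> = additive_frag_eval [of ?\<phi>, OF this]
  have "Cmp C (hact C a f) (hact C b g) = ?\<phi> (lactL A (epsL A a) b)" for a b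
  proof -
    have "hact C a f = hact C (tL A (epsL A a)) f" using inv unfolding H_invariant_def by blast
    then show ?thesis
      using Cmp_balanced [OF obj f hg, of "epsL A a" b] hact_mult [OF C obj(1,2) g, of "sL A (epsL A a)" b]
      by (simp add: lactL_def)
  qed
  then have "hact C h (Cmp C f g) = frag_eval (\<lambda>x. ?\<phi> (case x of (a, b) \<Rightarrow> lactL A (epsL A a) b)) (DeltaL A h)"
    unfolding hact_Cmp_DeltaL [OF obj f g] case_prod_beta by simp
  also have "\<dots> = ?\<phi> h"
    unfolding \<phi> [symmetric] epsL_DeltaL_left [OF B] ..
  finally show ?thesis .
qed

text \<open>The mirror computation, with the other form of invariance,
  \<open>h g = s_L eps(h) g\<close>, and the other counit law.\<close>

lemma hact_Cmp_invariant_right: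
  assumes obj: "X \<in> Obj C" "Y \<in> Obj C" "Z \<in> Obj C" and f: "f \<in> Hom C Y Z" and g: "g \<in> Hom C X Y"
    and inv: "H_invariant A C g"
  shows "hact C h (Cmp C f g) = Cmp C (hact C h f) g"
proof -
  let ?\<phi> = "\<lambda>x. Cmp C (hact C x f) g"
  have hf: "hact C x f \<in> Hom C Y Z" for x using Hom_hact [OF C obj(2,3) f] .
  have "?\<phi> (x + y) = ?\<phi> x + ?\<phi> y" for x y
    using hact_add_left [OF C obj(2,3) f] Cmp_add_left [OF C obj hf hf g] by simp
  note \<phi> = additive_frag_eval [of ?\<phi>, OF this]
  have "Cmp C (hact C a f) (hact C b g) = ?\<phi> (ractL A a (epsL A b))" for a b
  proof -
    have "hact C b g = hact C (sL A (epsL A b)) g" using inv unfolding H_invariant_def by blast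
    then show ?thesis
      using Cmp_balanced [OF obj hf g, of "epsL A b" a] hact_mult [OF C obj(2,3) f, of "tL A (epsL A b)" a]
      by (simp add: ractL_def)
  qed
  then have "hact C h (Cmp C f g) = frag_eval (\<lambda>x. ?\<phi> (case x of (a, b) \<Rightarrow> ractL A a (epsL A b))) (DeltaL A h)"
    unfolding hact_Cmp_DeltaL [OF obj f g] case_prod_beta by simp
  also have "\<dots> = ?\<phi> h"
    unfolding \<phi> [symmetric] epsL_DeltaL_right [OF B] ..
  finally show ?thesis .
qed

text \<open>The witness \<open>u b c Y X f\<close> is \<open>f\<close> composed with theta on the
  left if \<open>b\<close> holds and with eta on the right if \<open>c\<close> holds.\<close>

lemma twisted_functor_invariant_iso:
  assumes Po: "\<And>X. X \<in> Obj C \<Longrightarrow> Po X \<in> Obj C"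
    and Pm: "\<And>X Y f. X \<in> Obj C \<Longrightarrow> Y \<in> Obj C \<Longrightarrow> f \<in> Hom C X Y \<Longrightarrow> Pm f \<in> Hom C (Po X) (Po Y)"
    and iso: "invariant_iso_to_id A C Po Pm \<eta>"
  shows "\<exists>u. twisted_functor C C (\<lambda>b X. if b then Po X else X) u \<and>
    (\<forall>X\<in>Obj C. \<forall>Y\<in>Obj C. \<forall>f\<in>Hom C X Y. u True True Y X f = Pm f \<and> u False False Y X f = f)"
proof -
  let ?p = "\<lambda>b X. if b then Po X else X"
  have \<eta>: "\<eta> X \<in> Hom C (Po X) X" and inv: "H_invariant A C (\<eta> X)" if "X \<in> Obj C" for X
    using iso that unfolding invariant_iso_to_id_def by blast+
  have nat: "Cmp C f (\<eta> X) = Cmp C (\<eta> Y) (Pm f)" if "X \<in> Obj C" "Y \<in> Obj C" "f \<in> Hom C X Y" for X Y f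
    using iso that unfolding invariant_iso_to_id_def by blast
  have "\<forall>X\<in>Obj C. \<exists>t. t \<in> Hom C X (Po X) \<and> Cmp C (\<eta> X) t = Idm C X \<and> Cmp C t (\<eta> X) = Idm C (Po X)"
    using iso unfolding invariant_iso_to_id_def by blast
  then obtain \<theta> where "\<forall>X\<in>Obj C. \<theta> X \<in> Hom C X (Po X) \<and> Cmp C (\<eta> X) (\<theta> X) = Idm C X \<and> Cmp C (\<theta> X) (\<eta> X) = Idm C (Po X)"
    by (rule bchoice [THEN exE])
  then have \<theta>: "\<theta> X \<in> Hom C X (Po X)" "Cmp C (\<eta> X) (\<theta> X) = Idm C X" "Cmp C (\<theta> X) (\<eta> X) = Idm C (Po X)"
    if "X \<in> Obj C" for X using that by blast+
  define post where "post c X f = (if c then Cmp C f (\<eta> X) else f)" for c X f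
  define pre where "pre b Y f = (if b then Cmp C (\<theta> Y) f else f)" for b Y f
  define u where "u b c Y X f = pre b Y (post c X f)" for b c Y X f
  have p: "?p b X \<in> Obj C" if "X \<in> Obj C" for b X using that Po by simp
  have post: "post c X f \<in> Hom C (?p c X) Y" if "X \<in> Obj C" "Y \<in> Obj C" "f \<in> Hom C X Y" for c X Y f
    unfolding post_def using that Hom_Cmp [OF C Po _ _ _ \<eta>] by simp
  have pre: "pre b Y f \<in> Hom C X (?p b Y)" if "X \<in> Obj C" "Y \<in> Obj C" "f \<in> Hom C X Y" for b X Y f
    unfolding pre_def using that Hom_Cmp [OF C _ _ Po \<theta>(1)] by simp
  have post_add: "post c X (f + g) = post c X f + post c X g"
    if "X \<in> Obj C" "Y \<in> Obj C" "f \<in> Hom C X Y" "g \<in> Hom C X Y" for c X Y f g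
    unfolding post_def using Cmp_add_left [OF C Po [OF that(1)] that \<eta> [OF that(1)]] by simp
  have pre_add: "pre b Y (f + g) = pre b Y f + pre b Y g"
    if "X \<in> Obj C" "Y \<in> Obj C" "f \<in> Hom C X Y" "g \<in> Hom C X Y" for b X Y f g
    unfolding pre_def using Cmp_add_right [OF C that(1,2) Po [OF that(2)] \<theta>(1) [OF that(2)] that(3,4)] by simp
  have post_hact: "post c X (hact C h f) = hact C h (post c X f)"
    if "X \<in> Obj C" "Y \<in> Obj C" "f \<in> Hom C X Y" for c X Y f h
    unfolding post_def using hact_Cmp_invariant_right [OF Po [OF that(1)] that \<eta> [OF that(1)] inv [OF that(1)]] by simp
  have \<eta>\<theta>: "Cmp C (\<eta> Y) (Cmp C (\<theta> Y) f) = f" if "X \<in> Obj C" "Y \<in> Obj C" "f \<in> Hom C X Y" for X Y f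
    using that Cmp_assoc [OF C that(1,2) Po [OF that(2)] that(2) \<eta> [OF that(2)] \<theta>(1) [OF that(2)] that(3)]
      \<theta>(2) Idm_Cmp [OF C that] by simp
  have \<theta>\<eta>: "Cmp C (\<theta> Y) (Cmp C (\<eta> Y) f) = f" if "X \<in> Obj C" "Y \<in> Obj C" "f \<in> Hom C X (Po Y)" for X Y f
    using that Cmp_assoc [OF C that(1) Po [OF that(2)] that(2) Po [OF that(2)] \<theta>(1) [OF that(2)] \<eta> [OF that(2)] that(3)]
      \<theta>(3) Idm_Cmp [OF C that(1) Po [OF that(2)] that(3)] by simp
  have pre_hact: "pre b Y (hact C h f) = hact C h (pre b Y f)"
    if X: "X \<in> Obj C" and Y: "Y \<in> Obj C" and f: "f \<in> Hom C X Y" for b X Y f h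
  proof -
    let ?g = "Cmp C (\<theta> Y) f"
    have g: "?g \<in> Hom C X (Po Y)" using Hom_Cmp [OF C X Y Po [OF Y] \<theta>(1) [OF Y] f] .
    \<comment> \<open>\<open>eta (h (theta f)) = h (eta theta f) = h f\<close> by invariance of eta;
      composing with theta gives the linearity of composition with theta.\<close>
    have "Cmp C (\<eta> Y) (hact C h ?g) = hact C h f"
      using hact_Cmp_invariant_left [OF X Po [OF Y] Y \<eta> [OF Y] g inv [OF Y], of h] \<eta>\<theta> [OF X Y f] by simp
    then have "Cmp C (\<theta> Y) (hact C h f) = hact C h ?g"
      using \<theta>\<eta> [OF X Y Hom_hact [OF C X Po [OF Y] g], of h] by simp
    then show ?thesis unfolding pre_def by simp
  qed
  have comp: "u a c Z X (Cmp C f g) = Cmp C (u a b Z Y f) (u b c Y X g)"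
    if X: "X \<in> Obj C" and Y: "Y \<in> Obj C" and Z: "Z \<in> Obj C" and f: "f \<in> Hom C Y Z" and g: "g \<in> Hom C X Y"
    for a b c X Y Z f g
  proof -
    let ?g = "post c X g"
    have g': "?g \<in> Hom C (?p c X) Y" using post [OF X Y g] .
    have "post c X (Cmp C f g) = Cmp C f ?g"
      unfolding post_def using Cmp_assoc [OF C Po [OF X] X Y Z f g \<eta> [OF X]] by simp
    \<comment> \<open>If \<open>b\<close> holds, \<open>eta theta = id\<close> is inserted at the
      middle object; otherwise nothing changes.\<close>
    also have "\<dots> = Cmp C (post b Y f) (pre b Y ?g)"
      using Cmp_assoc [OF C p [OF X] Po [OF Y] Y Z f \<eta> [OF Y] Hom_Cmp [OF C p [OF X] Y Po [OF Y] \<theta>(1) [OF Y] g']]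
        \<eta>\<theta> [OF p [OF X] Y g'] unfolding post_def pre_def by simp
    finally have "u a c Z X (Cmp C f g) = pre a Z (Cmp C (post b Y f) (pre b Y ?g))"
      unfolding u_def by simp
    also have "\<dots> = Cmp C (pre a Z (post b Y f)) (pre b Y ?g)"
      using Cmp_assoc [OF C p [OF X] p [OF Y] Z Po [OF Z] \<theta>(1) [OF Z] post [OF Y Z f] pre [OF p [OF X] Y g']]
      unfolding pre_def [of a] by simp
    finally show ?thesis unfolding u_def .
  qed
  have "twisted_functor C C ?p u"
    unfolding twisted_functor_def
  proof (intro conjI allI ballI)
    show "?p b X \<in> Obj C" if "X \<in> Obj C" for b X using p that .
    fix b c X Y f assume XYf: "X \<in> Obj C" "Y \<in> Obj C" "f \<in> Hom C X Y"
    show "u b c Y X f \<in> Hom C (?p c X) (?p b Y)"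
      unfolding u_def by (rule pre [OF p [OF XYf(1)] XYf(2) post [OF XYf]])
    show "u b c Y X (hact C h f) = hact C h (u b c Y X f)" for h
      unfolding u_def using post_hact [OF XYf] pre_hact [OF p [OF XYf(1)] XYf(2) post [OF XYf]] by simp
    show "u b c Y X (f + g) = u b c Y X f + u b c Y X g" if "g \<in> Hom C X Y" for g
      unfolding u_def using post_add [OF XYf that]
        pre_add [OF p [OF XYf(1)] XYf(2) post [OF XYf] post [OF XYf(1,2) that]] by simp
  qed (rule comp)
  \<comment> \<open>By naturality \<open>theta f eta = theta eta (P f) = P f\<close>.\<close>
  moreover have "u True True Y X f = Pm f" "u False False Y X f = f"
    if "X \<in> Obj C" "Y \<in> Obj C" "f \<in> Hom C X Y" for X Y f
    using nat [OF that] \<theta>\<eta> [OF Po [OF that(1)] that(2) Pm [OF that]] by (simp_all add: u_def post_def pre_def)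
  ultimately show ?thesis by blast
qed

end

section \<open>Twisting the relations of T\<close>

context
  fixes A :: "('k::comm_ring_1, 'l::ring_1, 'r::ring_1, 'h::ring_1) hopf_algebroid"
    and C :: "('k, 'h, 'o, 'f::ab_group_add) hcat"
    and D :: "('k, 'h, 'p, 'g::ab_group_add) hcat"
    and M :: "('k, 'l, 'r, 'h, 'm::ab_group_add) mod_comod"
    and p u
  assumes C: "H_category A C" and D: "H_category A D" and U: "twisted_functor C D p u"
begin

lemma twist_list_upd:
  assumes "length ps = n + 1" and "i \<le> n"
  shows "twist_list p u a n (upd ps i f) = upd (twist_list p u a n ps) i
    (u (a i) (a (if i = n then 0 else i + 1)) (fst (ps ! i)) (fst (ps ! (if i = n then 0 else i + 1))) f)"
proof (rule nth_equalityI)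
  fix j assume "j < length (twist_list p u a n (upd ps i f))"
  then have "j \<le> n" by simp
  then show "twist_list p u a n (upd ps i f) ! j = upd (twist_list p u a n ps) i
    (u (a i) (a (if i = n then 0 else i + 1)) (fst (ps ! i)) (fst (ps ! (if i = n then 0 else i + 1))) f) ! j"
    using assms by (auto simp: nth_twist_list upd_nth_eq snd_upd)
qed simp

lemma twist_list_upd_hact:
  assumes s: "(ps, m) \<in> simples C n" and i: "i \<le> n"
  shows "twist_list p u a n (upd ps i (hact C h (snd (ps ! i))))
    = upd (twist_list p u a n ps) i (hact D h (snd (twist_list p u a n ps ! i)))"
  using simplesD(1) [OF s] i
    twisted_functor_hact [OF C D U simplesD(4) [OF s i] simplesD(2,3) [OF s i]]
  by (simp add: twist_list_upd nth_twist_list)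

text \<open>The relations involve morphisms only through sums and the action of \<open>H\<close>,
  both of which \<open>u\<close> preserves, and the coefficient is left alone.\<close>

lemma twist_T_rel:
  assumes "x \<in> group_closure (T_rel A C M n)"
  shows "frag_extend (\<lambda>s. frag_of (twist p u a n s)) x \<in> group_closure (T_rel A D M n)"
  using assms
proof (rule frag_extend_group_closure)
  note twist = twist_simples [OF C D U]
  fix r assume "r \<in> T_rel A C M n"
  then show "frag_extend (\<lambda>s. frag_of (twist p u a n s)) r \<in> group_closure (T_rel A D M n)"
  proof (cases rule: T_rel_cases)
    case (add ps i f g m)
    have len: "length ps = n + 1" using add(3) by (simp add: simples_iff)
    let ?j = "if i = n then 0 else i + 1"
    have "u (a i) (a ?j) (fst (ps ! i)) (fst (ps ! ?j)) (f + g)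
        = u (a i) (a ?j) (fst (ps ! i)) (fst (ps ! ?j)) f + u (a i) (a ?j) (fst (ps ! i)) (fst (ps ! ?j)) g"
      using simplesD(4) [OF add(3,2)] simplesD(2,3) [OF add(3,2)]
        simplesD(3) [OF add(4,2)] len add(2)
      by (intro twisted_functor_add [OF C D U]) (simp_all add: snd_upd)
    then show ?thesis
      using T_relI(1) [OF add(2), of "twist_list p u a n ps" _ m D _ A M] twist [OF add(3), of a m]
        twist [OF add(4), of a m]
      by (simp add: add(1) frag_extend_diff twist_def twist_list_upd [OF len add(2)])
  next
    case (add_last ps m m')
    then show ?thesis
      using T_relI(2) [OF twist [OF add_last(2), of a m], where m' = m'] by (simp add: frag_extend_diff twist_def)
  next
    case (balanced ps i l m)
    then show ?thesis
      using T_relI(3) [OF balanced(2) twist [OF balanced(3), of a m], of A l M]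
      by (simp add: frag_extend_diff twist_def twist_list_upd_hact [OF balanced(3)])
  next
    case (balanced_last ps l m)
    then show ?thesis
      using T_relI(4) [OF twist [OF balanced_last(2), of a m], of A l M]
      by (simp add: frag_extend_diff twist_def twist_list_upd_hact [OF balanced_last(2)])
  qed
qed

end

section \<open>The homotopy equivalence\<close>

definition Q_coset ::
  "('k, 'l, 'r, 'h::ring_1) hopf_algebroid \<Rightarrow> ('k, 'h, 'o, 'f::ab_group_add) hcat \<Rightarrow>
   ('k, 'l, 'r, 'h, 'm::ab_group_add) mod_comod \<Rightarrow> nat \<Rightarrow> (('o, 'f, 'm) simple \<Rightarrow>\<^sub>0 int) \<Rightarrow>
   (('o, 'f, 'm) simple \<Rightarrow>\<^sub>0 int) set set" where
  "Q_coset A C M = double_coset A (free_data A C M)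
     (\<lambda>n. generate (grp (free_data A C M) n) (T_rel A C M n))"


lemma carrier_QH_mod:
  "carrier (grp (QH_mod A C M) n) = Q_coset A C M n ` {c. Poly_Mapping.keys c \<subseteq> simples C n}"
proof -
  have "carrier (grp (free_data A C M) n) = {c. Poly_Mapping.keys c \<subseteq> simples C n}"
    by (auto simp: free_data_def)
  then show ?thesis
    unfolding QH_mod_def T_mod_def carrier_iterated_quotient Q_coset_def by simp
qed

lemma twisted_map_QH_mod:
  fixes A :: "('k::comm_ring_1, 'l::ring_1, 'r::ring_1, 'h::ring_1) hopf_algebroid"
    and C :: "('k, 'h, 'o, 'f::ab_group_add) hcat"
    and D :: "('k, 'h, 'p, 'g::ab_group_add) hcat"
    and M :: "('k, 'l, 'r, 'h, 'm::ab_group_add) mod_comod"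
  assumes B: "left_bialgebroid A" and M: "left_module_on (scH A) UNIV (scM M) (actM M)"
    and C: "H_category A C" "Q_defined A C M" and D: "H_category A D" "Q_defined A D M"
    and U: "twisted_functor C D p u"
  shows "\<exists>L. twisted_map (QH_mod A C M) (QH_mod A D M) L \<and>
    (\<forall>a n c. Poly_Mapping.keys c \<subseteq> simples C n \<longrightarrow>
      L a n (Q_coset A C M n c) = Q_coset A D M n (frag_extend (\<lambda>s. frag_of (twist p u a n s)) c))"
proof -
  let ?N = "\<lambda>n. generate (grp (free_data A C M) n) (T_rel A C M n)"
  let ?N' = "\<lambda>n. generate (grp (free_data A D M) n) (T_rel A D M n)"
  have "frag_extend (\<lambda>s. frag_of (twist p u a n s)) ` ?N n \<subseteq> ?N' n" for a n
    using twist_T_rel [OF C(1) D(1) U] generate_T_rel [OF C(1), of n M] generate_T_rel [OF D(1), of n M]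
    by (auto simp: free_data_def)
  from twisted_map_iterated_quotient [OF compatible_Q(1) [OF C(1) B M C(2)]
      compatible_Q(2) [OF C(1) B M C(2), unfolded T_mod_def]
      compatible_Q(1) [OF D(1) B M D(2)] compatible_Q(2) [OF D(1) B M D(2), unfolded T_mod_def]
      twisted_map_free [OF C(1) D(1) U] this]
  show ?thesis
    by (simp add: QH_mod_def T_mod_def Q_coset_def) (auto simp: free_data_def)
qed

lemma homotopic_cong:
  assumes "homotopic X Y f g" and "\<And>n x. x \<in> carrier (grp X n) \<Longrightarrow> f n x = f' n x"
  shows "homotopic X Y f' g"
  using assms(1) unfolding homotopic_def by (simp add: assms(2))

text \<open>The maps enter only through their values on free representatives. So the lemma serves
  both composites, with the functors exchanged, and the composite is identified with the operator at
  the constant label True by comparing lists.\<close>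

lemma homotopic_equivalence:
  fixes A :: "('k::comm_ring_1, 'l::ring_1, 'r::ring_1, 'h::ring_1) hopf_algebroid"
    and C :: "('k, 'h, 'o, 'f::ab_group_add) hcat"
    and D :: "('k, 'h, 'p, 'g::ab_group_add) hcat"
    and M :: "('k, 'l, 'r, 'h, 'm::ab_group_add) mod_comod"
  assumes B: "left_bialgebroid A" and M: "left_module_on (scH A) UNIV (scM M) (actM M)"
    and C: "H_category A C" "Q_defined A C M" and D: "H_category A D"
    and F: "H_functor C D Fo Fm" and G: "H_functor D C Go Gm"
    and iso: "invariant_iso_to_id A C (Go \<circ> Fo) (Gm \<circ> Fm) \<eta>"
    and \<phi>: "\<And>n c. Poly_Mapping.keys c \<subseteq> simples C n \<Longrightarrow> \<phi> n (Q_coset A C M n c)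
      = Q_coset A D M n (frag_extend (\<lambda>s. frag_of (twist (\<lambda>_. Fo) (\<lambda>_ _ _ _. Fm) (\<lambda>_. True) n s)) c)"
    and \<psi>: "\<And>n c. Poly_Mapping.keys c \<subseteq> simples D n \<Longrightarrow> \<psi> n (Q_coset A D M n c)
      = Q_coset A C M n (frag_extend (\<lambda>s. frag_of (twist (\<lambda>_. Go) (\<lambda>_ _ _ _. Gm) (\<lambda>_. True) n s)) c)"
  shows "homotopic (Q_mod A C M) (Q_mod A C M) (\<lambda>n x. \<psi> n (\<phi> n x)) (\<lambda>n x. x)"
proof -
  let ?p = "\<lambda>b X. if b then (Go \<circ> Fo) X else X"
  obtain u where U: "twisted_functor C C ?p u"
    and u: "\<And>X Y f. X \<in> Obj C \<Longrightarrow> Y \<in> Obj C \<Longrightarrow> f \<in> Hom C X Y \<Longrightarrow>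
      u True True Y X f = Gm (Fm f) \<and> u False False Y X f = f"
    using twisted_functor_invariant_iso [OF B C(1) _ _ iso] H_functor_Obj [OF F] H_functor_Obj [OF G]
      H_functor_Hom [OF F] H_functor_Hom [OF G] by (auto simp: o_def)
  obtain L where L: "twisted_map (QH_mod A C M) (QH_mod A C M) L"
    and Lc: "\<And>a n c. Poly_Mapping.keys c \<subseteq> simples C n \<Longrightarrow>
      L a n (Q_coset A C M n c) = Q_coset A C M n (frag_extend (\<lambda>s. frag_of (twist ?p u a n s)) c)"
    using twisted_map_QH_mod [OF B M C C U] by blast
  have QH: "para_cyclic_module (QH_mod A C M)"
    using C(2) unfolding Q_defined_def by blast
  have sub: "carrier (grp (Q_mod A C M) n) \<subseteq> carrier (grp (QH_mod A C M) n)" for n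
    unfolding Q_mod_def carrier_cyclic_part by blast
  \<comment> \<open>Label False keeps the objects and \<open>u False False\<close> fixes every
    morphism, so representatives do not move.\<close>
  have False: "L (\<lambda>_. False) n x = x" if x: "x \<in> carrier (grp (Q_mod A C M) n)" for n x
  proof -
    obtain c where c: "Poly_Mapping.keys c \<subseteq> simples C n" "x = Q_coset A C M n c"
      using subsetD [OF sub x] unfolding carrier_QH_mod by blast
    have "frag_extend (\<lambda>s. frag_of (twist ?p u (\<lambda>_. False) n s)) c = frag_extend frag_of c"
    proof (rule frag_extend_eq)
      fix s assume "s \<in> Poly_Mapping.keys c"
      then have s: "(fst s, snd s) \<in> simples C n" using c(1) by auto
      note D = simplesD [OF s]
      have "twist_list ?p u (\<lambda>_. False) n (fst s) = fst s"
        by (rule nth_equalityI)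
           (use D u in \<open>auto simp: nth_twist_list intro!: prod_eqI simp del: One_nat_def\<close>)
      then show "frag_of (twist ?p u (\<lambda>_. False) n s) = frag_of s" by (simp add: twist_def)
    qed
    then show ?thesis using Lc [OF c(1)] c(2) frag_expansion [of c] by simp
  qed
  \<comment> \<open>Label True replaces objects and morphisms by their images under
    \<open>G F\<close>, which is what twisting by \<open>F\<close> and then by \<open>G\<close> does
    entry by entry.\<close>
  have True: "L (\<lambda>_. True) n x = \<psi> n (\<phi> n x)" if x: "x \<in> carrier (grp (Q_mod A C M) n)" for n x
  proof -
    obtain c where c: "Poly_Mapping.keys c \<subseteq> simples C n" "x = Q_coset A C M n c"
      using subsetD [OF sub x] unfolding carrier_QH_mod by blast
    let ?F = "twist (\<lambda>_. Fo) (\<lambda>_ _ _ _. Fm) (\<lambda>_. True) n"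
    let ?G = "twist (\<lambda>_. Go) (\<lambda>_ _ _ _. Gm) (\<lambda>_. True) n"
    have F_simples: "?F s \<in> simples D n" if "s \<in> simples C n" for s :: "('o, 'f, 'm) simple"
      using twist_simples [OF C(1) D twisted_functor_H_functor [OF F], of "fst s" "snd s" n] that
      by (simp add: twist_def)
    have "frag_extend (\<lambda>s. frag_of (twist ?p u (\<lambda>_. True) n s)) c = frag_extend (\<lambda>s. frag_of (?G (?F s))) c"
    proof (rule frag_extend_eq)
      fix s assume "s \<in> Poly_Mapping.keys c"
      then have s: "(fst s, snd s) \<in> simples C n" using c(1) by auto
      note D = simplesD [OF s]
      have "twist_list ?p u (\<lambda>_. True) n (fst s) = fst (?G (?F s))"
        by (rule nth_equalityI)
           (use D u in \<open>auto simp: twist_def nth_twist_list intro!: prod_eqI simp del: One_nat_def\<close>)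
      then show "frag_of (twist ?p u (\<lambda>_. True) n s) = frag_of (?G (?F s))" by (simp add: twist_def)
    qed
    also have "\<dots> = frag_extend (\<lambda>s. frag_of (?G s)) (frag_extend (\<lambda>s. frag_of (?F s)) c)"
      by (simp add: frag_extend_frag_extend)
    finally have eq: "frag_extend (\<lambda>s. frag_of (twist ?p u (\<lambda>_. True) n s)) c
      = frag_extend (\<lambda>s. frag_of (?G s)) (frag_extend (\<lambda>s. frag_of (?F s)) c)" .
    have "Poly_Mapping.keys (frag_extend (\<lambda>s. frag_of (?F s)) c) \<subseteq> simples D n"
      using c(1) F_simples by (intro keys_frag_extend_subset) auto
    then show ?thesis
      using Lc [OF c(1)] \<phi> [OF c(1)] \<psi> c(2) eq by simp
  qed
  have "twisted_map (Q_mod A C M) (Q_mod A C M) L"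
    unfolding Q_mod_def by (rule twisted_map_cyclic_part [OF QH QH L])
  moreover have "para_cyclic_module (Q_mod A C M)"
    using cyclic_module_cyclic_part [OF QH] unfolding cyclic_module_def Q_mod_def by blast
  ultimately have "homotopic (Q_mod A C M) (Q_mod A C M) (L (\<lambda>_. True)) (\<lambda>n x. x)"
    using False by (intro homotopic_twisted)
  then show ?thesis by (rule homotopic_cong) (rule True)
qed

theorem corollary3p17:
  fixes A :: "('k::comm_ring_1, 'l::ring_1, 'r::ring_1, 'h::ring_1) hopf_algebroid"
    and C :: "('k, 'h, 'o, 'f::ab_group_add) hcat"
    and C' :: "('k, 'h, 'p, 'g::ab_group_add) hcat"
    and M :: "('k, 'l, 'r, 'h, 'm::ab_group_add) mod_comod"
  assumes "is_hopf_algebroid A" and "bij (antipode A)"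
    and "H_category A C" and "H_category A C'"
    and "equivariantly_equivalent A C C'"
    and "stable_mod_comod A M"
    and "Q_defined A C M" and "Q_defined A C' M"
  shows "equivariantly_homotopy_equivalent (Q_mod A C M) (Q_mod A C' M)"
proof -
  have B: "left_bialgebroid A" using assms(1) unfolding is_hopf_algebroid_def by blast
  have M: "left_module_on (scH A) UNIV (scM M) (actM M)"
    using assms(6) unfolding stable_mod_comod_def by blast
  obtain Fo Fm Go Gm \<eta> \<theta> where F: "H_functor C C' Fo Fm" and G: "H_functor C' C Go Gm"
    and \<eta>: "invariant_iso_to_id A C (Go \<circ> Fo) (Gm \<circ> Fm) \<eta>"
    and \<theta>: "invariant_iso_to_id A C' (Fo \<circ> Go) (Fm \<circ> Gm) \<theta>"
    using assms(5) unfolding equivariantly_equivalent_def by blast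
  have QH: "para_cyclic_module (QH_mod A C M)" "para_cyclic_module (QH_mod A C' M)"
    using assms(7,8) unfolding Q_defined_def by blast+
  \<comment> \<open>A functor is regarded as a twisted functor that ignores the labels; the constant
    label True chosen below is the one in which the homotopy lemma is phrased.\<close>
  obtain K where K: "twisted_map (QH_mod A C M) (QH_mod A C' M) K"
    and Kc: "\<And>a n c. Poly_Mapping.keys c \<subseteq> simples C n \<Longrightarrow> K a n (Q_coset A C M n c)
      = Q_coset A C' M n (frag_extend (\<lambda>s. frag_of (twist (\<lambda>_. Fo) (\<lambda>_ _ _ _. Fm) a n s)) c)"
    using twisted_map_QH_mod [OF B M assms(3,7,4,8) twisted_functor_H_functor [OF F]] by blast
  obtain L where L: "twisted_map (QH_mod A C' M) (QH_mod A C M) L"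
    and Lc: "\<And>a n c. Poly_Mapping.keys c \<subseteq> simples C' n \<Longrightarrow> L a n (Q_coset A C' M n c)
      = Q_coset A C M n (frag_extend (\<lambda>s. frag_of (twist (\<lambda>_. Go) (\<lambda>_ _ _ _. Gm) a n s)) c)"
    using twisted_map_QH_mod [OF B M assms(4,8,3,7) twisted_functor_H_functor [OF G]] by blast
  have "semi_cyclic_map (Q_mod A C M) (Q_mod A C' M) (K (\<lambda>_. True))"
    unfolding Q_mod_def by (rule semi_cyclic_map_twisted [OF twisted_map_cyclic_part [OF QH K]])
  moreover have "semi_cyclic_map (Q_mod A C' M) (Q_mod A C M) (L (\<lambda>_. True))"
    unfolding Q_mod_def by (rule semi_cyclic_map_twisted [OF twisted_map_cyclic_part [OF QH(2,1) L]])
  moreover have "homotopic (Q_mod A C M) (Q_mod A C M) (\<lambda>n x. L (\<lambda>_. True) n (K (\<lambda>_. True) n x)) (\<lambda>n x. x)"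
    by (rule homotopic_equivalence [OF B M assms(3,7,4) F G \<eta> Kc Lc])
  moreover have "homotopic (Q_mod A C' M) (Q_mod A C' M) (\<lambda>n x. K (\<lambda>_. True) n (L (\<lambda>_. True) n x)) (\<lambda>n x. x)"
    by (rule homotopic_equivalence [OF B M assms(4,8,3) G F \<theta> Lc Kc])
  ultimately show ?thesis
    using cyclic_module_cyclic_part [OF QH(1)] cyclic_module_cyclic_part [OF QH(2)]
    unfolding equivariantly_homotopy_equivalent_def Q_mod_def by blast
qed

end
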